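(* Let $E_1(z),E_2(z)$ be Hermite-Biehler functions without real zeros, with phase functions $\phi_1(x),\phi_2(x)$ respectively, and let $K_1(z,w),K_2(z,w)$ be the reproducing kernels of the de Branges spaces $H(E_1),H(E_2)$. Let $\rho_1^{E_j}$ denote the first intensity function of the de Branges GAF associated with $H(E_j)$, $j=1,2$. If $$\rho_1^{E_1}(x)=\rho_1^{E_2}(x)\quad\text{for all }x\in\mathbb{R},$$ then there exists an entire function $S(z)$ without zeros such that $$K_2(z,w)=S(z)K_1(z,w)\overline{S(w)},$$ and the map $f\mapsto Sf$ is an isometry from $H(E_1)$ to $H(E_2)$.
   Context: Hermite-Biehler function: an entire function $E$ with $|E(z)|>|E^*(z)|$ for $\operatorname{Im} z>0$, where $f^*(z)=\overline{f(\bar z)}$. All Hermite-Biehler functions considered have no real zeros. De Branges space: $H(E)=\{f\text{ entire}: f/E,\ f^*/E\in H^2(\mathbb{C}_+)\}$, where $H^2(\mathbb{C}_+)$ is the Hardy space of the upper half-plane, with norm $\|f\|_{H(E)}^2=\int_{-\infty}^{\infty}|f(x)/E(x)|^2\,dx$. It is a Hilbert space with reproducing kernel $$K(z,w)=\frac{i}{2\pi}\,\frac{E(z)\overline{E(w)}-E^*(z)\overline{E^*(w)}}{z-\overline{w}}.$$ Phase function: a smooth increasing function $\phi:\mathbb{R}\to\mathbb{R}$ with $E(x)=|E(x)|e^{-i\phi(x)}$ for $x\in\mathbb{R}$; it satisfies $\phi'>0$ and $K(x,x)=\frac1\pi\phi'(x)|E(x)|^2$. Normalized reproducing kernels: for $x,y\in\mathbb{R}$,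 $k_y(x)=\frac{K(x,y)}{K(y,y)^{1/2}}=\frac{|E(x)|}{\sqrt{\pi\phi'(y)}}\frac{\sin(\phi(x)-\phi(y))}{x-y}$. Orthonormal basis of reproducing kernels: a family $\{k_{\omega_n}\}$ which is an orthonormal basis of $H(E)$, where, for some $\alpha\in[0,\pi)$, $\{\omega_n\}$ consists of all real points with $\phi(\omega_n)=\alpha+\pi n$, $n\in\mathbb{Z}$ (only those $n$ for which such a point exists). By a theorem of de Branges, for all $\alpha\in[0,\pi)$ except at most one this family is an orthonormal basis. De Branges GAF: $F(x)=\sum_n a_n k_{\omega_n}(x)$, where the $a_n$ are i.i.d. real standard normal random variables and $\{k_{\omega_n}\}$ is such an orthonormal basis. The series converges almost surely uniformly on compact subsets of $\mathbb{C}$, and $\mathbb{E}[F(x)F(y)]=K(x,y)$ for real $x,y$; in particular the distribution of $(F(x))_{x\in\mathbb{R}}$ does not depend on the choice of the basis. First intensity function (with respect to Lebesgue measure): the function $\rho_1\ge 0$ on $\mathbb{R}$ with $\mathbb{E}[\#(Z_{\mathbb{R}}(F)\cap D)]=\int_D\rho_1(x)\,dx$ for all Borel sets $D\subset\mathbb{R}$, where $Z_{\mathbb{R}}(F)$ is the set of real zeros of $F$ (pointwise statements refer to the continuous version of this density). *)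

theory Defs
  imports "HOL-Complex_Analysis.Complex_Analysis" "HOL-Probability.Probability"
begin

definition entire :: "(complex \<Rightarrow> complex) \<Rightarrow> bool" where
  "entire f \<longleftrightarrow> f holomorphic_on UNIV"

definition sharp :: "(complex \<Rightarrow> complex) \<Rightarrow> complex \<Rightarrow> complex" where
  "sharp f z = cnj (f (cnj z))"

definition hermite_biehler :: "(complex \<Rightarrow> complex) \<Rightarrow> bool" where
  "hermite_biehler E \<longleftrightarrow> entire E \<and> (\<forall>z. Im z > 0 \<longrightarrow> cmod (E z) > cmod (sharp E z))"

definition no_real_zeros :: "(complex \<Rightarrow> complex) \<Rightarrow> bool" where
  "no_real_zeros E \<longleftrightarrow> (\<forall>x::real. E (of_real x) \<noteq> 0)"

text \<open>The Hardy space of the upper half-plane. Only the values of a function on the open upper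
  half-plane matter; the functions themselves are total.\<close>

definition hardy2 :: "(complex \<Rightarrow> complex) set" where
  "hardy2 = {g. g holomorphic_on {z. Im z > 0} \<and>
     (SUP y\<in>{0<..}. \<integral>\<^sup>+x. ennreal ((cmod (g (Complex x y)))\<^sup>2) \<partial>lborel) < \<infinity>}"

definition deBranges_space :: "(complex \<Rightarrow> complex) \<Rightarrow> (complex \<Rightarrow> complex) set" where
  "deBranges_space E =
     {f. entire f \<and> (\<lambda>z. f z / E z) \<in> hardy2 \<and> (\<lambda>z. sharp f z / E z) \<in> hardy2}"

definition dB_inner ::
  "(complex \<Rightarrow> complex) \<Rightarrow> (complex \<Rightarrow> complex) \<Rightarrow> (complex \<Rightarrow> complex) \<Rightarrow> complex" where
  "dB_inner E f g =
     (LINT x|lborel. (f (of_real x) / E (of_real x)) * cnj (g (of_real x) / E (of_real x)))"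

definition dB_norm :: "(complex \<Rightarrow> complex) \<Rightarrow> (complex \<Rightarrow> complex) \<Rightarrow> real" where
  "dB_norm E f = sqrt (LINT x|lborel. (cmod (f (of_real x) / E (of_real x)))\<^sup>2)"

text \<open>The reproducing property determines the kernel uniquely. By a theorem of de Branges it is
  $K(z,w) = \frac{i}{2\pi} (E(z)\overline{E(w)} - E^*(z)\overline{E^*(w)}) / (z - \overline{w})$,
  extended continuously to $z = \overline{w}$.\<close>

definition reproducing_kernel ::
  "(complex \<Rightarrow> complex) \<Rightarrow> (complex \<Rightarrow> complex \<Rightarrow> complex) \<Rightarrow> bool" where
  "reproducing_kernel E K \<longleftrightarrow>
     (\<forall>w. (\<lambda>z. K z w) \<in> deBranges_space E \<and>
          (\<forall>f\<in>deBranges_space E. f w = dB_inner E f (\<lambda>z. K z w)))"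

definition phase_function :: "(complex \<Rightarrow> complex) \<Rightarrow> (real \<Rightarrow> real) \<Rightarrow> bool" where
  "phase_function E \<phi> \<longleftrightarrow>
     (\<forall>n. (deriv ^^ n) \<phi> differentiable_on UNIV) \<and> strict_mono \<phi> \<and>
     (\<forall>x. E (of_real x) = of_real (cmod (E (of_real x))) * exp (- \<i> * of_real (\<phi> x)))"

definition normalized_kernel ::
  "(complex \<Rightarrow> complex \<Rightarrow> complex) \<Rightarrow> real \<Rightarrow> complex \<Rightarrow> complex" where
  "normalized_kernel K y z = K z (of_real y) / of_real (sqrt (Re (K (of_real y) (of_real y))))"

text \<open>The phase may be bounded above or below, so the points $\omega_n$ exist only for some
  integers n; \<open>phase_point\<close> is meaningful on \<open>phase_index\<close> only.\<close>

definition phase_index :: "(real \<Rightarrow> real) \<Rightarrow> real \<Rightarrow> int set" where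
  "phase_index \<phi> \<alpha> = {n. \<exists>x. \<phi> x = \<alpha> + pi * of_int n}"

definition phase_point :: "(real \<Rightarrow> real) \<Rightarrow> real \<Rightarrow> int \<Rightarrow> real" where
  "phase_point \<phi> \<alpha> n = (THE x. \<phi> x = \<alpha> + pi * of_int n)"

definition dB_orthonormal_basis ::
  "(complex \<Rightarrow> complex) \<Rightarrow> int set \<Rightarrow> (int \<Rightarrow> complex \<Rightarrow> complex) \<Rightarrow> bool" where
  "dB_orthonormal_basis E I k \<longleftrightarrow>
     (\<forall>n\<in>I. k n \<in> deBranges_space E) \<and>
     (\<forall>m\<in>I. \<forall>n\<in>I. dB_inner E (k m) (k n) = (if m = n then 1 else 0)) \<and>
     (\<forall>f\<in>deBranges_space E. \<forall>\<epsilon>>0. \<exists>J c. finite J \<and> J \<subseteq> I \<and>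
        dB_norm E (\<lambda>z. f z - (\<Sum>n\<in>J. c n * k n z)) < \<epsilon>)"

text \<open>The series $\sum_n a_n k_{\omega_n}$ need not converge absolutely (for the Paley--Wiener
  space the kernels decay like $1/n$), so it is taken as the limit of its symmetric partial sums,
  almost surely uniformly on compact sets.\<close>

definition deBranges_GAF ::
  "'a measure \<Rightarrow> (complex \<Rightarrow> complex) \<Rightarrow> (complex \<Rightarrow> complex \<Rightarrow> complex) \<Rightarrow> (real \<Rightarrow> real) \<Rightarrow>
     ('a \<Rightarrow> complex \<Rightarrow> complex) \<Rightarrow> bool" where
  "deBranges_GAF M E K \<phi> F \<longleftrightarrow>
     prob_space M \<and>
     (\<exists>\<alpha> a. 0 \<le> \<alpha> \<and> \<alpha> < pi \<and>
        dB_orthonormal_basis E (phase_index \<phi> \<alpha>)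
          (\<lambda>n. normalized_kernel K (phase_point \<phi> \<alpha> n)) \<and>
        prob_space.indep_vars M (\<lambda>_. borel) a (phase_index \<phi> \<alpha>) \<and>
        (\<forall>n\<in>phase_index \<phi> \<alpha>. distributed M lborel (a n) std_normal_density) \<and>
        (AE \<omega> in M. \<forall>C. compact C \<longrightarrow>
           uniform_limit C
             (\<lambda>N z. \<Sum>n\<in>{n \<in> phase_index \<phi> \<alpha>. \<bar>n\<bar> \<le> int N}.
                of_real (a n \<omega>) * normalized_kernel K (phase_point \<phi> \<alpha> n) z)
             (F \<omega>) sequentially))"

definition real_zeros :: "(complex \<Rightarrow> complex) \<Rightarrow> real set" where
  "real_zeros f = {x. f (of_real x) = 0}"

definition first_intensity ::
  "'a measure \<Rightarrow> ('a \<Rightarrow> complex \<Rightarrow> complex) \<Rightarrow> (real \<Rightarrow> real) \<Rightarrow> bool" where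
  "first_intensity M F \<rho> \<longleftrightarrow>
     continuous_on UNIV \<rho> \<and> (\<forall>x. \<rho> x \<ge> 0) \<and>
     (\<forall>D\<in>sets borel.
        (\<integral>\<^sup>+\<omega>. emeasure (count_space UNIV) (real_zeros (F \<omega>) \<inter> D) \<partial>M) =
        (\<integral>\<^sup>+x\<in>D. ennreal (\<rho> x) \<partial>lborel))"

definition dB_isometry ::
  "(complex \<Rightarrow> complex) \<Rightarrow> (complex \<Rightarrow> complex) \<Rightarrow>
     ((complex \<Rightarrow> complex) \<Rightarrow> complex \<Rightarrow> complex) \<Rightarrow> bool" where
  "dB_isometry E1 E2 T \<longleftrightarrow>
     T ` deBranges_space E1 \<subseteq> deBranges_space E2 \<and>
     (\<forall>f\<in>deBranges_space E1. \<forall>g\<in>deBranges_space E1.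
        dB_norm E2 (\<lambda>z. T f z - T g z) = dB_norm E1 (\<lambda>z. f z - g z))"

end

theory Submission
  imports Defs "HOL-Real_Asymp.Real_Asymp"
begin

text \<open>The zeros of the Gaussian function only see the correlation
\<open>r(x,y) = K(x,y) / sqrt (K(x,x) K(y,y))\<close> of its values at real points, and for a de Branges space
the phase gives it explicitly: \<open>r(x,y) = sin (\<phi>(x) - \<phi>(y)) / ((x - y) sqrt (\<phi>'(x) \<phi>'(y)))\<close>.
The functions \<open>u = cos \<phi> / sqrt \<phi>'\<close> and \<open>w = sin \<phi> / sqrt \<phi>'\<close> solve \<open>y'' = - Q y\<close>, where
\<open>Q\<close> is half the Schwarzian derivative of \<open>tan \<phi>\<close>, and \<open>(x - y) r(x,y) = w(x) u(y) - u(x) w(y)\<close>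
is the solution in \<open>x\<close> that vanishes at \<open>y\<close> with slope 1.  Hence \<open>1 - r(x,y)\<close> is
\<open>Q (x - y)\<^sup>2 / 6\<close> to leading order.

A centred Gaussian pair with correlation \<open>r\<close> has opposite signs with probability
\<open>arccos r / \<pi>\<close>.  Comparing zeros with sign changes along fine partitions therefore gives the
intensity \<open>sqrt (Q / 3) / \<pi>\<close> (\<open>intensity_formula\<close>).  So the intensity determines \<open>Q\<close>: two spaces with
the same intensity belong to the same linear equation \<open>y'' = - Q y\<close>, and their pairs \<open>(u,w)\<close> differ by
a constant real matrix of determinant 1, the Wronskians being equal (\<open>phase_curves_related\<close>).

Written in terms of \<open>E = A - i B\<close>, this says that on the real line \<open>E\<^sub>2 = s (\<alpha> E\<^sub>1 + \<beta> E\<^sub>1\<^sup>*)\<close> with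
\<open>s\<close> positive and \<open>\<bar>\<alpha>\<bar>\<^sup>2 - \<bar>\<beta>\<bar>\<^sup>2 = 1\<close>.  The function \<open>G = \<alpha> E\<^sub>1 + \<beta> E\<^sub>1\<^sup>*\<close> has no zeros in the closed
upper half-plane and has the same kernel as \<open>E\<^sub>1\<close>; the quotient \<open>S = E\<^sub>2 / G\<close> extends by reflection to an
entire function without zeros, and the kernel formula turns \<open>E\<^sub>2 = S G\<close> into the claim on the kernels.
Multiplication by \<open>S\<close> preserves inner products with kernels, which span a dense subspace, so it is
an isometry.

Two classical facts are proved on the way: the explicit formula for the reproducing kernel
(\<open>K_formula\<close>), from a Cauchy formula for Hardy functions that are continuous up to the real line
(\<open>hardy2_cauchy\<close>), and the Kac--Rice type statement \<open>intensity_eq_sign_change_rate\<close>.\<close>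

section \<open>Cauchy formula in the Hardy space of the upper half-plane\<close>

lemma nn_integral_cauchy_kernel:
  assumes b: "b > (0::real)"
  shows "(\<integral>\<^sup>+x. ennreal (1 / ((x - a)\<^sup>2 + b\<^sup>2)) \<partial>lborel) = ennreal (pi / b)"
proof -
  have base: "(\<integral>\<^sup>+x. ennreal (inverse (1 + x\<^sup>2)) \<partial>lborel) = ennreal pi"
  proof -
    have "(\<integral>\<^sup>+x. ennreal (inverse (1 + x\<^sup>2)) \<partial>lborel) = ennreal (LINT x|lborel. inverse (1 + x\<^sup>2))"
      using integrable_inverse_1_plus_square
      by (intro nn_integral_eq_integral) (auto simp: set_integrable_def add_nonneg_nonneg)
    also have "(LINT x|lborel. inverse (1 + x\<^sup>2)) = pi"
      using LBINT_inverse_1_plus_square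
      by (simp add: interval_lebesgue_integral_def set_lebesgue_integral_def)
    finally show ?thesis .
  qed
  have "(\<integral>\<^sup>+x. ennreal (1 / ((x - a)\<^sup>2 + b\<^sup>2)) \<partial>lborel)
      = ennreal b * (\<integral>\<^sup>+x. ennreal (1 / ((a + b * x - a)\<^sup>2 + b\<^sup>2)) \<partial>lborel)"
    using b by (subst nn_integral_real_affine[where c = b and t = a]) auto
  also have "\<dots> = (\<integral>\<^sup>+x. ennreal b * ennreal (1 / ((a + b * x - a)\<^sup>2 + b\<^sup>2)) \<partial>lborel)"
    by (subst nn_integral_cmult) auto
  also have "\<dots> = (\<integral>\<^sup>+x. ennreal (1 / b) * ennreal (inverse (1 + x\<^sup>2)) \<partial>lborel)"
  proof (intro nn_integral_cong)
    fix x :: real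
    have "b * (1 / ((a + b * x - a)\<^sup>2 + b\<^sup>2)) = (1/b) * inverse (1 + x\<^sup>2)"
    proof -
      have "(a + b * x - a)\<^sup>2 + b\<^sup>2 = b * (b * (1 + x\<^sup>2))"
        by (simp add: power2_eq_square algebra_simps)
      then show ?thesis unfolding \<open>(a + b * x - a)\<^sup>2 + b\<^sup>2 = b * (b * (1 + x\<^sup>2))\<close> using b by (simp add: inverse_eq_divide)
    qed
    then show "ennreal b * ennreal (1 / ((a + b * x - a)\<^sup>2 + b\<^sup>2))
        = ennreal (1 / b) * ennreal (inverse (1 + x\<^sup>2))"
      using b by (simp flip: ennreal_mult' ennreal_mult)
  qed
  also have "\<dots> = ennreal (1 / b) * ennreal pi"
    by (subst nn_integral_cmult) (auto simp: base)
  also have "\<dots> = ennreal (pi / b)"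
    using b by (simp flip: ennreal_mult)
  finally show ?thesis .
qed

abbreviation "line_energy g y \<equiv> \<integral>\<^sup>+x. ennreal ((cmod (g (Complex x y)))\<^sup>2) \<partial>lborel"

lemma hardy2_bound:
  assumes "g \<in> hardy2"
  obtains C where "C \<ge> 0"
    "\<And>y. y > 0 \<Longrightarrow> line_energy g y \<le> ennreal C"
proof -
  let ?S = "SUP y\<in>{0<..}. \<integral>\<^sup>+x. ennreal ((cmod (g (Complex x y)))\<^sup>2) \<partial>lborel"
  have "?S < \<infinity>" using assms by (simp add: hardy2_def)
  then have e: "?S = ennreal (enn2real ?S)" by simp
  show ?thesis
    by (rule that[of "enn2real ?S"]) (use e in \<open>auto simp flip: e intro: SUP_upper\<close>)
qed

text \<open>The bound extends to the real line by Fatou's lemma, since the boundary values are pointwise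
limits of \<open>g (x + i / n)\<close>.\<close>

lemma hardy2_bound_closed:
  assumes g: "g \<in> hardy2" and m [measurable]: "g \<in> borel_measurable borel"
    and c: "continuous_on {z. Im z \<ge> 0} g"
  obtains C where "C \<ge> 0"
    "\<And>y. y \<ge> 0 \<Longrightarrow> line_energy g y \<le> ennreal C"
proof -
  obtain C where C: "C \<ge> 0" 
    "\<And>y. y > 0 \<Longrightarrow> line_energy g y \<le> ennreal C"
    using hardy2_bound[OF g] by blast
  have "line_energy g 0 \<le> ennreal C"
  proof -
    have cx [measurable]: "(\<lambda>x. Complex x y) \<in> borel_measurable borel" for y
      by (intro borel_measurable_continuous_onI) (auto simp: Complex_eq intro!: continuous_intros)
    have lim: "(\<lambda>n. ennreal ((cmod (g (Complex x (1 / real (Suc n)))))\<^sup>2)) 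
        \<longlonglongrightarrow> ennreal ((cmod (g (Complex x 0)))\<^sup>2)" for x
    proof (intro tendsto_ennrealI tendsto_power tendsto_norm)
      have "(\<lambda>n. Complex x (1 / real (Suc n))) \<longlonglongrightarrow> Complex x 0"
        using LIMSEQ_inverse_real_of_nat
        by (intro tendsto_Complex tendsto_const) (auto simp: inverse_eq_divide)
      from continuous_on_tendsto_compose[OF c this]
      show "(\<lambda>n. g (Complex x (1 / real (Suc n)))) \<longlonglongrightarrow> g (Complex x 0)"
        by auto
    qed
    have "line_energy g 0
       = (\<integral>\<^sup>+x. liminf (\<lambda>n. ennreal ((cmod (g (Complex x (1 / real (Suc n)))))\<^sup>2)) \<partial>lborel)"
      by (intro nn_integral_cong) (metis lim lim_imp_Liminf trivial_limit_sequentially)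
    also have "\<dots> \<le> liminf (\<lambda>n. \<integral>\<^sup>+x. ennreal ((cmod (g (Complex x (1 / real (Suc n)))))\<^sup>2) \<partial>lborel)"
      by (rule nn_integral_liminf) measurable
    also have "\<dots> \<le> liminf (\<lambda>n. ennreal C)"
      by (intro Liminf_mono always_eventually allI C(2)) auto
    also have "\<dots> = ennreal C" by (simp add: Liminf_const)
    finally show ?thesis .
  qed
  then show ?thesis using C that by (metis order_le_less)
qed

text \<open>A Hardy function need not decay along every vertical segment, but it is square integrable over
the strip of height \<open>Y\<close>, so the integrals over vertical segments cannot stay away from 0. This
provides rectangles whose vertical sides contribute little to a contour integral.\<close>

lemma hardy2_good_verticals:
  assumes m [measurable]: "g \<in> borel_measurable borel" and Y: "Y > 0" and C: "C \<ge> 0"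
    and bd: "\<And>y. y \<ge> 0 \<Longrightarrow> line_energy g y \<le> ennreal C"
    and e: "e > 0"
  obtains R where "R \<ge> R0"
    "(\<integral>\<^sup>+y\<in>{0..Y}. ennreal ((cmod (g (Complex R y)))\<^sup>2) \<partial>lborel) < ennreal e"
    "(\<integral>\<^sup>+y\<in>{0..Y}. ennreal ((cmod (g (Complex (-R) y)))\<^sup>2) \<partial>lborel) < ennreal e"
proof -
  have cx [measurable]: "(\<lambda>p. Complex (fst p) (snd p)) \<in> borel_measurable (lborel \<Otimes>\<^sub>M lborel)"
    unfolding Complex_eq by measurable
  define s where "s R = (\<integral>\<^sup>+y\<in>{0..Y}. ennreal ((cmod (g (Complex R y)))\<^sup>2) \<partial>lborel)" for R
  have mm [measurable]: "(\<lambda>(R,y). ennreal ((cmod (g (Complex R y)))\<^sup>2) * indicator {0..Y} y) \<in> borel_measurable (lborel \<Otimes>\<^sub>M lborel)"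
    unfolding case_prod_beta by measurable
  have sm [measurable]: "s \<in> borel_measurable lborel"
    unfolding s_def by measurable
  have "(\<integral>\<^sup>+R. s R \<partial>lborel) = (\<integral>\<^sup>+y. (\<integral>\<^sup>+R. ennreal ((cmod (g (Complex R y)))\<^sup>2) * indicator {0..Y} y \<partial>lborel) \<partial>lborel)"
    unfolding s_def by (rule lborel_pair.Fubini'[OF mm, symmetric])
  also have "\<dots> \<le> (\<integral>\<^sup>+y. ennreal C * indicator {0..Y} y \<partial>lborel)"
    by (intro nn_integral_mono) (auto simp: indicator_def intro: bd)
  also have "\<dots> = ennreal C * ennreal Y"
    using Y by (subst nn_integral_cmult_indicator) auto
  also have "\<dots> < \<infinity>" by (simp flip: ennreal_mult' add: C ennreal_mult_less_top)
  finally have fin: "(\<integral>\<^sup>+R. s R \<partial>lborel) < \<infinity>" .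
  have fin2: "(\<integral>\<^sup>+R. s (-R) \<partial>lborel) < \<infinity>"
    using fin by (subst (asm) nn_integral_real_affine[where c = "-1" and t = 0]) auto
  have "\<exists>R\<ge>R0. s R + s (-R) < ennreal e"
  proof (rule ccontr)
    assume "\<not> ?thesis"
    then have ge: "\<And>R. R \<ge> R0 \<Longrightarrow> ennreal e \<le> s R + s (-R)" by (auto simp: not_less)
    have "ennreal e * emeasure lborel {R0..} = (\<integral>\<^sup>+R. ennreal e * indicator {R0..} R \<partial>lborel)"
      by (subst nn_integral_cmult_indicator) auto
    also have "\<dots> \<le> (\<integral>\<^sup>+R. s R + s (-R) \<partial>lborel)"
      by (intro nn_integral_mono) (auto simp: indicator_def intro: ge)
    also have "\<dots> < \<infinity>" using fin fin2 by (subst nn_integral_add) auto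
    also have "emeasure lborel {R0..} = \<infinity>"
    proof (rule ccontr)
      assume "emeasure lborel {R0..} \<noteq> \<infinity>"
      then obtain r where r: "r \<ge> 0" "emeasure lborel {R0..} = ennreal r" 
        by (cases "emeasure lborel {R0..}") auto
      have "ennreal (r + 1) = emeasure lborel {R0..R0 + (r + 1)}" using r by auto
      also have "\<dots> \<le> emeasure lborel {R0..}" by (intro emeasure_mono) auto
      finally show False using r by simp
    qed
    finally show False using e by (simp add: ennreal_mult_top)
  qed
  then obtain R where R: "R \<ge> R0" "s R + s (-R) < ennreal e" by blast
  show ?thesis
  proof (rule that[OF R(1)])
    show "(\<integral>\<^sup>+y\<in>{0..Y}. ennreal ((cmod (g (Complex R y)))\<^sup>2) \<partial>lborel) < ennreal e"
      using R(2) unfolding s_def[symmetric] by (rule le_less_trans[rotated]) (simp add: add_increasing2)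
    show "(\<integral>\<^sup>+y\<in>{0..Y}. ennreal ((cmod (g (Complex (-R) y)))\<^sup>2) \<partial>lborel) < ennreal e"
      using R(2) unfolding s_def[symmetric] by (rule le_less_trans[rotated]) (simp add: add_increasing)
  qed
qed

lemma contour_integral_linepath_same_Im:
  assumes "a < b"
  shows "contour_integral (linepath (Complex a c) (Complex b c)) f = integral {a..b} (\<lambda>x. f (Complex x c))"
proof -
  have "contour_integral (linepath (Complex a c) (Complex b c)) f =
         (Complex b c - Complex a c) * integral {0..1} (\<lambda>x. f (linepath (Complex a c) (Complex b c) x))"
    by (simp add: contour_integral_integral)
  also have "Complex b c - Complex a c = of_real (b - a)"
    by (simp add: Complex_eq algebra_simps)
  also have "integral {0..1} (\<lambda>x. f (linepath (Complex a c) (Complex b c) x)) =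
             integral {0..1} (\<lambda>x. f (Complex (linepath a b x) c))"
    by (simp add: linepath_def Complex_eq scaleR_conv_of_real algebra_simps)
  also have "\<dots> = integral {0..(b - a) / (b - a)} (\<lambda>x. f (Complex (a + (b - a) * x) c))"
    using \<open>a < b\<close> by (simp add: algebra_simps linepath_def)
  also have "{0..(b - a) / (b - a)} = (\<lambda>x. x / (b - a)) ` {0..b - a}"
    using \<open>a < b\<close> by simp
  also have "integral \<dots> (\<lambda>x. f (Complex (a + (b - a) * x) c)) =
             integral {a-a..b-a} (\<lambda>x. f (Complex (x + a) c)) / of_real (b - a)"
    using \<open>a < b\<close> by (subst integral_stretch_real) (auto simp: scaleR_conv_of_real add_ac)
  also have "\<dots> = integral {a..b} (\<lambda>x. f (Complex x c)) / of_real (b - a)"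
    by (subst integral_shift_real_ivl) (rule refl)
  finally show ?thesis
    using \<open>a < b\<close> by simp
qed

lemma interior_closed_upper_half_plane: "interior {z. 0 \<le> Im z} = {z. 0 < Im z}"
  using interior_halfspace_ge[of \<i> 0] by (simp add: inner_complex_def)

text \<open>The four sides of the contour integral are written as integrals over real intervals, so that
the limits of infinite width and infinite height can be taken side by side.\<close>

lemma half_plane_rectangle:
  assumes hol: "g holomorphic_on {z. Im z > 0}" and cont: "continuous_on {z. Im z \<ge> 0} g"
    and c: "Im c \<noteq> 0" and R: "R > \<bar>Re c\<bar>" and Y: "Y > \<bar>Im c\<bar>"
  defines "G \<equiv> \<lambda>z. g z / (z - c)"
  shows "integral {-R..R} (\<lambda>x. G (Complex x 0)) + \<i> * integral {0..Y} (\<lambda>y. G (Complex R y))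
     - integral {-R..R} (\<lambda>x. G (Complex x Y)) - \<i> * integral {0..Y} (\<lambda>y. G (Complex (-R) y))
     = (if Im c > 0 then 2 * pi * \<i> * g c else 0)"
proof -
  let ?S = "{z. Im z \<ge> 0}"
  let ?a = "Complex (-R) 0" and ?b = "Complex R Y"
  let ?p = "rectpath ?a ?b"
  have R0: "R > 0" and Y0: "Y > 0" using R Y by linarith+
  have convex: "convex ?S" by (rule convex_halfspace_Im_ge)
  have fd: "g field_differentiable at x" if "x \<in> interior ?S - {}" for x
  proof -
    have "x \<in> {z. Im z > 0}" "open {z. Im z > 0}" 
      using that by (auto simp: interior_closed_upper_half_plane open_halfspace_Im_gt)
    then show ?thesis using hol holomorphic_on_imp_differentiable_at by blast
  qed
  have img: "path_image ?p = {z. Re z \<in> {-R, R} \<and> Im z \<in> {0..Y}} \<union> {z. Im z \<in> {0, Y} \<and> Re z \<in> {-R..R}}"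
    using R0 Y0 by (subst path_image_rectpath) auto
  have imgS: "path_image ?p \<subseteq> ?S - {c}" 
    unfolding img using R0 Y0 R Y c by auto
  have I: "(G has_contour_integral (if Im c > 0 then 2 * pi * \<i> * g c else 0)) ?p"
  proof (cases "Im c > 0")
    case True
    have "c \<in> box ?a ?b" using True R Y by (auto simp: in_box_complex_iff)
    then have "winding_number ?p c = 1" by (rule winding_number_rectpath)
    with Cauchy_integral_formula_convex[OF convex finite.emptyI cont fd, of c ?p] imgS True
    show ?thesis by (simp add: G_def interior_closed_upper_half_plane)
  next
    case False
    then have ne: "z \<noteq> c" if "Im z \<ge> 0" for z using that c by auto
    have "(G has_contour_integral 0) ?p"
    proof (rule Cauchy_theorem_convex[OF _ convex finite.emptyI])
      show "continuous_on ?S G" unfolding G_def using ne by (intro continuous_intros cont) auto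
      show "G field_differentiable at x" if "x \<in> interior ?S - {}" for x
        unfolding G_def using that ne[of x] interior_subset[of ?S]
        by (intro derivative_intros fd) auto
    qed (use imgS in auto)
    with False show ?thesis by simp
  qed
  have contG: "continuous_on (path_image ?p) G"
    unfolding G_def using imgS by (intro continuous_intros continuous_on_subset[OF cont]) auto
  have segs: "closed_segment (Complex (-R) 0) (Complex R 0) \<subseteq> path_image ?p"
      "closed_segment (Complex R 0) (Complex R Y) \<subseteq> path_image ?p"
      "closed_segment (Complex R Y) (Complex (-R) Y) \<subseteq> path_image ?p"
      "closed_segment (Complex (-R) Y) (Complex (-R) 0) \<subseteq> path_image ?p"
    by (auto simp: rectpath_def Let_def path_image_join)
  have ci: "G contour_integrable_on linepath (Complex (-R) 0) (Complex R 0)"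
    "G contour_integrable_on linepath (Complex R 0) (Complex R Y)"
    "G contour_integrable_on linepath (Complex R Y) (Complex (-R) Y)"
    "G contour_integrable_on linepath (Complex (-R) Y) (Complex (-R) 0)"
    using segs by (auto intro!: contour_integrable_continuous_linepath intro: continuous_on_subset[OF contG])
  have "contour_integral ?p G = 
     contour_integral (linepath (Complex (-R) 0) (Complex R 0)) G +
     (contour_integral (linepath (Complex R 0) (Complex R Y)) G +
     (contour_integral (linepath (Complex R Y) (Complex (-R) Y)) G +
     contour_integral (linepath (Complex (-R) Y) (Complex (-R) 0)) G))"
    unfolding rectpath_def Let_def using ci
    by (simp add: contour_integrable_joinI)
  also have "contour_integral (linepath (Complex R Y) (Complex (-R) Y)) G = - contour_integral (linepath (Complex (-R) Y) (Complex R Y)) G"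
    using segs(3) by (intro contour_integral_reverse_linepath continuous_on_subset[OF contG]) auto
  also have "contour_integral (linepath (Complex (-R) Y) (Complex (-R) 0)) G = - contour_integral (linepath (Complex (-R) 0) (Complex (-R) Y)) G"
    using segs(4) by (intro contour_integral_reverse_linepath continuous_on_subset[OF contG]) auto
  finally show ?thesis
    using contour_integral_unique[OF I] R0 Y0
    by (simp add: contour_integral_linepath_same_Im contour_integral_linepath_same_Re[where a = 0 and b = Y])
qed

text \<open>The parameter \<open>t\<close> takes the place of the Cauchy--Schwarz inequality: it is 1 where only
finiteness matters, and small where the weight of the \<open>L\<^sup>2\<close> norm of \<open>u\<close> has to be small.\<close>

lemma amgm_div:
  assumes "t > 0"
  shows "cmod (u / v) \<le> (t * (cmod u)\<^sup>2 + (1/t) * (1 / (cmod v)\<^sup>2)) / 2"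
proof -
  have "0 \<le> (sqrt t * cmod u - (1 / sqrt t) * (1 / cmod v))\<^sup>2" by simp
  also have "\<dots> = t * (cmod u)\<^sup>2 + (1/t) * (1 / (cmod v)\<^sup>2) - 2 * (cmod u / cmod v)"
    using assms by (simp add: power2_diff power_mult_distrib power_divide field_simps)
  finally show ?thesis by (simp add: norm_divide mult.commute)
qed

lemma measurable_Complex_line [measurable]: "(\<lambda>x. Complex x y) \<in> borel_measurable borel"
  by (intro borel_measurable_continuous_onI) (auto simp: Complex_eq intro!: continuous_intros)
lemma measurable_Complex_line' [measurable]: "(\<lambda>y. Complex x y) \<in> borel_measurable borel"
  by (intro borel_measurable_continuous_onI) (auto simp: Complex_eq intro!: continuous_intros)

lemma horizontal_line_bound:
  assumes [measurable]: "g \<in> borel_measurable borel" and C: "C \<ge> 0"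
    and bd: "line_energy g y \<le> ennreal C"
    and y: "y \<noteq> Im c" and t: "t > 0"
  shows "(\<integral>\<^sup>+x. ennreal (cmod (g (Complex x y) / (Complex x y - c))) \<partial>lborel)
     \<le> ennreal ((t * C + pi / (t * \<bar>y - Im c\<bar>)) / 2)"
proof -
  let ?b = "\<bar>y - Im c\<bar>"
  have b: "?b > 0" using y by simp
  have sq: "(cmod (Complex x y - c))\<^sup>2 = (x - Re c)\<^sup>2 + ?b\<^sup>2" for x
    by (simp add: cmod_power2)
  have "(\<integral>\<^sup>+x. ennreal (cmod (g (Complex x y) / (Complex x y - c))) \<partial>lborel)
     \<le> (\<integral>\<^sup>+x. ennreal (t/2) * ennreal ((cmod (g (Complex x y)))\<^sup>2) + ennreal (1/(2*t)) * ennreal (1 / ((x - Re c)\<^sup>2 + ?b\<^sup>2)) \<partial>lborel)"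
  proof (intro nn_integral_mono)
    fix x
    have "cmod (g (Complex x y) / (Complex x y - c)) \<le> (t/2) * (cmod (g (Complex x y)))\<^sup>2 + 1/(2*t) * (1 / ((x - Re c)\<^sup>2 + ?b\<^sup>2))"
      using amgm_div[OF t, of "g (Complex x y)" "Complex x y - c"] by (simp add: sq add_divide_distrib mult_ac)
    then show "ennreal (cmod (g (Complex x y) / (Complex x y - c))) \<le>
       ennreal (t/2) * ennreal ((cmod (g (Complex x y)))\<^sup>2) + ennreal (1/(2*t)) * ennreal (1 / ((x - Re c)\<^sup>2 + ?b\<^sup>2))"
      using t by (simp flip: ennreal_mult ennreal_plus add: ennreal_leI)
  qed
  also have "\<dots> = ennreal (t/2) * line_energy g y
     + ennreal (1/(2*t)) * (\<integral>\<^sup>+x. ennreal (1 / ((x - Re c)\<^sup>2 + ?b\<^sup>2)) \<partial>lborel)"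
    by (simp add: nn_integral_add nn_integral_cmult)
  also have "\<dots> \<le> ennreal (t/2) * ennreal C + ennreal (1/(2*t)) * ennreal (pi / ?b)"
    using b unfolding nn_integral_cauchy_kernel[OF b] by (intro add_mono mult_left_mono bd) simp_all
  also have "\<dots> = ennreal ((t * C + pi / (t * ?b)) / 2)"
    using t b C by (simp flip: ennreal_mult ennreal_plus add: field_simps)
  finally show ?thesis .
qed

lemma vertical_segment_bound:
  assumes [measurable]: "g \<in> borel_measurable borel" and Y: "Y > 0"
    and d: "\<bar>r - Re c\<bar> \<ge> d" "d > 0" and e: "e \<ge> 0"
    and cont: "continuous_on {0..Y} (\<lambda>y. g (Complex r y) / (Complex r y - c))"
    and bd: "(\<integral>\<^sup>+y\<in>{0..Y}. ennreal ((cmod (g (Complex r y)))\<^sup>2) \<partial>lborel) \<le> ennreal e"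
  shows "cmod (integral {0..Y} (\<lambda>y. g (Complex r y) / (Complex r y - c))) \<le> (e + Y / d\<^sup>2) / 2"
proof -
  define h where "h = 1 / (2::real)"
  then have h: "h > 0" by simp
  let ?G = "\<lambda>y. g (Complex r y) / (Complex r y - c)"
  have si: "set_integrable lborel {0..Y} ?G" by (rule borel_integrable_atLeastAtMost'[OF cont])
  have "ennreal (cmod (integral {0..Y} ?G)) = ennreal (cmod (LINT y|lborel. indicator {0..Y} y *\<^sub>R ?G y))"
    using set_borel_integral_eq_integral(2)[OF si] by (simp add: set_lebesgue_integral_def)
  also have "\<dots> \<le> (\<integral>\<^sup>+y. ennreal (cmod (indicator {0..Y} y *\<^sub>R ?G y)) \<partial>lborel)"
    using si unfolding set_integrable_def by (rule integral_norm_bound_ennreal)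
  also have "\<dots> \<le> (\<integral>\<^sup>+y. ennreal h * (ennreal ((cmod (g (Complex r y)))\<^sup>2) * indicator {0..Y} y) 
      + ennreal (1/(2 * d\<^sup>2)) * indicator {0..Y} y \<partial>lborel)"
  proof (intro nn_integral_mono)
    fix y
    have "d \<le> cmod (Complex r y - c)" using d abs_Re_le_cmod[of "Complex r y - c"] by simp
    then have "d\<^sup>2 \<le> (cmod (Complex r y - c))\<^sup>2" using d by (intro power_mono) auto
    then have "1 / (cmod (Complex r y - c))\<^sup>2 \<le> 1 / d\<^sup>2" using d by (intro divide_left_mono) (auto intro!: mult_pos_pos elim: less_le_trans)
    then have "cmod (?G y) \<le> h * (cmod (g (Complex r y)))\<^sup>2 + 1/(2 * d\<^sup>2)"
      using amgm_div[of 1 "g (Complex r y)" "Complex r y - c"] by (simp add: field_simps h_def)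
    then show "ennreal (cmod (indicator {0..Y} y *\<^sub>R ?G y)) \<le>
      ennreal h * (ennreal ((cmod (g (Complex r y)))\<^sup>2) * indicator {0..Y} y) + ennreal (1/(2 * d\<^sup>2)) * indicator {0..Y} y"
      using h by (auto simp: indicator_def ennreal_leI simp flip: ennreal_mult ennreal_plus)
  qed
  also have "\<dots> = ennreal h * (\<integral>\<^sup>+y\<in>{0..Y}. ennreal ((cmod (g (Complex r y)))\<^sup>2) \<partial>lborel) + ennreal (1/(2 * d\<^sup>2)) * ennreal Y"
    using Y by (subst nn_integral_add) (auto simp: nn_integral_cmult nn_integral_cmult_indicator)
  also have "\<dots> \<le> ennreal h * ennreal e + ennreal (1/(2 * d\<^sup>2)) * ennreal Y"
    by (intro add_mono mult_left_mono bd) auto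
  also have "\<dots> = ennreal ((e + Y / d\<^sup>2) / 2)"
    using e Y d h by (simp flip: ennreal_mult ennreal_plus) (simp add: h_def field_simps)
  finally show ?thesis using e Y by (subst (asm) ennreal_le_iff) auto
qed

text \<open>On rectangles with good vertical sides the sides vanish as the width grows; what remains is the
real line and the top side. The top side tends to 0 as the height grows, because the \<open>L\<^sup>2\<close> norms of
\<open>g\<close> stay bounded while that of \<open>1 / (z - c)\<close> decays.\<close>

lemma hardy2_cauchy:
  assumes g: "g \<in> hardy2" and [measurable]: "g \<in> borel_measurable borel"
    and cont: "continuous_on {z. Im z \<ge> 0} g" and c: "Im c \<noteq> 0"
  shows "integrable lborel (\<lambda>x. g (of_real x) / (of_real x - c))"
    and "(LINT x|lborel. g (of_real x) / (of_real x - c)) = (if Im c > 0 then 2 * pi * \<i> * g c else 0)"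
proof -
  define k where "k = (if Im c > 0 then 2 * pi * \<i> * g c else 0)"
  define G where "G = (\<lambda>z. g z / (z - c))"
  have hol: "g holomorphic_on {z. Im z > 0}" using g by (simp add: hardy2_def)
  obtain C where C: "C \<ge> 0" and 
    bd: "\<And>y. y \<ge> 0 \<Longrightarrow> line_energy g y \<le> ennreal C"
    using hardy2_bound_closed[OF g assms(2) cont] by blast
  have [measurable]: "(\<lambda>x. G (Complex x y)) \<in> borel_measurable lborel" for y
    unfolding G_def by measurable
  have int: "integrable lborel (\<lambda>x. G (Complex x y))" if "y \<ge> 0" "y \<noteq> Im c" for y
  proof (rule integrableI_bounded)
    show "(\<integral>\<^sup>+x. ennreal (cmod (G (Complex x y))) \<partial>lborel) < \<infinity>"
      unfolding G_def by (rule le_less_trans[OF horizontal_line_bound[OF assms(2) C bd[OF that(1)] that(2), of 1]]) auto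
  qed measurable
  define A where "A y = (LINT x|lborel. G (Complex x y))" for y
  have A_le: "cmod (A y) \<le> (t * C + pi / (t * \<bar>y - Im c\<bar>)) / 2" if "y \<ge> 0" "y \<noteq> Im c" "t > 0" for y t
  proof -
    have "ennreal (cmod (A y)) \<le> (\<integral>\<^sup>+x. ennreal (cmod (G (Complex x y))) \<partial>lborel)"
      unfolding A_def by (intro integral_norm_bound_ennreal int that)
    also have "\<dots> \<le> ennreal ((t * C + pi / (t * \<bar>y - Im c\<bar>)) / 2)"
      unfolding G_def by (rule horizontal_line_bound[OF assms(2) C bd[OF that(1)] that(2,3)])
    finally show ?thesis using C that by (subst (asm) ennreal_le_iff) auto
  qed
  have contG: "continuous_on ({z. Im z \<ge> 0} - {c}) G"
    unfolding G_def by (intro continuous_intros continuous_on_subset[OF cont]) auto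
  have AY: "A 0 - A Y = k" if Y: "Y > \<bar>Im c\<bar>" for Y
  proof -
    have Y0: "Y > 0" using Y by linarith
    have "\<exists>R. R \<ge> \<bar>Re c\<bar> + real (Suc n) \<and>
      (\<integral>\<^sup>+y\<in>{0..Y}. ennreal ((cmod (g (Complex R y)))\<^sup>2) \<partial>lborel) < ennreal (1 / real (Suc n)) \<and>
      (\<integral>\<^sup>+y\<in>{0..Y}. ennreal ((cmod (g (Complex (-R) y)))\<^sup>2) \<partial>lborel) < ennreal (1 / real (Suc n))" for n
    proof -
      have "1 / real (Suc n) > 0" by simp
      from hardy2_good_verticals[OF assms(2) Y0 C bd this, of "\<bar>Re c\<bar> + real (Suc n)"]
      show ?thesis by blast
    qed
    then have "\<exists>R. \<forall>n. R n \<ge> \<bar>Re c\<bar> + real (Suc n) \<and>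
      (\<integral>\<^sup>+y\<in>{0..Y}. ennreal ((cmod (g (Complex (R n) y)))\<^sup>2) \<partial>lborel) < ennreal (1 / real (Suc n)) \<and>
      (\<integral>\<^sup>+y\<in>{0..Y}. ennreal ((cmod (g (Complex (- R n) y)))\<^sup>2) \<partial>lborel) < ennreal (1 / real (Suc n))"
      by (intro choice allI)
    then obtain R where R: "\<And>n. R n \<ge> \<bar>Re c\<bar> + real (Suc n)"
      "\<And>n. (\<integral>\<^sup>+y\<in>{0..Y}. ennreal ((cmod (g (Complex (R n) y)))\<^sup>2) \<partial>lborel) < ennreal (1 / real (Suc n))"
      "\<And>n. (\<integral>\<^sup>+y\<in>{0..Y}. ennreal ((cmod (g (Complex (- R n) y)))\<^sup>2) \<partial>lborel) < ennreal (1 / real (Suc n))"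
      by blast
    have Rtop: "filterlim R at_top sequentially"
    proof (rule filterlim_at_top_mono[OF filterlim_real_sequentially], intro always_eventually allI)
      fix n show "real n \<le> R n" using R(1)[of n] by auto
    qed
    have J: "(\<lambda>n. integral {0..Y} (\<lambda>y. G (Complex (s * R n) y))) \<longlonglongrightarrow> 0" if s: "s = 1 \<or> s = -1" for s
    proof (rule Lim_null_comparison)
      show "\<forall>\<^sub>F n in sequentially. cmod (integral {0..Y} (\<lambda>y. G (Complex (s * R n) y))) 
        \<le> (1 / real (Suc n) + Y / (real (Suc n))\<^sup>2) / 2"
      proof (intro always_eventually allI)
        fix n
        have d: "\<bar>s * R n - Re c\<bar> \<ge> real (Suc n)" using s R(1)[of n] by auto
        then have "s * R n \<noteq> Re c" by auto
        then have "Complex (s * R n) y \<noteq> c" for y by (metis complex.sel(1))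
        then have "continuous_on {0..Y} (\<lambda>y. g (Complex (s * R n) y) / (Complex (s * R n) y - c))"
          by (intro continuous_intros continuous_on_compose2[OF cont]) (auto simp: Complex_eq intro!: continuous_intros)
        then show "cmod (integral {0..Y} (\<lambda>y. G (Complex (s * R n) y))) 
          \<le> (1 / real (Suc n) + Y / (real (Suc n))\<^sup>2) / 2"
          unfolding G_def using s R(2,3)[of n]
          by (intro vertical_segment_bound[OF assms(2) Y0 d]) (auto intro: less_imp_le)
      qed
      have a: "(\<lambda>n. 1 / real (Suc n)) \<longlonglongrightarrow> 0"
        using LIMSEQ_inverse_real_of_nat by (simp add: inverse_eq_divide)
      have "(\<lambda>n. (1 / real (Suc n) + Y * (1 / real (Suc n) * (1 / real (Suc n)))) / 2) \<longlonglongrightarrow> (0 + Y * (0 * 0)) / 2"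
        by (intro tendsto_intros a) auto
      then show "(\<lambda>n. (1 / real (Suc n) + Y / (real (Suc n))\<^sup>2) / 2) \<longlonglongrightarrow> 0"
        by (simp add: power2_eq_square)
    qed
    have I: "(\<lambda>n. integral {- R n..R n} (\<lambda>x. G (Complex x y))) \<longlonglongrightarrow> A y" if y: "y \<ge> 0" "y \<noteq> Im c" for y
    proof -
      have i: "integrable lborel (\<lambda>x. G (Complex x y))" by (rule int[OF y])
      have eq: "integral {- R n..R n} (\<lambda>x. G (Complex x y)) = (LINT x|lborel. indicator {- R n..R n} x *\<^sub>R G (Complex x y))" for n
      proof -
        have "set_integrable lborel {- R n..R n} (\<lambda>x. G (Complex x y))"
          using i unfolding set_integrable_def by (intro integrable_mult_indicator) auto
        from set_borel_integral_eq_integral(2)[OF this] show ?thesis by (simp add: set_lebesgue_integral_def)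
      qed
      show ?thesis unfolding eq A_def
      proof (rule integral_dominated_convergence[where w = "\<lambda>x. cmod (G (Complex x y))"])
        show "AE x in lborel. (\<lambda>n. indicator {- R n..R n} x *\<^sub>R G (Complex x y)) \<longlonglongrightarrow> G (Complex x y)"
        proof (intro AE_I2)
          fix x :: real
          have "\<forall>\<^sub>F n in sequentially. R n \<ge> \<bar>x\<bar>" using Rtop by (simp add: filterlim_at_top)
          then have "\<forall>\<^sub>F n in sequentially. indicator {- R n..R n} x *\<^sub>R G (Complex x y) = G (Complex x y)"
            by eventually_elim (auto simp: indicator_def)
          then show "(\<lambda>n. indicator {- R n..R n} x *\<^sub>R G (Complex x y)) \<longlonglongrightarrow> G (Complex x y)"
            by (rule tendsto_eventually)
        qed
        show "integrable lborel (\<lambda>x. cmod (G (Complex x y)))" using i by auto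
      qed (auto simp: indicator_def)
    qed
    have "(\<lambda>n. integral {- R n..R n} (\<lambda>x. G (Complex x 0)) + \<i> * integral {0..Y} (\<lambda>y. G (Complex (1 * R n) y))
     - integral {- R n..R n} (\<lambda>x. G (Complex x Y)) - \<i> * integral {0..Y} (\<lambda>y. G (Complex (-1 * R n) y))) \<longlonglongrightarrow> A 0 + \<i> * 0 - A Y - \<i> * 0"
    proof (intro tendsto_intros I)
      show "(\<lambda>n. integral {0..Y} (\<lambda>y. G (Complex (1 * R n) y))) \<longlonglongrightarrow> 0" by (rule J) simp
      show "(\<lambda>n. integral {0..Y} (\<lambda>y. G (Complex (- 1 * R n) y))) \<longlonglongrightarrow> 0" by (rule J) simp
    qed (use Y c in auto)
    moreover have "integral {- R n..R n} (\<lambda>x. G (Complex x 0)) + \<i> * integral {0..Y} (\<lambda>y. G (Complex (1 * R n) y))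
     - integral {- R n..R n} (\<lambda>x. G (Complex x Y)) - \<i> * integral {0..Y} (\<lambda>y. G (Complex (-1 * R n) y)) = k" for n
    proof -
      have "R n > \<bar>Re c\<bar>" using R(1)[of n] by auto
      from half_plane_rectangle[OF hol cont c this Y] show ?thesis by (simp add: k_def G_def)
    qed
    ultimately have "(\<lambda>n. k) \<longlonglongrightarrow> A 0 - A Y" by simp
    then show ?thesis by (simp add: LIMSEQ_const_iff)
  qed
  have "A 0 = k"
  proof -
    have le: "cmod (A 0 - k) \<le> (1 / real (Suc n) * C + pi * (1 / real (Suc n))) / 2" for n
    proof -
      \<comment> \<open>with height of order \<open>(Suc n)\<^sup>2\<close> and \<open>t = 1 / Suc n\<close>, both terms of the bound for the top side are of order \<open>1 / n\<close>\<close>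
      define Y where "Y = \<bar>Im c\<bar> + (real (Suc n))\<^sup>2"
      have Y: "Y > \<bar>Im c\<bar>" by (simp add: Y_def)
      have N: "real (Suc n) > 0" by simp
      have "\<bar>Y - Im c\<bar> \<ge> (real (Suc n))\<^sup>2" using Y_def by (auto simp: abs_if)
      then have "pi / ((1 / real (Suc n)) * \<bar>Y - Im c\<bar>) \<le> pi / ((1 / real (Suc n)) * (real (Suc n))\<^sup>2)"
        using Y by (intro divide_left_mono mult_left_mono mult_pos_pos) auto
      also have "\<dots> = pi * (1 / real (Suc n))" using N by (simp add: power2_eq_square)
      finally have p: "pi / ((1 / real (Suc n)) * \<bar>Y - Im c\<bar>) \<le> pi * (1 / real (Suc n))" .
      have "cmod (A 0 - k) = cmod (A Y)" using AY[OF Y] by (simp add: algebra_simps)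
      also have "\<dots> \<le> (1 / real (Suc n) * C + pi / ((1 / real (Suc n)) * \<bar>Y - Im c\<bar>)) / 2"
        using Y N by (intro A_le) (auto intro: order_trans[OF abs_ge_zero less_imp_le])
      also have "\<dots> \<le> (1 / real (Suc n) * C + pi * (1 / real (Suc n))) / 2" using p by (intro divide_right_mono add_left_mono) simp_all
      finally show ?thesis .
    qed
    have a: "(\<lambda>n. 1 / real (Suc n)) \<longlonglongrightarrow> 0"
      using LIMSEQ_inverse_real_of_nat by (simp add: inverse_eq_divide)
    have "(\<lambda>n. (1 / real (Suc n) * C + pi * (1 / real (Suc n))) / 2) \<longlonglongrightarrow> (0 * C + pi * 0) / 2"
      by (intro tendsto_intros a) auto
    then have "cmod (A 0 - k) \<le> (0 * C + pi * 0) / 2" by (rule LIMSEQ_le_const) (use le in blast)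
    then show ?thesis by simp
  qed
  then show "integrable lborel (\<lambda>x. g (of_real x) / (of_real x - c))"
    and "(LINT x|lborel. g (of_real x) / (of_real x - c)) = (if Im c > 0 then 2 * pi * \<i> * g c else 0)"
    using int[of 0] c by (simp_all add: A_def k_def G_def complex_of_real_def)
qed

section \<open>de Branges spaces as inner product spaces\<close>

lemma hermite_biehler_nonzero:
  assumes "hermite_biehler E" "no_real_zeros E" "Im z \<ge> 0"
  shows "E z \<noteq> 0"
proof (cases "Im z > 0")
  case True
  then have "cmod (sharp E z) < cmod (E z)" using assms(1) by (auto simp: hermite_biehler_def)
  then show ?thesis by auto
next
  case False
  then have "z = of_real (Re z)" using assms(3) by (simp add: complex_eq_iff)
  then show ?thesis using assms(2) by (metis no_real_zeros_def)
qed

lemma entire_sharp: "entire f \<Longrightarrow> entire (sharp f)"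
  unfolding entire_def sharp_def using holomorphic_on_compose_cnj_cnj[of f UNIV] holomorphic_on_subset[of f UNIV "range cnj"] by (simp add: o_def)

lemma sharp_of_real: "sharp f (of_real x) = cnj (f (of_real x))"
  by (simp add: sharp_def)

lemma entire_borel_measurable: "entire f \<Longrightarrow> f \<in> borel_measurable borel"
  unfolding entire_def by (intro borel_measurable_continuous_onI holomorphic_on_imp_continuous_on)

lemma hermite_biehler_entire: "hermite_biehler E \<Longrightarrow> entire E"
  by (simp add: hermite_biehler_def)

lemma hardy2I:
  assumes "g holomorphic_on {z. Im z > 0}"
    "\<And>y. y > 0 \<Longrightarrow> line_energy g y \<le> ennreal C"
  shows "g \<in> hardy2"
proof -
  have "(SUP y\<in>{0<..}. \<integral>\<^sup>+x. ennreal ((cmod (g (Complex x y)))\<^sup>2) \<partial>lborel) \<le> ennreal C"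
    using assms(2) by (intro SUP_least) auto
  also have "\<dots> < \<infinity>" by simp
  finally show ?thesis using assms(1) by (simp add: hardy2_def)
qed

lemma hardy2_holomorphic: "g \<in> hardy2 \<Longrightarrow> g holomorphic_on {z. Im z > 0}"
  by (simp add: hardy2_def)

lemma holomorphic_half_plane_measurable_line:
  assumes "g holomorphic_on {z. Im z > 0}" "y > 0"
  shows "(\<lambda>x. g (Complex x y)) \<in> borel_measurable borel"
  using assms(2) by (intro borel_measurable_continuous_onI continuous_on_compose2[OF holomorphic_on_imp_continuous_on[OF assms(1)]])
    (auto simp: Complex_eq intro!: continuous_intros)

lemma hardy2_dominated:
  assumes g: "g \<in> hardy2" and h: "h holomorphic_on {z. Im z > 0}" and C: "C \<ge> 0"
    and le: "\<And>z. Im z > 0 \<Longrightarrow> cmod (h z) \<le> C * cmod (g z)"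
  shows "h \<in> hardy2"
proof -
  obtain B where B: "B \<ge> 0"
    "\<And>y. y > 0 \<Longrightarrow> line_energy g y \<le> ennreal B"
    using hardy2_bound[OF g] by blast
  show ?thesis
  proof (rule hardy2I[OF h, of "C\<^sup>2 * B"])
    fix y :: real assume y: "y > 0"
    note [measurable] = holomorphic_half_plane_measurable_line[OF hardy2_holomorphic[OF g] y]
    have "line_energy h y \<le> (\<integral>\<^sup>+x. ennreal (C\<^sup>2) * ennreal ((cmod (g (Complex x y)))\<^sup>2) \<partial>lborel)"
    proof (intro nn_integral_mono)
      fix x
      have "(cmod (h (Complex x y)))\<^sup>2 \<le> (C * cmod (g (Complex x y)))\<^sup>2" using le[of "Complex x y"] y by (intro power_mono) auto
      then show "ennreal ((cmod (h (Complex x y)))\<^sup>2) \<le> ennreal (C\<^sup>2) * ennreal ((cmod (g (Complex x y)))\<^sup>2)"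
        by (simp add: power_mult_distrib ennreal_leI flip: ennreal_mult)
    qed
    also have "\<dots> = ennreal (C\<^sup>2) * line_energy g y"
      by (rule nn_integral_cmult) measurable
    also have "\<dots> \<le> ennreal (C\<^sup>2) * ennreal B" by (intro mult_left_mono B(2) y) auto
    also have "\<dots> = ennreal (C\<^sup>2 * B)" using B(1) by (simp add: ennreal_mult)
    finally show "line_energy h y \<le> ennreal (C\<^sup>2 * B)" .
  qed
qed

lemma hardy2_scale:
  assumes g: "g \<in> hardy2"
  shows "(\<lambda>z. c * g z) \<in> hardy2"
proof (rule hardy2_dominated[OF g, where C = "cmod c"])
  show "(\<lambda>z. c * g z) holomorphic_on {z. Im z > 0}" by (intro holomorphic_intros hardy2_holomorphic g)
qed (auto simp: norm_mult)

lemma norm_add_sq_le: "(cmod (a + b))\<^sup>2 \<le> 2 * (cmod a)\<^sup>2 + 2 * (cmod b)\<^sup>2"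
proof -
  have "(cmod (a + b))\<^sup>2 \<le> (cmod a + cmod b)\<^sup>2" by (intro power_mono norm_triangle_ineq) auto
  also have "\<dots> \<le> 2 * (cmod a)\<^sup>2 + 2 * (cmod b)\<^sup>2" 
    using zero_le_power2[of "cmod a - cmod b"] by (simp add: power2_sum power2_diff)
  finally show ?thesis .
qed

text \<open>Only the bound on horizontal lines needs an argument; the crude \<open>(p + q)\<^sup>2 \<le> 2 p\<^sup>2 + 2 q\<^sup>2\<close> suffices
because the space asks for finiteness of the supremum.\<close>

lemma hardy2_add:
  assumes f: "f \<in> hardy2" and g: "g \<in> hardy2"
  shows "(\<lambda>z. f z + g z) \<in> hardy2"
proof -
  obtain C where C: "C \<ge> 0"
    "\<And>y. y > 0 \<Longrightarrow> line_energy f y \<le> ennreal C"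
    using hardy2_bound[OF f] by blast
  obtain D where D: "D \<ge> 0"
    "\<And>y. y > 0 \<Longrightarrow> line_energy g y \<le> ennreal D"
    using hardy2_bound[OF g] by blast
  note hol = hardy2_holomorphic[OF f] hardy2_holomorphic[OF g]
  show ?thesis
  proof (rule hardy2I[of _ "2 * C + 2 * D"])
    show "(\<lambda>z. f z + g z) holomorphic_on {z. Im z > 0}" by (intro holomorphic_intros hol)
    fix y :: real assume y: "y > 0"
    note [measurable] = holomorphic_half_plane_measurable_line[OF hol(1) y] holomorphic_half_plane_measurable_line[OF hol(2) y]
    have "(\<integral>\<^sup>+x. ennreal ((cmod (f (Complex x y) + g (Complex x y)))\<^sup>2) \<partial>lborel)
       \<le> (\<integral>\<^sup>+x. 2 * ennreal ((cmod (f (Complex x y)))\<^sup>2) + 2 * ennreal ((cmod (g (Complex x y)))\<^sup>2) \<partial>lborel)"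
      proof (intro nn_integral_mono)
      fix x
      have "ennreal ((cmod (f (Complex x y) + g (Complex x y)))\<^sup>2) \<le> ennreal (2 * (cmod (f (Complex x y)))\<^sup>2 + 2 * (cmod (g (Complex x y)))\<^sup>2)"
        by (intro ennreal_leI norm_add_sq_le)
      then show "ennreal ((cmod (f (Complex x y) + g (Complex x y)))\<^sup>2) \<le> 2 * ennreal ((cmod (f (Complex x y)))\<^sup>2) + 2 * ennreal ((cmod (g (Complex x y)))\<^sup>2)"
        by (simp add: ennreal_mult)
    qed
    also have "\<dots> = 2 * line_energy f y + 2 * line_energy g y"
      by (simp add: nn_integral_add nn_integral_cmult)
    also have "\<dots> \<le> 2 * ennreal C + 2 * ennreal D" by (intro add_mono mult_left_mono C(2) D(2) y) auto
    finally show "(\<integral>\<^sup>+x. ennreal ((cmod (f (Complex x y) + g (Complex x y)))\<^sup>2) \<partial>lborel) \<le> ennreal (2 * C + 2 * D)"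
      using C(1) D(1) by (simp add: ennreal_mult ennreal_plus)
  qed
qed

lemma deBranges_space_entire: "f \<in> deBranges_space E \<Longrightarrow> entire f"
  by (simp add: deBranges_space_def)

lemma deBranges_space_scale:
  assumes f: "f \<in> deBranges_space E"
  shows "(\<lambda>z. c * f z) \<in> deBranges_space E"
proof -
  have "entire (\<lambda>z. c * f z)" using f by (auto simp: deBranges_space_def entire_def intro!: holomorphic_intros)
  moreover have "(\<lambda>z. c * f z / E z) \<in> hardy2"
    using f hardy2_scale[of "\<lambda>z. f z / E z" c] by (simp add: deBranges_space_def)
  moreover have "(\<lambda>z. sharp (\<lambda>z. c * f z) z / E z) \<in> hardy2"
    using f hardy2_scale[of "\<lambda>z. sharp f z / E z" "cnj c"] by (simp add: deBranges_space_def sharp_def)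
  ultimately show ?thesis by (simp add: deBranges_space_def)
qed

lemma deBranges_space_add:
  assumes f: "f \<in> deBranges_space E" and g: "g \<in> deBranges_space E"
  shows "(\<lambda>z. f z + g z) \<in> deBranges_space E"
proof -
  have "entire (\<lambda>z. f z + g z)" using f g by (auto simp: deBranges_space_def entire_def intro!: holomorphic_intros)
  moreover have "(\<lambda>z. (f z + g z) / E z) \<in> hardy2"
    using f g hardy2_add[of "\<lambda>z. f z / E z" "\<lambda>z. g z / E z"] by (simp add: deBranges_space_def add_divide_distrib)
  moreover have "(\<lambda>z. sharp (\<lambda>z. f z + g z) z / E z) \<in> hardy2"
    using f g hardy2_add[of "\<lambda>z. sharp f z / E z" "\<lambda>z. sharp g z / E z"] 
    by (simp add: deBranges_space_def sharp_def add_divide_distrib)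
  ultimately show ?thesis by (simp add: deBranges_space_def)
qed

lemma deBranges_space_diff:
  assumes f: "f \<in> deBranges_space E" and g: "g \<in> deBranges_space E"
  shows "(\<lambda>z. f z - g z) \<in> deBranges_space E"
  using deBranges_space_add[OF f deBranges_space_scale[OF g, of "-1"]] by simp

lemma hardy2_zero: "(\<lambda>z. 0) \<in> hardy2"
  by (rule hardy2I[of _ 0]) auto

lemma deBranges_space_zero: "(\<lambda>z. 0) \<in> deBranges_space E"
  by (auto simp: deBranges_space_def hardy2_zero entire_def sharp_def)

lemma deBranges_space_sum:
  assumes "\<And>n. n \<in> J \<Longrightarrow> k n \<in> deBranges_space E"
  shows "(\<lambda>z. \<Sum>n\<in>J. c n * k n z) \<in> deBranges_space E"
  using assms
proof (induction J rule: infinite_finite_induct)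
  case (insert x F)
  then have "(\<lambda>z. c x * k x z + (\<Sum>n\<in>F. c n * k n z)) \<in> deBranges_space E"
    by (intro deBranges_space_add deBranges_space_scale) auto
  with insert show ?case by simp
qed (auto simp: deBranges_space_zero)

lemma integrable_mult_cnj:
  fixes a b :: "'a \<Rightarrow> complex"
  assumes [measurable]: "a \<in> borel_measurable M" "b \<in> borel_measurable M"
    and "integrable M (\<lambda>x. (cmod (a x))\<^sup>2)" "integrable M (\<lambda>x. (cmod (b x))\<^sup>2)"
  shows "integrable M (\<lambda>x. a x * cnj (b x))"
proof (rule Bochner_Integration.integrable_bound[OF Bochner_Integration.integrable_add[OF assms(3,4)]])
  have "cmod (u * cnj v) \<le> norm ((cmod u)\<^sup>2 + (cmod v)\<^sup>2)" for u v
  proof -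
    have "2 * (cmod u * cmod v) \<le> (cmod u)\<^sup>2 + (cmod v)\<^sup>2" using sum_squares_bound[of "cmod u" "cmod v"] by simp
    moreover have "0 \<le> cmod u * cmod v" by simp
    ultimately have "cmod u * cmod v \<le> (cmod u)\<^sup>2 + (cmod v)\<^sup>2" by linarith
    then show ?thesis by (simp add: norm_mult)
  qed
  then show "AE x in M. cmod (a x * cnj (b x)) \<le> norm ((cmod (a x))\<^sup>2 + (cmod (b x))\<^sup>2)"
    by blast
  have [measurable]: "(\<lambda>x. cnj (b x)) \<in> borel_measurable M"
    by (rule measurable_compose[OF assms(2)]) (intro borel_measurable_continuous_onI continuous_intros)
  show "(\<lambda>x. a x * cnj (b x)) \<in> borel_measurable M" by measurable
qed

locale hermite_biehler_function =
  fixes E :: "complex \<Rightarrow> complex"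
  assumes hb: "hermite_biehler E" and nrz: "no_real_zeros E"
begin

abbreviation "H \<equiv> deBranges_space E"

lemma E_nonzero: "Im z \<ge> 0 \<Longrightarrow> E z \<noteq> 0"
  using hermite_biehler_nonzero[OF hb nrz] .

lemma E_entire: "entire E" by (rule hermite_biehler_entire[OF hb])

lemma ratio_measurable: "entire f \<Longrightarrow> (\<lambda>z. f z / E z) \<in> borel_measurable borel"
  using entire_borel_measurable[of f] entire_borel_measurable[OF E_entire] by measurable

lemma ratio_continuous: "entire f \<Longrightarrow> continuous_on {z. Im z \<ge> 0} (\<lambda>z. f z / E z)"
  using E_nonzero E_entire
  by (intro continuous_intros holomorphic_on_imp_continuous_on) (auto simp: entire_def intro: holomorphic_on_subset)

lemma ratio_line_measurable: "entire f \<Longrightarrow> (\<lambda>x::real. f (of_real x) / E (of_real x)) \<in> borel_measurable borel"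
  using ratio_measurable[of f] by (rule measurable_compose[rotated]) measurable

text \<open>Without real zeros of \<open>E\<close> the quotient \<open>f / E\<close> is continuous up to the real line, so its boundary
function is literally \<open>f x / E x\<close>, and the Hardy bound passes to it.\<close>

lemma L2_boundary:
  assumes "f \<in> H"
  shows "integrable lborel (\<lambda>x. (cmod (f (of_real x) / E (of_real x)))\<^sup>2)"
proof -
  have f: "entire f" "(\<lambda>z. f z / E z) \<in> hardy2" using assms by (auto simp: deBranges_space_def)
  note [measurable] = ratio_line_measurable[OF f(1)]
  obtain C where C: "\<And>y. y \<ge> 0 \<Longrightarrow> (\<integral>\<^sup>+x. ennreal ((cmod (f (Complex x y) / E (Complex x y)))\<^sup>2) \<partial>lborel) \<le> ennreal C"
    using hardy2_bound_closed[OF f(2) ratio_measurable[OF f(1)] ratio_continuous[OF f(1)]] by blast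
  show ?thesis
  proof (rule integrableI_bounded)
    have "(\<integral>\<^sup>+x. ennreal (norm ((cmod (f (of_real x) / E (of_real x)))\<^sup>2)) \<partial>lborel) \<le> ennreal C"
      using C[of 0] by (simp add: complex_of_real_def)
    then show "(\<integral>\<^sup>+x. ennreal (norm ((cmod (f (of_real x) / E (of_real x)))\<^sup>2)) \<partial>lborel) < \<infinity>"
      by (rule le_less_trans) simp
  qed measurable
qed

lemma inner_integrable:
  assumes "f \<in> H" "g \<in> H"
  shows "integrable lborel (\<lambda>x. (f (of_real x) / E (of_real x)) * cnj (g (of_real x) / E (of_real x)))"
  using assms
  by (intro integrable_mult_cnj L2_boundary) (simp_all add: ratio_line_measurable deBranges_space_entire)

lemma inner_cnj: "dB_inner E g f = cnj (dB_inner E f g)"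
proof -
  have "dB_inner E g f = (LINT x|lborel. cnj ((f (of_real x) / E (of_real x)) * cnj (g (of_real x) / E (of_real x))))"
    unfolding dB_inner_def by (intro Bochner_Integration.integral_cong) (auto simp: mult.commute)
  also have "\<dots> = cnj (dB_inner E f g)" unfolding dB_inner_def by (rule Bochner_Integration.integral_cnj)
  finally show ?thesis .
qed

lemma inner_add_left:
  assumes "f \<in> H" "g \<in> H" "h \<in> H"
  shows "dB_inner E (\<lambda>z. f z + g z) h = dB_inner E f h + dB_inner E g h"
  unfolding dB_inner_def 
    Bochner_Integration.integral_add[OF inner_integrable[OF assms(1,3)] inner_integrable[OF assms(2,3)], symmetric]
  by (intro Bochner_Integration.integral_cong) (simp_all only: add_divide_distrib distrib_right)

lemma inner_scale_left: "dB_inner E (\<lambda>z. c * f z) h = c * dB_inner E f h"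
  unfolding dB_inner_def integral_mult_right_zero[symmetric]
  by (intro Bochner_Integration.integral_cong) (simp_all only: times_divide_eq_right[symmetric] mult.assoc)

lemma inner_diff_left:
  "f \<in> H \<Longrightarrow> g \<in> H \<Longrightarrow> h \<in> H \<Longrightarrow> dB_inner E (\<lambda>z. f z - g z) h = dB_inner E f h - dB_inner E g h"
  using inner_add_left[of f "\<lambda>z. -1 * g z" h] inner_scale_left[of "-1" g h] deBranges_space_scale[of g E "-1"] by simp

lemma inner_sum_left:
  assumes "\<And>n. n \<in> J \<Longrightarrow> k n \<in> H" "h \<in> H"
  shows "dB_inner E (\<lambda>z. \<Sum>n\<in>J. c n * k n z) h = (\<Sum>n\<in>J. c n * dB_inner E (k n) h)"
  using assms
proof (induction J rule: infinite_finite_induct)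
  case (insert x F)
  then have "dB_inner E (\<lambda>z. c x * k x z + (\<Sum>n\<in>F. c n * k n z)) h = c x * dB_inner E (k x) h + (\<Sum>n\<in>F. c n * dB_inner E (k n) h)"
    by (subst inner_add_left) (auto intro!: deBranges_space_scale deBranges_space_sum simp: inner_scale_left)
  with insert show ?case by simp
qed (auto simp: dB_inner_def)

lemma inner_add_right:
  "f \<in> H \<Longrightarrow> g \<in> H \<Longrightarrow> h \<in> H \<Longrightarrow> dB_inner E h (\<lambda>z. f z + g z) = dB_inner E h f + dB_inner E h g"
  using inner_add_left[of f g h] by (metis complex_cnj_add inner_cnj)

lemma inner_diff_right:
  "f \<in> H \<Longrightarrow> g \<in> H \<Longrightarrow> h \<in> H \<Longrightarrow> dB_inner E h (\<lambda>z. f z - g z) = dB_inner E h f - dB_inner E h g"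
  using inner_diff_left[of f g h] by (metis complex_cnj_diff inner_cnj)

lemma inner_scale_right: "dB_inner E h (\<lambda>z. c * f z) = cnj c * dB_inner E h f"
  using inner_scale_left[of c f h] by (metis complex_cnj_mult inner_cnj)

lemma inner_sum_right:
  assumes "\<And>n. n \<in> J \<Longrightarrow> k n \<in> H" "h \<in> H"
  shows "dB_inner E h (\<lambda>z. \<Sum>n\<in>J. c n * k n z) = (\<Sum>n\<in>J. cnj (c n) * dB_inner E h (k n))"
proof -
  have "dB_inner E h (\<lambda>z. \<Sum>n\<in>J. c n * k n z) = cnj (\<Sum>n\<in>J. c n * dB_inner E (k n) h)"
    by (subst inner_cnj, subst inner_sum_left) (use assms in auto)
  also have "\<dots> = (\<Sum>n\<in>J. cnj (c n) * cnj (dB_inner E (k n) h))" by simp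
  also have "\<dots> = (\<Sum>n\<in>J. cnj (c n) * dB_inner E h (k n))"
    by (intro sum.cong refl arg_cong2[of _ _ _ _ "(*)"] inner_cnj[symmetric])
  finally show ?thesis .
qed

lemma inner_self: "dB_inner E f f = of_real ((dB_norm E f)\<^sup>2)"
proof -
  have "dB_inner E f f = (LINT x|lborel. complex_of_real ((cmod (f (of_real x) / E (of_real x)))\<^sup>2))"
    unfolding dB_inner_def by (intro Bochner_Integration.integral_cong) (simp_all only: complex_norm_square)
  also have "\<dots> = of_real (LINT x|lborel. (cmod (f (of_real x) / E (of_real x)))\<^sup>2)"
    by (rule integral_complex_of_real)
  finally show ?thesis by (simp add: dB_norm_def)
qed

lemma norm_nonneg: "dB_norm E f \<ge> 0" by (simp add: dB_norm_def)

text \<open>The square of \<open>t c f - g\<close>, with \<open>c\<close> rotating the inner product to a nonnegative number, gives a bound for each \<open>t > 0\<close>.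
The optimal \<open>t\<close> is a quotient of norms; either of them may vanish, so both are enlarged by a small \<open>e\<close>.\<close>

lemma inner_Cauchy_Schwarz:
  assumes f: "f \<in> H" and g: "g \<in> H"
  shows "cmod (dB_inner E f g) \<le> dB_norm E f * dB_norm E g"
proof -
  let ?a = "dB_inner E f g"
  have bound: "2 * cmod ?a \<le> t * (dB_norm E f)\<^sup>2 + (dB_norm E g)\<^sup>2 / t" if t: "t > 0" for t
  proof -
    obtain c where c: "(cmod c)\<^sup>2 \<le> 1" and ca: "c * ?a = of_real (cmod ?a)"
    proof (cases "?a = 0")
      case True
      then show ?thesis using that[of 0] by simp
    next
      case False
      have "cnj ?a / of_real (cmod ?a) * ?a = (?a * cnj ?a) / of_real (cmod ?a)" by simp
      also have "\<dots> = of_real (cmod ?a)" 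
        unfolding complex_norm_square[symmetric] using False by (simp add: power2_eq_square)
      finally show ?thesis using False by (intro that[of "cnj ?a / of_real (cmod ?a)"]) (auto simp: norm_divide)
    qed
    let ?u = "\<lambda>z. of_real t * c * f z" 
    have u: "?u \<in> H" by (intro deBranges_space_scale f)
    have "dB_inner E (\<lambda>z. ?u z - g z) (\<lambda>z. ?u z - g z) 
       = dB_inner E ?u ?u - dB_inner E ?u g - dB_inner E g ?u + dB_inner E g g"
      using u g by (simp add: inner_diff_left inner_diff_right deBranges_space_diff)
    also have "dB_inner E ?u g = of_real (t * cmod ?a)" using ca by (simp add: inner_scale_left mult.assoc)
    also have "dB_inner E g ?u = of_real (t * cmod ?a)"
      unfolding inner_cnj[of g ?u] \<open>dB_inner E ?u g = of_real (t * cmod ?a)\<close> by simp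
    also have "dB_inner E ?u ?u = of_real (t\<^sup>2 * (cmod c)\<^sup>2 * (dB_norm E f)\<^sup>2)"
    proof -
      have "dB_inner E ?u ?u = (of_real t * c) * (cnj (of_real t * c) * of_real ((dB_norm E f)\<^sup>2))"
        by (simp only: inner_scale_left inner_scale_right inner_self)
      also have "\<dots> = of_real t * of_real t * (c * cnj c) * of_real ((dB_norm E f)\<^sup>2)" by (simp add: mult_ac)
      also have "\<dots> = of_real (t\<^sup>2 * (cmod c)\<^sup>2 * (dB_norm E f)\<^sup>2)"
        unfolding complex_norm_square[symmetric] by (simp add: power2_eq_square)
      finally show ?thesis .
    qed
    finally have "of_real ((dB_norm E (\<lambda>z. ?u z - g z))\<^sup>2) = complex_of_real (t\<^sup>2 * (cmod c)\<^sup>2 * (dB_norm E f)\<^sup>2 - t * cmod ?a - t * cmod ?a + (dB_norm E g)\<^sup>2)"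
      by (simp only: inner_self of_real_add of_real_diff)
    then have "(dB_norm E (\<lambda>z. ?u z - g z))\<^sup>2 = t\<^sup>2 * (cmod c)\<^sup>2 * (dB_norm E f)\<^sup>2 - t * cmod ?a - t * cmod ?a + (dB_norm E g)\<^sup>2"
      by (simp only: of_real_eq_iff)
    then have "2 * (t * cmod ?a) \<le> t\<^sup>2 * (cmod c)\<^sup>2 * (dB_norm E f)\<^sup>2 + (dB_norm E g)\<^sup>2"
      using zero_le_power2[of "dB_norm E (\<lambda>z. ?u z - g z)"] by linarith
    also have "t\<^sup>2 * (cmod c)\<^sup>2 * (dB_norm E f)\<^sup>2 \<le> t\<^sup>2 * 1 * (dB_norm E f)\<^sup>2"
      using c by (intro mult_right_mono mult_left_mono) auto
    finally have "2 * (t * cmod ?a) \<le> t * (t * (dB_norm E f)\<^sup>2 + (dB_norm E g)\<^sup>2 / t)"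
      using t by (simp add: power2_eq_square algebra_simps)
    then have "t * (2 * cmod ?a) \<le> t * (t * (dB_norm E f)\<^sup>2 + (dB_norm E g)\<^sup>2 / t)" by simp
    then show ?thesis using t by (simp only: mult_le_cancel_left_pos)
  qed
  have b2: "2 * cmod ?a \<le> 2 * ((dB_norm E f + e) * (dB_norm E g + e))" if e: "e > 0" for e
  proof -
    let ?F = "dB_norm E f + e" and ?G = "dB_norm E g + e"
    have p: "?F > 0" "?G > 0" using e norm_nonneg[of f] norm_nonneg[of g] by linarith+
    have "2 * cmod ?a \<le> (?G / ?F) * (dB_norm E f)\<^sup>2 + (dB_norm E g)\<^sup>2 / (?G / ?F)" by (rule bound) (use p in auto)
    also have "\<dots> \<le> (?G / ?F) * ?F\<^sup>2 + ?G\<^sup>2 / (?G / ?F)"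
      using p e norm_nonneg by (intro add_mono mult_left_mono divide_right_mono power_mono) (auto intro: less_imp_le)
    also have "\<dots> = 2 * (?F * ?G)"
    proof -
      have "(b / a) * a\<^sup>2 + b\<^sup>2 / (b / a) = 2 * (a * b)" if "a > 0" "b > 0" for a b :: real
        using that by (simp add: power2_eq_square)
      from this[OF p] show ?thesis .
    qed
    finally show ?thesis .
  qed
  have "((\<lambda>e. (dB_norm E f + e) * (dB_norm E g + e)) \<longlongrightarrow> (dB_norm E f + 0) * (dB_norm E g + 0)) (at_right 0)"
    by (intro tendsto_intros)
  then have "cmod ?a \<le> (dB_norm E f + 0) * (dB_norm E g + 0)"
    by (rule tendsto_lowerbound) (use b2 in \<open>auto simp: eventually_at_right_field intro!: exI[of _ 1]\<close>)
  then show ?thesis by simp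
qed

end

section \<open>The formula for the reproducing kernel\<close>

context hermite_biehler_function
begin

definition kernel_numerator :: "complex \<Rightarrow> complex \<Rightarrow> complex" where
  "kernel_numerator z w = \<i> / (2 * pi) * (E z * cnj (E w) - sharp E z * cnj (sharp E w))"

lemma kernel_numerator_cnj: "kernel_numerator (cnj w) w = 0"
  by (simp add: kernel_numerator_def sharp_def)

lemma kernel_numerator_entire: "entire (\<lambda>z. kernel_numerator z w)"
  unfolding kernel_numerator_def entire_def using E_entire entire_sharp[OF E_entire]
  by (intro holomorphic_intros) (auto simp: entire_def)

text \<open>The numerator vanishes at \<open>z = cnj w\<close>, where the quotient is completed by the derivative.
The first argument of \<open>kernel\<close> is the point of evaluation.\<close>

definition kernel :: "complex \<Rightarrow> complex \<Rightarrow> complex" where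
  "kernel w z = (if z = cnj w then deriv (\<lambda>z. kernel_numerator z w) (cnj w) else kernel_numerator z w / (z - cnj w))"

lemma kernel_entire: "entire (kernel w)"
proof -
  have "(\<lambda>z. if z = cnj w then deriv (\<lambda>z. kernel_numerator z w) (cnj w) 
     else (kernel_numerator z w - kernel_numerator (cnj w) w) / (z - cnj w)) holomorphic_on UNIV"
    by (rule pole_lemma_open) (use kernel_numerator_entire in \<open>auto simp: entire_def\<close>)
  then show ?thesis by (simp only: entire_def kernel_def[abs_def] kernel_numerator_cnj diff_zero)
qed

lemma kernel_mult: "(z - cnj w) * kernel w z = kernel_numerator z w"
  by (simp add: kernel_def kernel_numerator_cnj)

text \<open>The conjugation symmetry moves the removable singularity from \<open>cnj w\<close> to \<open>w\<close>; it reduces membership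
of the reflected kernel in the Hardy space to membership of a kernel.\<close>

lemma sharp_kernel: "sharp (kernel w) = kernel (cnj w)"
proof -
  have eq: "sharp (kernel w) z = kernel (cnj w) z" if "z \<noteq> w" for z
  proof -
    have nz: "cnj z \<noteq> cnj w" using that by simp
    have "cnj (kernel_numerator (cnj z) w) = kernel_numerator z (cnj w)"
      by (simp add: kernel_numerator_def sharp_def algebra_simps)
    then show ?thesis using that nz by (simp add: sharp_def kernel_def)
  qed
  have "sharp (kernel w) w = kernel (cnj w) w"
  proof (rule tendsto_unique)
    have "sharp (kernel w) \<midarrow>w\<rightarrow> sharp (kernel w) w"
      using entire_sharp[OF kernel_entire[of w]] 
      by (meson UNIV_I entire_def holomorphic_on_imp_continuous_on continuous_on_eq_continuous_at isCont_def open_UNIV)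
    then show "(kernel (cnj w)) \<midarrow>w\<rightarrow> sharp (kernel w) w"
      by (rule Lim_transform_eventually) (auto simp: eventually_at_filter eq)
    show "(kernel (cnj w)) \<midarrow>w\<rightarrow> kernel (cnj w) w"
      using kernel_entire[of "cnj w"] 
      by (meson UNIV_I entire_def holomorphic_on_imp_continuous_on continuous_on_eq_continuous_at isCont_def open_UNIV)
  qed auto
  with eq show ?thesis by (metis ext)
qed

lemma norm_sharp_le: "Im z \<ge> 0 \<Longrightarrow> cmod (sharp E z) \<le> cmod (E z)"
proof (cases "Im z > 0")
  case True then show ?thesis using hb by (auto simp: hermite_biehler_def intro: less_imp_le)
next
  case False
  assume "Im z \<ge> 0"
  with False have "cnj z = z" by (simp add: complex_eq_iff)
  then show ?thesis by (simp add: sharp_def)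
qed

text \<open>Away from \<open>cnj w\<close> the quotient decays like \<open>1 / \<bar>z - cnj w\<bar>\<close>, as the numerator is at most a constant
times \<open>\<bar>E z\<bar>\<close>; near \<open>cnj w\<close> it is bounded by compactness. Together this gives a
bound by a Cauchy density in \<open>Re z\<close> that is uniform in \<open>Im z\<close>.\<close>

lemma kernel_ratio_hardy2:
  shows "(\<lambda>z. kernel w z / E z) \<in> hardy2"
proof -
  define C0 where "C0 = (cmod (E w) + cmod (sharp E w))\<^sup>2"
  define g where "g = (\<lambda>z. kernel w z / E z)"
  have C0: "C0 \<ge> 0" by (simp add: C0_def)
  have hol: "g holomorphic_on {z. Im z > 0}"
    unfolding g_def using kernel_entire E_entire E_nonzero
    by (intro holomorphic_intros) (auto simp: entire_def intro: holomorphic_on_subset)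
  have contg: "continuous_on {z. Im z \<ge> 0} g" unfolding g_def by (rule ratio_continuous[OF kernel_entire])
  have "compact (cball (cnj w) 1 \<inter> {z. Im z \<ge> 0})"
    by (intro compact_Int_closed closed_halfspace_Im_ge compact_cball)
  then have "compact (g ` (cball (cnj w) 1 \<inter> {z. Im z \<ge> 0}))"
    by (intro compact_continuous_image continuous_on_subset[OF contg]) auto
  then obtain B where B': "\<forall>z\<in>g ` (cball (cnj w) 1 \<inter> {z. Im z \<ge> 0}). cmod z \<le> B" and B0: "B > 0"
    by (metis compact_imp_bounded bounded_pos)
  have B: "cmod (g z) \<le> B" if "z \<in> cball (cnj w) 1" "Im z \<ge> 0" for z
    using bspec[OF B' imageI] that by simp
  \<comment> \<open>the numerator is at most \<open>\<bar>E z\<bar> (\<bar>E w\<bar> + \<bar>E\<^sup>* w\<bar>)\<close>, by the Hermite--Biehler inequality\<close>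
  have far: "(cmod (g z))\<^sup>2 * (cmod (z - cnj w))\<^sup>2 \<le> C0" if z: "Im z \<ge> 0" for z
  proof -
    have E: "E z \<noteq> 0" by (rule E_nonzero[OF z])
    have "cmod (g z) * cmod (z - cnj w) = cmod (kernel_numerator z w) / cmod (E z)"
      unfolding g_def by (simp add: kernel_mult[symmetric] norm_divide norm_mult)
    also have "cmod (kernel_numerator z w) \<le> 1 * (cmod (E z) * cmod (E w) + cmod (sharp E z) * cmod (sharp E w))"
      unfolding kernel_numerator_def norm_mult
    proof (rule mult_mono)
      show "cmod (\<i> / (2 * pi)) \<le> 1" using pi_gt3 by (simp add: norm_divide norm_mult)
      show "cmod (E z * cnj (E w) - sharp E z * cnj (sharp E w)) \<le> cmod (E z) * cmod (E w) + cmod (sharp E z) * cmod (sharp E w)"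
        by (rule norm_triangle_le_diff) (simp add: norm_mult)
    qed auto
    also have "1 * (cmod (E z) * cmod (E w) + cmod (sharp E z) * cmod (sharp E w)) \<le> cmod (E z) * (cmod (E w) + cmod (sharp E w))"
      using mult_right_mono[OF norm_sharp_le[OF z] norm_ge_zero[of "sharp E w"]] by (simp add: algebra_simps)
    also have "\<dots> / cmod (E z) = cmod (E w) + cmod (sharp E w)" using E by simp
    finally have "cmod (g z) * cmod (z - cnj w) \<le> cmod (E w) + cmod (sharp E w)"
      by (simp add: divide_right_mono)
    then have "(cmod (g z) * cmod (z - cnj w))\<^sup>2 \<le> C0" unfolding C0_def by (intro power_mono) auto
    then show ?thesis by (simp add: power_mult_distrib)
  qed
  define D where "D = 2 * C0 + 2 * B\<^sup>2"
  have D: "D \<ge> 0" using C0 by (simp add: D_def)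
  have bound: "(cmod (g z))\<^sup>2 \<le> D * (1 / ((Re z - Re w)\<^sup>2 + 1\<^sup>2))" if z: "Im z \<ge> 0" for z
  proof -
    have re: "(Re z - Re w)\<^sup>2 \<le> (cmod (z - cnj w))\<^sup>2" 
      by (simp add: cmod_power2)
    have pos: "(Re z - Re w)\<^sup>2 + 1\<^sup>2 > 0" by (simp add: add_nonneg_pos)
    have "(cmod (g z))\<^sup>2 * ((Re z - Re w)\<^sup>2 + 1\<^sup>2) \<le> D"
    proof (cases "cmod (z - cnj w) \<le> 1")
      case True
      then have "cmod (g z) \<le> B" using z by (intro B) (auto simp: dist_norm norm_minus_commute)
      then have "(cmod (g z))\<^sup>2 \<le> B\<^sup>2" by (intro power_mono) auto
      moreover have "(cmod (z - cnj w))\<^sup>2 \<le> 1" using True by (simp add: power_le_one)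
      ultimately have "(cmod (g z))\<^sup>2 * ((Re z - Re w)\<^sup>2 + 1\<^sup>2) \<le> B\<^sup>2 * 2" using re by (intro mult_mono) auto
      then show ?thesis using C0 by (simp add: D_def)
    next
      case False
      then have "1 \<le> (cmod (z - cnj w))\<^sup>2" by (simp add: one_le_power)
      then have "(cmod (g z))\<^sup>2 * ((Re z - Re w)\<^sup>2 + 1\<^sup>2) \<le> (cmod (g z))\<^sup>2 * (2 * (cmod (z - cnj w))\<^sup>2)"
        using re by (intro mult_left_mono) auto
      also have "\<dots> \<le> 2 * C0" using far[OF z] by simp
      finally show ?thesis using B0 by (simp add: D_def add_increasing2)
    qed
    then show ?thesis using pos by (simp add: pos_le_divide_eq)
  qed
  have "g \<in> hardy2"
  proof (rule hardy2I[OF hol, of "D * pi"])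
    fix y :: real assume y: "y > 0"
    have "line_energy g y \<le> (\<integral>\<^sup>+x. ennreal D * ennreal (1 / ((x - Re w)\<^sup>2 + 1\<^sup>2)) \<partial>lborel)"
    proof (intro nn_integral_mono)
      fix x
      have "ennreal ((cmod (g (Complex x y)))\<^sup>2) \<le> ennreal (D * (1 / ((x - Re w)\<^sup>2 + 1\<^sup>2)))"
        using bound[of "Complex x y"] y by (intro ennreal_leI) simp
      then show "ennreal ((cmod (g (Complex x y)))\<^sup>2) \<le> ennreal D * ennreal (1 / ((x - Re w)\<^sup>2 + 1\<^sup>2))"
        using D by (subst ennreal_mult[symmetric]) auto
    qed
    also have "\<dots> = ennreal D * ennreal (pi / 1)"
      by (subst nn_integral_cmult) (use nn_integral_cauchy_kernel[of 1 "Re w"] in auto)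
    also have "\<dots> = ennreal (D * pi)" using D by (subst ennreal_mult[symmetric]) auto
    finally show "line_energy g y \<le> ennreal (D * pi)" .
  qed
  then show ?thesis by (simp add: g_def)
qed

lemma kernel_in_space: "kernel w \<in> H"
  using kernel_ratio_hardy2[of w] kernel_ratio_hardy2[of "cnj w"] kernel_entire
  by (simp add: deBranges_space_def sharp_kernel)

text \<open>On the real line the inner product splits into Cauchy integrals of \<open>f / E\<close> at \<open>w\<close> and of
\<open>f\<^sup>* / E\<close> at \<open>cnj w\<close>. The first gives the value at \<open>w\<close>, and the second vanishes because
\<open>cnj w\<close> lies in the lower half-plane.\<close>

lemma kernel_reproducing:
  assumes f: "f \<in> H" and w: "Im w > 0"
  shows "f w = dB_inner E f (kernel w)"
proof -
  have fe: "entire f" and f1: "(\<lambda>z. f z / E z) \<in> hardy2" and f2: "(\<lambda>z. sharp f z / E z) \<in> hardy2"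
    using f by (auto simp: deBranges_space_def)
  note c1 = hardy2_cauchy[OF f1 ratio_measurable[OF fe] ratio_continuous[OF fe], of w]
  have se: "entire (sharp f)" by (rule entire_sharp[OF fe])
  note c2 = hardy2_cauchy[OF f2 ratio_measurable[OF se] ratio_continuous[OF se], of "cnj w"]
  have w0: "Im w \<noteq> 0" "Im (cnj w) \<noteq> 0" "\<not> Im (cnj w) > 0" using w by auto
  define c where "c = - \<i> / (2 * complex_of_real pi)"
  have eq: "(f (of_real x) / E (of_real x)) * cnj (kernel w (of_real x) / E (of_real x))
     = (c * E w) * (f (of_real x) / E (of_real x) / (of_real x - w)) 
      - (c * sharp E w) * cnj (sharp f (of_real x) / E (of_real x) / (of_real x - cnj w))" for x :: real
  proof -
    have ne: "complex_of_real x \<noteq> cnj w" "complex_of_real x \<noteq> w" using w by (auto simp: complex_eq_iff)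
    have Ex: "E (of_real x) \<noteq> 0" "cnj (E (of_real x)) \<noteq> 0" using E_nonzero[of "of_real x"] by auto
    define e where "e = E (of_real x)"
    define fx where "fx = f (of_real x)"
    have ec: "cnj e \<noteq> 0" "e \<noteq> 0" using Ex by (auto simp: e_def)
    have k: "cnj (kernel w (of_real x)) = c * (cnj e * E w - e * sharp E w) / (of_real x - w)"
      using ne by (simp add: kernel_def kernel_numerator_def c_def sharp_of_real e_def)
    have "fx / e * (c * (e' * u - e * v) / d / e') = (c * u) * (fx / e / d) - (c * v) * (fx / e' / d)"
      if "e' \<noteq> 0" "d \<noteq> 0" for e' d u v using that ec(2) by (simp add: field_simps)
    from this[OF ec(1), of "of_real x - w"]
    have "fx / e * (c * (cnj e * E w - e * sharp E w) / (of_real x - w) / cnj e)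
       = (c * E w) * (fx / e / (of_real x - w)) - (c * sharp E w) * (fx / cnj e / (of_real x - w))"
      using ne by simp
    then show ?thesis unfolding complex_cnj_divide k by (simp add: e_def fx_def sharp_of_real)
  qed
  have "dB_inner E f (kernel w) = (LINT x|lborel. (c * E w) * (f (of_real x) / E (of_real x) / (of_real x - w)) 
      - (c * sharp E w) * cnj (sharp f (of_real x) / E (of_real x) / (of_real x - cnj w)))"
    unfolding dB_inner_def eq ..
  also have "\<dots> = (c * E w) * (LINT x|lborel. f (of_real x) / E (of_real x) / (of_real x - w))
      - (c * sharp E w) * cnj (LINT x|lborel. sharp f (of_real x) / E (of_real x) / (of_real x - cnj w))"
    using c1(1)[OF w0(1)] integrable_cnj[OF c2(1)[OF w0(2)]]
    by (simp only: Bochner_Integration.integral_diff integrable_mult_right integral_mult_right_zero Bochner_Integration.integral_cnj)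
  also have "\<dots> = (c * E w) * (2 * pi * \<i> * (f w / E w))"
    unfolding c1(2)[OF w0(1)] c2(2)[OF w0(2)] using w by simp
  also have "\<dots> = f w" using E_nonzero[of w] w by (simp add: c_def)
  finally show ?thesis ..
qed

end

lemma entire_eq_on_open:
  assumes f: "entire f" and g: "entire g" and U: "open U" "U \<noteq> {}" and eq: "\<And>z. z \<in> U \<Longrightarrow> f z = g z"
  shows "f z = g z"
proof (rule analytic_continuation_open[OF U(1) open_UNIV U(2) connected_UNIV, where f = f and g = g])
  show "f holomorphic_on UNIV" "g holomorphic_on UNIV" using f g by (auto simp: entire_def)
qed (use eq in auto)

lemma entire_eq_punctured:
  assumes f: "entire f" and g: "entire g" and eq: "\<And>z. z \<noteq> a \<Longrightarrow> f z = g z"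
  shows "f z = g z"
proof (rule entire_eq_on_open[OF f g])
  show "open (- {a})" by auto
  show "- {a} \<noteq> {}" by (metis Compl_empty_eq Compl_insert double_compl insert_not_empty UNIV_I singletonD zero_neq_one ComplI)
qed (use eq in auto)

lemma entire_eq_on_reals:
  assumes f: "entire f" and g: "entire g" and eq: "\<And>x::real. f (of_real x) = g (of_real x)"
  shows "f z = g z"
proof -
  have "f z - g z = 0"
  proof (rule analytic_continuation[OF _ open_UNIV connected_UNIV, where f = "\<lambda>z. f z - g z" and U = "\<real>" and \<xi> = 0])
  show "(\<lambda>z. f z - g z) holomorphic_on UNIV" using f g by (auto simp: entire_def intro!: holomorphic_intros)
  show "(0::complex) islimpt \<real>"
  proof (rule islimptI)
    fix T :: "complex set" assume "0 \<in> T" "open T"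
    then obtain e where e: "e > 0" "ball 0 e \<subseteq> T" by (meson openE)
    show "\<exists>y\<in>\<real>. y \<in> T \<and> y \<noteq> 0"
      by (rule bexI[of _ "of_real (e/2)"]) (use e in auto)
  qed
  qed (use eq in \<open>auto elim!: Reals_cases\<close>)
  then show ?thesis by simp
qed

locale kernel_space = hermite_biehler_function +
  fixes K :: "complex \<Rightarrow> complex \<Rightarrow> complex"
  assumes rk: "reproducing_kernel E K"
begin

lemma K_in_space: "(\<lambda>z. K z w) \<in> H"
  using rk by (simp add: reproducing_kernel_def)

lemma K_reproducing: "f \<in> H \<Longrightarrow> f w = dB_inner E f (\<lambda>z. K z w)"
  using rk by (simp add: reproducing_kernel_def)

lemma K_entire: "entire (\<lambda>z. K z w)"
  using K_in_space deBranges_space_entire by blast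

lemma K_cnj: "K w z = cnj (K z w)"
  using K_reproducing[OF K_in_space, of z w] K_reproducing[OF K_in_space, of w z] inner_cnj by metis

text \<open>Two kernels that reproduce the same space agree: each is recovered by pairing it with the other.\<close>

lemma K_formula_upper:
  assumes "Im w > 0"
  shows "K z w = kernel w z"
proof -
  have "kernel w z = dB_inner E (kernel w) (\<lambda>u. K u z)" by (rule K_reproducing[OF kernel_in_space])
  also have "\<dots> = cnj (dB_inner E (\<lambda>u. K u z) (kernel w))" by (rule inner_cnj)
  also have "dB_inner E (\<lambda>u. K u z) (kernel w) = K w z"
    by (rule kernel_reproducing[OF K_in_space assms, symmetric])
  also have "cnj (K w z) = K z w" by (rule K_cnj[symmetric])
  finally show ?thesis ..
qed

text \<open>For \<open>Im w > 0\<close> this is the comparison with the explicit kernel. Hermitian symmetry of \<open>K\<close> turns this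
into a statement for \<open>Im z > 0\<close> and arbitrary \<open>w\<close>, and both sides are entire in \<open>z\<close>.\<close>

theorem K_formula: "(z - cnj w) * K z w = kernel_numerator z w"
proof (rule entire_eq_on_open[where f = "\<lambda>z. (z - cnj w) * K z w" and g = "\<lambda>z. kernel_numerator z w" and U = "{z. Im z > 0}"])
  show "entire (\<lambda>z. (z - cnj w) * K z w)"
    using K_entire[of w] by (auto simp: entire_def intro!: holomorphic_intros)
  show "entire (\<lambda>z. kernel_numerator z w)" by (rule kernel_numerator_entire)
  show "open {z. Im z > 0}" by (rule open_halfspace_Im_gt)
  show "{z. Im z > 0} \<noteq> {}" by (auto intro: exI[of _ \<i>])
  fix z assume "z \<in> {z. Im z > 0}"
  then have "(w - cnj z) * K w z = kernel_numerator w z" by (simp add: K_formula_upper kernel_mult)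
  then have "cnj ((w - cnj z) * cnj (K z w)) = cnj (kernel_numerator w z)" unfolding K_cnj[of w z] by simp
  then have "(cnj w - z) * K z w = cnj (kernel_numerator w z)" by simp
  moreover have "cnj (kernel_numerator w z) = - kernel_numerator z w"
    by (simp add: kernel_numerator_def algebra_simps)
  ultimately show "(z - cnj w) * K z w = kernel_numerator z w"
    by (simp add: algebra_simps)
qed

lemma K_diag_real: "K z z = of_real (Re (K z z))"
  using K_cnj[of z z] by (simp add: complex_eq_iff)

lemma K_diag: "K z z = of_real ((dB_norm E (\<lambda>u. K u z))\<^sup>2)"
  using K_reproducing[OF K_in_space, of z z] inner_self by simp

text \<open>If \<open>K x x\<close> vanished, the kernel at \<open>x\<close> would have norm 0, hence vanish at \<open>i\<close>; by the formula this
forces \<open>\<bar>E i\<bar> = \<bar>E\<^sup>* i\<bar>\<close>, against the Hermite--Biehler inequality.\<close>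

lemma K_diag_pos:
  assumes "x \<in> \<real>"
  shows "Re (K x x) > 0"
proof (rule ccontr)
  assume "\<not> ?thesis"
  then have n0: "dB_norm E (\<lambda>u. K u x) = 0" using K_diag[of x] by simp
  have "cmod (K \<i> x) \<le> dB_norm E (\<lambda>u. K u x) * dB_norm E (\<lambda>u. K u \<i>)"
    using K_reproducing[OF K_in_space, of \<i> x] inner_Cauchy_Schwarz[OF K_in_space K_in_space, of x \<i>] by simp
  then have "K \<i> x = 0" using n0 by simp
  then have "kernel_numerator \<i> x = 0" using K_formula[of \<i> x] by simp
  moreover have "cnj x = x" using assms by (simp add: Reals_cnj_iff)
  ultimately have "E \<i> * cnj (E x) = sharp E \<i> * E x" by (simp add: kernel_numerator_def sharp_def)
  then have "cmod (E \<i>) * cmod (E x) = cmod (sharp E \<i>) * cmod (E x)" by (metis complex_mod_cnj norm_mult)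
  moreover have "E x \<noteq> 0" using nrz assms by (auto simp: no_real_zeros_def elim: Reals_cases)
  ultimately have "cmod (E \<i>) = cmod (sharp E \<i>)" by simp
  then show False using hb by (auto simp: hermite_biehler_def dest: spec[of _ \<i>])
qed

end

locale phase_space = kernel_space +
  fixes \<phi> :: "real \<Rightarrow> real"
  assumes phase: "phase_function E \<phi>"
begin

lemma E_polar: "E (of_real x) = of_real (cmod (E (of_real x))) * cis (- \<phi> x)"
  using phase by (simp add: phase_function_def cis_conv_exp)

lemma phase_deriv_iter: "((deriv ^^ n) \<phi> has_real_derivative (deriv ^^ Suc n) \<phi> x) (at x)"
proof -
  have "(deriv ^^ n) \<phi> differentiable (at x)"
    using phase by (auto simp: phase_function_def differentiable_on_def)
  then show ?thesis by (simp add: DERIV_deriv_iff_real_differentiable)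
qed

lemma K_real_formula:
  fixes x y :: real
  shows "(x - y) * (pi * Re (K (of_real x) (of_real y))) = cmod (E (of_real x)) * cmod (E (of_real y)) * sin (\<phi> x - \<phi> y)"
    and "x \<noteq> y \<Longrightarrow> Im (K (of_real x) (of_real y)) = 0"
proof -
  let ?r = "cmod (E (of_real x)) * cmod (E (of_real y))"
  have "of_real (x - y) * K (of_real x) (of_real y) = kernel_numerator (of_real x) (of_real y)"
    using K_formula[of "of_real x" "of_real y"] by simp
  also have "\<dots> = \<i> / (2 * pi) * (E (of_real x) * cnj (E (of_real y)) - cnj (E (of_real x) * cnj (E (of_real y))))"
    by (simp add: kernel_numerator_def sharp_of_real)
  also have "E (of_real x) * cnj (E (of_real y)) = of_real ?r * cis (\<phi> y - \<phi> x)"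
    by (subst (1 2) E_polar) (simp add: cis_cnj cis_mult mult_ac)
  also have "\<i> / (2 * pi) * (of_real ?r * cis (\<phi> y - \<phi> x) - cnj (of_real ?r * cis (\<phi> y - \<phi> x))) = of_real (?r * sin (\<phi> x - \<phi> y) / pi)"
    by (simp add: complex_eq_iff sin_diff field_simps)
  finally have eq: "of_real (x - y) * K (of_real x) (of_real y) = of_real (?r * sin (\<phi> x - \<phi> y) / pi)" .
  from arg_cong[OF this, of Re] show "(x - y) * (pi * Re (K (of_real x) (of_real y))) = ?r * sin (\<phi> x - \<phi> y)"
    by (simp add: field_simps)
  from arg_cong[OF eq, of Im] show "x \<noteq> y \<Longrightarrow> Im (K (of_real x) (of_real y)) = 0" by simp
qed

lemma K_real: "K (of_real x) (of_real y) = of_real (Re (K (of_real x) (of_real y)))"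
  using K_real_formula(2)[of x y] K_diag_real[of "of_real x"] by (cases "x = y") (auto simp: complex_eq_iff)

lemma K_diag_phase: "pi * Re (K (of_real x) (of_real x)) = (cmod (E (of_real x)))\<^sup>2 * deriv \<phi> x"
proof (rule tendsto_unique)
  have iso: "isCont (\<lambda>y::real. f (complex_of_real y)) x" if "entire f" for f
  proof -
    have "continuous_on UNIV f" using that by (simp add: entire_def holomorphic_on_imp_continuous_on)
    then have "continuous_on UNIV (\<lambda>y::real. f (complex_of_real y))"
      by (rule continuous_on_compose2[OF _ continuous_on_of_real[OF continuous_on_id]]) auto
    then show ?thesis by (simp add: continuous_on_eq_continuous_at)
  qed
  show "((\<lambda>y. pi * Re (K (of_real y) (of_real x))) \<longlongrightarrow> pi * Re (K (of_real x) (of_real x))) (at x)"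
    using iso[OF K_entire[of "of_real x"]] unfolding isCont_def by (intro tendsto_intros)
  have der: "((\<lambda>y. sin (\<phi> y - \<phi> x)) has_real_derivative deriv \<phi> x) (at x)"
    using phase_deriv_iter[of 0 x] by (auto intro!: derivative_eq_intros)
  have "((\<lambda>y. sin (\<phi> y - \<phi> x) / (y - x)) \<longlongrightarrow> deriv \<phi> x) (at x)"
    using der by (simp add: has_field_derivative_iff)
  moreover have "((\<lambda>y. cmod (E (of_real y))) \<longlongrightarrow> cmod (E (of_real x))) (at x)"
    using iso[OF E_entire] by (intro tendsto_norm) (simp add: isCont_def)
  ultimately have "((\<lambda>y. cmod (E (of_real y)) * cmod (E (of_real x)) * (sin (\<phi> y - \<phi> x) / (y - x))) \<longlongrightarrow> cmod (E (of_real x)) * cmod (E (of_real x)) * deriv \<phi> x) (at x)"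
    by (intro tendsto_mult tendsto_const)
  moreover have "\<forall>\<^sub>F y in at x. cmod (E (of_real y)) * cmod (E (of_real x)) * (sin (\<phi> y - \<phi> x) / (y - x)) = pi * Re (K (of_real y) (of_real x))"
    using K_real_formula(1)[of _ x] by (auto simp: eventually_at_filter field_simps)
  ultimately show "((\<lambda>y. pi * Re (K (of_real y) (of_real x))) \<longlongrightarrow> (cmod (E (of_real x)))\<^sup>2 * deriv \<phi> x) (at x)"
    by (simp add: Lim_transform_eventually power2_eq_square)
qed auto

text \<open>A strictly increasing smooth phase could still have critical points; they are excluded by the
positivity of the kernel on the diagonal.\<close>

lemma phase_deriv_pos: "deriv \<phi> x > 0"
proof -
  have "(cmod (E (of_real x)))\<^sup>2 * deriv \<phi> x > 0"
    using K_diag_pos[of "of_real x"] unfolding K_diag_phase[symmetric] by simp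
  then show ?thesis by (simp add: zero_less_mult_iff)
qed

end

section \<open>Expansion of the kernel in an orthonormal basis\<close>

context hermite_biehler_function
begin

lemma norm_pythagoras:
  assumes r: "r \<in> H" and q: "q \<in> H" and o: "dB_inner E r q = 0"
  shows "dB_norm E r \<le> dB_norm E (\<lambda>z. r z + q z)"
proof -
  have "dB_inner E q r = 0" using inner_cnj[of q r] o by simp
  then have "dB_inner E (\<lambda>z. r z + q z) (\<lambda>z. r z + q z) = dB_inner E r r + dB_inner E q q"
    using r q o by (simp add: inner_add_left inner_add_right deBranges_space_add)
  then have "complex_of_real ((dB_norm E (\<lambda>z. r z + q z))\<^sup>2) = complex_of_real ((dB_norm E r)\<^sup>2 + (dB_norm E q)\<^sup>2)"
    by (simp only: inner_self of_real_add)
  then have "(dB_norm E (\<lambda>z. r z + q z))\<^sup>2 = (dB_norm E r)\<^sup>2 + (dB_norm E q)\<^sup>2"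
    by (simp only: of_real_eq_iff)
  then have "(dB_norm E r)\<^sup>2 \<le> (dB_norm E (\<lambda>z. r z + q z))\<^sup>2" by simp
  then show ?thesis by (rule power2_le_imp_le) (rule norm_nonneg)
qed

lemma orthonormal_best_approximation:
  assumes k: "\<And>n. n \<in> B \<Longrightarrow> k n \<in> H" and B: "finite B" "A \<subseteq> B"
    and o: "\<And>m n. m \<in> B \<Longrightarrow> n \<in> B \<Longrightarrow> dB_inner E (k m) (k n) = (if m = n then 1 else 0)"
    and f: "f \<in> H"
  shows "dB_norm E (\<lambda>z. f z - (\<Sum>n\<in>B. dB_inner E f (k n) * k n z)) \<le> dB_norm E (\<lambda>z. f z - (\<Sum>n\<in>A. c n * k n z))"
proof -
  define r where "r = (\<lambda>z. f z - (\<Sum>n\<in>B. dB_inner E f (k n) * k n z))"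
  define d where "d n = dB_inner E f (k n) - (if n \<in> A then c n else 0)" for n
  define q where "q = (\<lambda>z. \<Sum>n\<in>B. d n * k n z)"
  have rH: "r \<in> H" unfolding r_def by (intro deBranges_space_diff f deBranges_space_sum k)
  have qH: "q \<in> H" unfolding q_def by (intro deBranges_space_sum k)
  have rk: "dB_inner E r (k m) = 0" if m: "m \<in> B" for m
  proof -
    have "dB_inner E r (k m) = dB_inner E f (k m) - (\<Sum>n\<in>B. dB_inner E f (k n) * dB_inner E (k n) (k m))"
      unfolding r_def using k m f by (simp add: inner_diff_left deBranges_space_sum inner_sum_left)
    also have "(\<Sum>n\<in>B. dB_inner E f (k n) * dB_inner E (k n) (k m)) = (\<Sum>n\<in>B. if n = m then dB_inner E f (k n) else 0)"
      using m by (intro sum.cong) (auto simp: o)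
    finally show ?thesis using m B(1) by (simp add: sum.delta)
  qed
  have "dB_inner E r q = 0"
    unfolding q_def by (subst inner_sum_right) (use k rH rk in auto)
  from norm_pythagoras[OF rH qH this] have "dB_norm E r \<le> dB_norm E (\<lambda>z. r z + q z)" .
  also have "(\<lambda>z. r z + q z) = (\<lambda>z. f z - (\<Sum>n\<in>A. c n * k n z))"
  proof
    fix z
    have "(\<Sum>n\<in>B. (if n \<in> A then c n else 0) * k n z) = (\<Sum>n\<in>A. c n * k n z)"
      using B by (intro sum.mono_neutral_cong_right) auto
    then show "r z + q z = f z - (\<Sum>n\<in>A. c n * k n z)"
      by (simp add: r_def q_def d_def left_diff_distrib sum_subtractf)
  qed
  finally show ?thesis unfolding r_def .
qed

end

context kernel_space
begin

text \<open>The error of the expansion at \<open>z\<close> is the value there of the remainder of the kernel at \<open>w\<close>, and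
evaluation is continuous in the norm. Completeness only provides some good finite combination; the
Fourier partial sums over larger index sets are at least as good.\<close>

lemma kernel_expansion:
  fixes J :: "nat \<Rightarrow> int set"
  assumes onb: "dB_orthonormal_basis E I k"
    and J: "\<And>N. finite (J N)" "\<And>N. J N \<subseteq> I"
      "\<And>A. finite A \<Longrightarrow> A \<subseteq> I \<Longrightarrow> \<forall>\<^sub>F N in sequentially. A \<subseteq> J N"
  shows "(\<lambda>N. \<Sum>n\<in>J N. k n z * cnj (k n w)) \<longlonglongrightarrow> K z w"
proof -
  define f where "f = (\<lambda>u. K u w)"
  have f: "f \<in> H" unfolding f_def by (rule K_in_space)
  have k: "k n \<in> H" if "n \<in> I" for n using onb that by (simp add: dB_orthonormal_basis_def)
  have o: "dB_inner E (k m) (k n) = (if m = n then 1 else 0)" if "m \<in> I" "n \<in> I" for m n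
    using onb that by (simp add: dB_orthonormal_basis_def)
  have fk: "dB_inner E f (k n) = cnj (k n w)" if "n \<in> I" for n
    using K_reproducing[OF k[OF that], of w] inner_cnj[of f "k n"] by (simp add: f_def)
  define r where "r N = (\<lambda>z. f z - (\<Sum>n\<in>J N. dB_inner E f (k n) * k n z))" for N
  have rH: "r N \<in> H" for N
    unfolding r_def using J(2)[of N] k by (intro deBranges_space_diff f deBranges_space_sum) auto
  have r0: "(\<lambda>N. dB_norm E (r N)) \<longlonglongrightarrow> 0"
  proof (rule LIMSEQ_I)
    fix e :: real assume e: "e > 0"
    then obtain A c where A: "finite A" "A \<subseteq> I" "dB_norm E (\<lambda>z. f z - (\<Sum>n\<in>A. c n * k n z)) < e"
      using onb f unfolding dB_orthonormal_basis_def by blast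
    have "\<forall>\<^sub>F N in sequentially. norm (dB_norm E (r N) - 0) < e"
      using J(3)[OF A(1,2)]
    proof eventually_elim
      case (elim N)
      have "dB_norm E (r N) \<le> dB_norm E (\<lambda>z. f z - (\<Sum>n\<in>A. c n * k n z))"
        unfolding r_def
      proof (rule orthonormal_best_approximation[OF _ J(1) elim _ f])
        show "k n \<in> H" if "n \<in> J N" for n using k that J(2)[of N] by auto
        show "dB_inner E (k m) (k n) = (if m = n then 1 else 0)" if "m \<in> J N" "n \<in> J N" for m n
          by (rule o) (use that J(2)[of N] in auto)
      qed
      then show ?case using A(3) norm_nonneg[of "r N"] by simp
    qed
    then show "\<exists>no. \<forall>n\<ge>no. norm (dB_norm E (r n) - 0) < e" by (simp add: eventually_sequentially)
  qed
  have "(\<lambda>N. r N z) \<longlonglongrightarrow> 0"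
  proof (rule Lim_null_comparison)
    show "\<forall>\<^sub>F N in sequentially. norm (r N z) \<le> dB_norm E (r N) * dB_norm E (\<lambda>u. K u z)"
      using K_reproducing[OF rH] inner_Cauchy_Schwarz[OF rH K_in_space] by simp
    show "(\<lambda>N. dB_norm E (r N) * dB_norm E (\<lambda>u. K u z)) \<longlonglongrightarrow> 0"
      using tendsto_mult_right[OF r0, of "dB_norm E (\<lambda>u. K u z)"] by simp
  qed
  then have "(\<lambda>N. f z - r N z) \<longlonglongrightarrow> f z - 0" by (intro tendsto_intros)
  moreover have "f z - r N z = (\<Sum>n\<in>J N. k n z * cnj (k n w))" for N
    unfolding r_def using J(2)[of N] by (auto intro!: sum.cong simp: fk subset_eq mult.commute)
  ultimately show ?thesis by (simp add: f_def)
qed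

end

section \<open>Gaussian pairs: independence and sign changes\<close>

context prob_space
begin

lemma integrable_iexp_rv [simp]: "Y \<in> borel_measurable M \<Longrightarrow> integrable M (\<lambda>\<omega>. iexp (Y \<omega> :: real))"
  by (intro integrable_const_bound[of _ 1]) auto

text \<open>Under the measure with density \<open>g / c\<close> the variable \<open>X\<close> has the same characteristic function as
under \<open>M\<close>, so by uniqueness in dimension one it has the same law. This is the tool that
reduces the two-dimensional uniqueness statement below to dimension one.\<close>

lemma weighted_char_unique:
  fixes X g :: "'a \<Rightarrow> real"
  assumes X [measurable]: "X \<in> borel_measurable M" and g [measurable]: "g \<in> borel_measurable M"
    and bd: "\<And>\<omega>. 0 \<le> g \<omega>" "\<And>\<omega>. g \<omega> \<le> C" and c: "c = expectation g" "c > 0"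
    and ch: "\<And>s. (CLINT \<omega>|M. of_real (g \<omega>) * iexp (s * X \<omega>)) = of_real c * (CLINT \<omega>|M. iexp (s * X \<omega>))"
    and A [measurable]: "A \<in> sets borel"
  shows "expectation (\<lambda>\<omega>. g \<omega> * indicator A (X \<omega>)) = c * expectation (\<lambda>\<omega>. indicator A (X \<omega>))"
proof -
  have gi: "integrable M g"
    using bd by (intro integrable_const_bound[of _ C]) auto
  define N where "N = density M (\<lambda>\<omega>. ennreal (g \<omega> / c))"
  have nn: "AE \<omega> in M. 0 \<le> g \<omega> / c" using bd c by auto
  have [measurable]: "X \<in> borel_measurable N" unfolding N_def by simp
  have "prob_space N"
  proof
    have "emeasure N (space N) = (\<integral>\<^sup>+\<omega>. ennreal (g \<omega> / c) \<partial>M)"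
      unfolding N_def by (subst emeasure_density) (auto intro!: nn_integral_cong)
    also have "\<dots> = ennreal (expectation (\<lambda>\<omega>. g \<omega> / c))"
      using gi bd c by (intro nn_integral_eq_integral) auto
    also have "\<dots> = 1" using c by simp
    finally show "emeasure N (space N) = 1" .
  qed
  then interpret N: prob_space N .
  have "char (distr N borel X) = char (distr M borel X)"
  proof
    fix s
    have "char (distr N borel X) s = (CLINT \<omega>|N. iexp (s * X \<omega>))"
      unfolding char_def by (subst integral_distr) auto
    also have "\<dots> = (CLINT \<omega>|M. (g \<omega> / c) *\<^sub>R iexp (s * X \<omega>))"
      unfolding N_def using nn by (subst integral_density) auto
    also have "\<dots> = (CLINT \<omega>|M. (1 / of_real c) * (of_real (g \<omega>) * iexp (s * X \<omega>)))"
      by (intro Bochner_Integration.integral_cong) (auto simp: scaleR_conv_of_real)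
    also have "\<dots> = (1 / of_real c) * (CLINT \<omega>|M. of_real (g \<omega>) * iexp (s * X \<omega>))"
      by (rule integral_mult_right_zero)
    also have "\<dots> = (CLINT \<omega>|M. iexp (s * X \<omega>))" unfolding ch using c by simp
    also have "\<dots> = char (distr M borel X) s"
      unfolding char_def by (subst integral_distr) auto
    finally show "char (distr N borel X) s = char (distr M borel X) s" .
  qed
  then have eq: "distr N borel X = distr M borel X"
    by (intro Levy_uniqueness N.real_distribution_distr real_distribution_distr) auto
  have "expectation (\<lambda>\<omega>. indicator A (X \<omega>)) = (LINT x|distr M borel X. indicator A x :: real)"
    by (subst integral_distr) auto
  also have "\<dots> = (LINT \<omega>|N. indicator A (X \<omega>))" unfolding eq[symmetric]
    by (subst integral_distr) auto
  also have "\<dots> = (LINT \<omega>|M. (g \<omega> / c) *\<^sub>R indicator A (X \<omega>))"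
    unfolding N_def using nn by (subst integral_density) auto
  also have "\<dots> = (LINT \<omega>|M. (1 / c) * (g \<omega> * indicator A (X \<omega>)))"
    by (intro Bochner_Integration.integral_cong) auto
  also have "\<dots> = (1 / c) * expectation (\<lambda>\<omega>. g \<omega> * indicator A (X \<omega>))"
    by (rule integral_mult_right_zero)
  finally show ?thesis using c by simp
qed

text \<open>One-dimensional uniqueness is applied twice. For fixed \<open>t\<close> the weights \<open>2 + Re (u exp (i t Z))\<close>, which are
positive when \<open>\<bar>u\<bar> = 1\<close>, show that \<open>exp (i t Z)\<close> and the event \<open>X \<in> A\<close> are uncorrelated. Then
the indicator of that event is itself an admissible weight for \<open>Z\<close>.\<close>

lemma char_factor_imp_indep:
  fixes X Z :: "'a \<Rightarrow> real"
  assumes X [measurable]: "X \<in> borel_measurable M" and Z [measurable]: "Z \<in> borel_measurable M"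
    and fac: "\<And>s t. (CLINT \<omega>|M. iexp (s * X \<omega> + t * Z \<omega>)) = (CLINT \<omega>|M. iexp (s * X \<omega>)) * (CLINT \<omega>|M. iexp (t * Z \<omega>))"
    and A [measurable]: "A \<in> sets borel" and B [measurable]: "B \<in> sets borel"
  shows "expectation (\<lambda>\<omega>. indicator A (X \<omega>) * indicator B (Z \<omega>) :: real) = expectation (\<lambda>\<omega>. indicator A (X \<omega>)) * expectation (\<lambda>\<omega>. indicator B (Z \<omega>))"
proof -
  define pA :: real where "pA = expectation (\<lambda>\<omega>. indicator A (X \<omega>))"
  have iA: "integrable M (\<lambda>\<omega>. indicator A (X \<omega>) :: real)" by (intro integrable_const_bound[of _ 1]) (auto simp: indicator_def)
  have step: "expectation (\<lambda>\<omega>. Re (u * iexp (t * Z \<omega>)) * indicator A (X \<omega>)) = Re (u * (CLINT \<omega>|M. iexp (t * Z \<omega>))) * pA"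
    if u: "cmod u = 1" for u t
  proof -
    \<comment> \<open>the constant 2 makes the weight positive and bounds its mean away from 0\<close>
    define g where "g = (\<lambda>\<omega>. 2 + Re (u * iexp (t * Z \<omega>)))"
    have [measurable]: "g \<in> borel_measurable M" unfolding g_def by measurable
    let ?z = "CLINT \<omega>|M. iexp (t * Z \<omega>)"
    have n1: "cmod (u * iexp (t * Z \<omega>)) = 1" for \<omega> using u by (simp add: norm_mult)
    have r1: "\<bar>Re (u * iexp (t * Z \<omega>))\<bar> \<le> 1" for \<omega> using abs_Re_le_cmod[of "u * iexp (t * Z \<omega>)"] n1 by simp
    have ci: "complex_integrable M (\<lambda>\<omega>. u * iexp (t * Z \<omega>))" by (intro integrable_mult_right integrable_iexp_rv) auto
    have ri: "integrable M (\<lambda>\<omega>. Re (u * iexp (t * Z \<omega>)))" using ci by (rule integrable_Re)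
    have Eg: "expectation g = 2 + Re (u * ?z)"
    proof -
      have "expectation g = expectation (\<lambda>\<omega>. 2) + expectation (\<lambda>\<omega>. Re (u * iexp (t * Z \<omega>)))"
        unfolding g_def by (intro Bochner_Integration.integral_add ri) auto
      also have "expectation (\<lambda>\<omega>. Re (u * iexp (t * Z \<omega>))) = Re (CLINT \<omega>|M. u * iexp (t * Z \<omega>))"
        using ci by (rule integral_Re)
      also have "(CLINT \<omega>|M. u * iexp (t * Z \<omega>)) = u * ?z" by (rule integral_mult_right_zero)
      finally show ?thesis by (simp add: prob_space)
    qed
    have gb: "1 \<le> g \<omega>" "g \<omega> \<le> 3" for \<omega> using r1[of \<omega>] unfolding g_def by linarith+
    have "norm (g \<omega>) \<le> 3" for \<omega> using gb[of \<omega>] unfolding real_norm_def by linarith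
    then have gi: "integrable M g" by (intro integrable_const_bound[of _ 3]) auto
    have "expectation (\<lambda>\<omega>. 1) \<le> expectation g" by (intro integral_mono gi gb) auto
    then have pos: "expectation g > 0" by (simp add: prob_space)
    have "expectation (\<lambda>\<omega>. g \<omega> * indicator A (X \<omega>)) = expectation g * expectation (\<lambda>\<omega>. indicator A (X \<omega>))"
    proof (rule weighted_char_unique[OF X _ _ gb(2) refl pos _ A])
      show "0 \<le> g \<omega>" for \<omega> using gb(1)[of \<omega>] by simp
      fix s
      let ?x = "CLINT \<omega>|M. iexp (s * X \<omega>)"
      have "of_real (g \<omega>) * iexp (s * X \<omega>) = 2 * iexp (s * X \<omega>) + ((u / 2) * iexp (s * X \<omega> + t * Z \<omega>) + (cnj u / 2) * iexp (s * X \<omega> + (- t) * Z \<omega>))" for \<omega>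
      proof -
        have "of_real (g \<omega>) = 2 + (u * iexp (t * Z \<omega>) + cnj (u * iexp (t * Z \<omega>))) / 2"
          unfolding g_def complex_add_cnj by simp
        moreover have "cnj (u * iexp (t * Z \<omega>)) = cnj u * iexp (- t * Z \<omega>)" by (simp add: exp_cnj)
        moreover have "iexp (s * X \<omega> + y) = iexp (s * X \<omega>) * iexp y" for y
          by (simp add: exp_add[symmetric] algebra_simps)
        ultimately show ?thesis by (simp only:) (simp add: algebra_simps)
      qed
      then have "(CLINT \<omega>|M. of_real (g \<omega>) * iexp (s * X \<omega>)) = (CLINT \<omega>|M. 2 * iexp (s * X \<omega>) + ((u / 2) * iexp (s * X \<omega> + t * Z \<omega>) + (cnj u / 2) * iexp (s * X \<omega> + (- t) * Z \<omega>)))"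
        by simp
      also have "\<dots> = (CLINT \<omega>|M. 2 * iexp (s * X \<omega>)) + ((CLINT \<omega>|M. (u / 2) * iexp (s * X \<omega> + t * Z \<omega>)) + (CLINT \<omega>|M. (cnj u / 2) * iexp (s * X \<omega> + (- t) * Z \<omega>)))"
      proof -
        have "complex_integrable M (\<lambda>\<omega>. (u / 2) * iexp (s * X \<omega> + t * Z \<omega>))" 
             "complex_integrable M (\<lambda>\<omega>. (cnj u / 2) * iexp (s * X \<omega> + (- t) * Z \<omega>))"
             "complex_integrable M (\<lambda>\<omega>. 2 * iexp (s * X \<omega>))"
          by (intro integrable_mult_right integrable_iexp_rv; measurable)+
        then show ?thesis by (simp only: Bochner_Integration.integral_add Bochner_Integration.integrable_add)
      qed
      also have "\<dots> = 2 * ?x + ((u / 2) * (?x * ?z) + (cnj u / 2) * (?x * (CLINT \<omega>|M. iexp ((- t) * Z \<omega>))))"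
        by (simp only: integral_mult_right_zero fac)
      also have "(CLINT \<omega>|M. iexp ((- t) * Z \<omega>)) = cnj ?z"
        by (subst Bochner_Integration.integral_cnj[symmetric]) (simp add: exp_cnj)
      also have "2 * ?x + ((u / 2) * (?x * ?z) + (cnj u / 2) * (?x * cnj ?z)) = (2 + (u * ?z + cnj (u * ?z)) / 2) * ?x"
        by (simp add: algebra_simps divide_simps)
      also have "2 + (u * ?z + cnj (u * ?z)) / 2 = of_real (expectation g)"
        unfolding Eg complex_add_cnj by simp
      finally show "(CLINT \<omega>|M. of_real (g \<omega>) * iexp (s * X \<omega>)) = of_real (expectation g) * ?x" .
    qed measurable
    moreover have "expectation (\<lambda>\<omega>. g \<omega> * indicator A (X \<omega>)) = expectation (\<lambda>\<omega>. 2 * indicator A (X \<omega>)) + expectation (\<lambda>\<omega>. Re (u * iexp (t * Z \<omega>)) * indicator A (X \<omega>))"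
    proof -
      have "integrable M (\<lambda>\<omega>. Re (u * iexp (t * Z \<omega>)) * indicator A (X \<omega>))"
        using r1 by (intro integrable_const_bound[of _ 1]) (auto simp: indicator_def)
      then show ?thesis unfolding g_def distrib_right
        by (intro Bochner_Integration.integral_add integrable_mult_right iA)
    qed
    moreover have "expectation (\<lambda>\<omega>. 2 * indicator A (X \<omega>)) = 2 * pA" unfolding pA_def by (rule integral_mult_right_zero)
    ultimately show ?thesis unfolding Eg pA_def[symmetric] by (simp add: algebra_simps)
  qed
  have step2: "(CLINT \<omega>|M. of_real (indicator A (X \<omega>)) * iexp (t * Z \<omega>)) = of_real pA * (CLINT \<omega>|M. iexp (t * Z \<omega>))" for t
  proof -
    have ci: "complex_integrable M (\<lambda>\<omega>. of_real (indicator A (X \<omega>)) * iexp (t * Z \<omega>))"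
      by (intro integrable_const_bound[of _ 1]) (auto simp: norm_mult indicator_def)
    have "Re (CLINT \<omega>|M. of_real (indicator A (X \<omega>)) * iexp (t * Z \<omega>)) = expectation (\<lambda>\<omega>. Re (1 * iexp (t * Z \<omega>)) * indicator A (X \<omega>))"
      by (subst integral_Re[OF ci, symmetric]) (simp add: mult.commute)
    moreover have "Im (CLINT \<omega>|M. of_real (indicator A (X \<omega>)) * iexp (t * Z \<omega>)) = expectation (\<lambda>\<omega>. Re ((-\<i>) * iexp (t * Z \<omega>)) * indicator A (X \<omega>))"
      by (subst integral_Im[OF ci, symmetric]) (simp add: mult.commute)
    ultimately show ?thesis using step[of 1 t] step[of "-\<i>" t] by (simp add: complex_eq_iff mult.commute)
  qed
  show ?thesis
  proof (cases "pA = 0")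
    case True
    have ae: "AE \<omega> in M. indicator A (X \<omega>) = (0::real)"
      using True iA unfolding pA_def by (subst (asm) integral_nonneg_eq_0_iff_AE) auto
    have "expectation (\<lambda>\<omega>. indicator A (X \<omega>) * indicator B (Z \<omega>) :: real) = expectation (\<lambda>\<omega>. 0)"
    proof (intro integral_cong_AE)
      show "AE \<omega> in M. indicator A (X \<omega>) * indicator B (Z \<omega>) = (0::real)" using ae by eventually_elim simp
    qed measurable
    then show ?thesis using True by (simp add: pA_def)
  next
    case False
    have "pA \<ge> 0" unfolding pA_def by (intro integral_nonneg_AE) auto
    with False have "pA > 0" by simp
    from weighted_char_unique[OF Z _ _ _ pA_def this step2 B, of 1] show ?thesis
      by (simp add: pA_def)
  qed
qed

lemma expectation_indicator_compose:
  assumes [measurable]: "f \<in> measurable M N" "S \<in> sets N"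
  shows "expectation (\<lambda>\<omega>. indicator S (f \<omega>) :: real) = prob (f -` S \<inter> space M)"
proof -
  have "expectation (\<lambda>\<omega>. indicator S (f \<omega>) :: real) = expectation (indicator (f -` S \<inter> space M))"
    by (intro Bochner_Integration.integral_cong) (auto simp: indicator_def)
  also have "\<dots> = prob (f -` S \<inter> space M)" by simp
  finally show ?thesis .
qed

lemma char_factor_imp_product:
  fixes X Z :: "'a \<Rightarrow> real"
  assumes X [measurable]: "X \<in> borel_measurable M" and Z [measurable]: "Z \<in> borel_measurable M"
    and fac: "\<And>s t. (CLINT \<omega>|M. iexp (s * X \<omega> + t * Z \<omega>)) = (CLINT \<omega>|M. iexp (s * X \<omega>)) * (CLINT \<omega>|M. iexp (t * Z \<omega>))"
  shows "distr M (borel \<Otimes>\<^sub>M borel) (\<lambda>\<omega>. (X \<omega>, Z \<omega>)) = distr M borel X \<Otimes>\<^sub>M distr M borel Z"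
proof (rule sym, rule pair_measure_eqI)
  show "sigma_finite_measure (distr M borel X)" "sigma_finite_measure (distr M borel Z)"
    by (auto intro!: prob_space_imp_sigma_finite prob_space_distr)
  show "sets (distr M borel X \<Otimes>\<^sub>M distr M borel Z) = sets (distr M (borel \<Otimes>\<^sub>M borel) (\<lambda>\<omega>. (X \<omega>, Z \<omega>)))"
    by (simp cong: sets_pair_measure_cong)
  fix A B assume "A \<in> sets (distr M borel X)" "B \<in> sets (distr M borel Z)"
  then have A [measurable]: "A \<in> sets borel" and B [measurable]: "B \<in> sets borel" by auto
  have "expectation (\<lambda>\<omega>. indicator A (X \<omega>) * indicator B (Z \<omega>) :: real) = expectation (\<lambda>\<omega>. indicator (A \<times> B) (X \<omega>, Z \<omega>))"
    by (simp add: indicator_times)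
  also have "\<dots> = prob ((\<lambda>\<omega>. (X \<omega>, Z \<omega>)) -` (A \<times> B) \<inter> space M)"
    by (rule expectation_indicator_compose[where N = "borel \<Otimes>\<^sub>M borel"]) measurable
  finally have "prob ((\<lambda>\<omega>. (X \<omega>, Z \<omega>)) -` (A \<times> B) \<inter> space M) = prob (X -` A \<inter> space M) * prob (Z -` B \<inter> space M)"
    using char_factor_imp_indep[OF X Z fac A B] expectation_indicator_compose[OF X A] expectation_indicator_compose[OF Z B] by simp
  then show "emeasure (distr M borel X) A * emeasure (distr M borel Z) B = emeasure (distr M (borel \<Otimes>\<^sub>M borel) (\<lambda>\<omega>. (X \<omega>, Z \<omega>))) (A \<times> B)"
    by (simp add: emeasure_distr emeasure_eq_measure ennreal_mult)
qed

end

text \<open>The substitution \<open>z = - x u\<close> makes the slope \<open>u\<close> a variable of integration. The inner integral over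
\<open>x\<close> is then elementary and leaves the Cauchy density \<open>1 / (1 + u\<^sup>2)\<close>.\<close>

lemma std_normal_sector:
  "emeasure (std_normal_distribution \<Otimes>\<^sub>M std_normal_distribution) {p. fst p > 0 \<and> snd p < - c * fst p}
    = ennreal ((pi / 2 - arctan c) / (2 * pi))"
proof -
  let ?\<phi> = "std_normal_density"
  let ?S = "{p. fst p > 0 \<and> snd p < - c * fst p} :: (real \<times> real) set"
  interpret N: prob_space std_normal_distribution by (rule prob_space_normal_density) simp
  have "{p \<in> space (borel \<Otimes>\<^sub>M borel). fst p > 0 \<and> snd p < - c * fst p} \<in> sets (borel \<Otimes>\<^sub>M borel)"
    by measurable
  then have S [measurable]: "?S \<in> sets (borel \<Otimes>\<^sub>M borel)" 
    by (simp add: space_pair_measure)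
  have S': "?S \<in> sets (std_normal_distribution \<Otimes>\<^sub>M std_normal_distribution)"
    using S by (simp cong: sets_pair_measure_cong)
  have "emeasure (std_normal_distribution \<Otimes>\<^sub>M std_normal_distribution) ?S
     = (\<integral>\<^sup>+x. emeasure std_normal_distribution (Pair x -` ?S) \<partial>std_normal_distribution)"
    by (rule N.emeasure_pair_measure_alt[OF S'])
  also have "\<dots> = (\<integral>\<^sup>+x. ennreal (?\<phi> x) * emeasure std_normal_distribution (Pair x -` ?S) \<partial>lborel)"
    using N.measurable_emeasure_Pair[OF S'] by (intro nn_integral_density) auto
  also have "\<dots> = (\<integral>\<^sup>+x. (\<integral>\<^sup>+u. ennreal (x * ?\<phi> x * ?\<phi> (x * u)) * indicator {0<..} x * indicator {c<..} u \<partial>lborel) \<partial>lborel)"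
  proof (rule nn_integral_cong)
    fix x :: real
    show "ennreal (?\<phi> x) * emeasure std_normal_distribution (Pair x -` ?S)
       = (\<integral>\<^sup>+u. ennreal (x * ?\<phi> x * ?\<phi> (x * u)) * indicator {0<..} x * indicator {c<..} u \<partial>lborel)"
    proof (cases "x > 0")
      case True
      have "emeasure std_normal_distribution (Pair x -` ?S) = (\<integral>\<^sup>+z. ennreal (?\<phi> z) * indicator {..<-c * x} z \<partial>lborel)"
        using True by (subst emeasure_density) (auto intro!: nn_integral_cong simp: indicator_def)
      also have "\<dots> = ennreal x * (\<integral>\<^sup>+u. ennreal (?\<phi> (0 + (-x) * u)) * indicator {..<-c * x} (0 + (-x) * u) \<partial>lborel)"
        using True by (subst nn_integral_real_affine[where c = "-x" and t = 0]) auto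
      also have "\<dots> = ennreal x * (\<integral>\<^sup>+u. ennreal (?\<phi> (x * u)) * indicator {c<..} u \<partial>lborel)"
        using True by (intro arg_cong2[of _ _ _ _ "(*)"] refl nn_integral_cong) (auto simp: indicator_def std_normal_density_def)
      finally have "ennreal (?\<phi> x) * emeasure std_normal_distribution (Pair x -` ?S) = 
         (\<integral>\<^sup>+u. (ennreal (?\<phi> x) * ennreal x) * (ennreal (?\<phi> (x * u)) * indicator {c<..} u) \<partial>lborel)"
        by (subst nn_integral_cmult) (auto simp: mult.assoc)
      also have "\<dots> = (\<integral>\<^sup>+u. ennreal (x * ?\<phi> x * ?\<phi> (x * u)) * indicator {0<..} x * indicator {c<..} u \<partial>lborel)"
        using True by (intro nn_integral_cong) (auto simp: ennreal_mult mult_ac indicator_def)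
      finally show ?thesis .
    next
      case False
      then have "Pair x -` ?S = {}" by auto
      then show ?thesis using False by simp
    qed
  qed
  also have "\<dots> = (\<integral>\<^sup>+u. (\<integral>\<^sup>+x. ennreal (x * ?\<phi> x * ?\<phi> (x * u)) * indicator {0<..} x * indicator {c<..} u \<partial>lborel) \<partial>lborel)"
    by (rule lborel_pair.Fubini'[symmetric]) measurable
  also have "\<dots> = (\<integral>\<^sup>+u. ennreal (1 / (2 * pi) * inverse (1 + u\<^sup>2)) * indicator {c..} u \<partial>lborel)"
  proof (rule nn_integral_cong_AE)
    show "AE u in lborel. (\<integral>\<^sup>+x. ennreal (x * ?\<phi> x * ?\<phi> (x * u)) * indicator {0<..} x * indicator {c<..} u \<partial>lborel)
       = ennreal (1 / (2 * pi) * inverse (1 + u\<^sup>2)) * indicator {c..} u"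
      using AE_lborel_singleton[of c]
    proof eventually_elim
      fix u :: real assume u: "u \<noteq> c"
      have p: "1 + u\<^sup>2 > 0" by (simp add: add_pos_nonneg)
      have "(\<integral>\<^sup>+x. ennreal (x * ?\<phi> x * ?\<phi> (x * u)) * indicator {0<..} x \<partial>lborel)
        = (\<integral>\<^sup>+x. ennreal (1 / (2 * pi) * (x * exp (- (x\<^sup>2 * (1 + u\<^sup>2)) / 2))) * indicator {0..} x \<partial>lborel)"
      proof (intro nn_integral_cong)
        fix x :: real
        have "x * ?\<phi> x * ?\<phi> (x * u) = 1 / (2 * pi) * (x * exp (- (x\<^sup>2 * (1 + u\<^sup>2)) / 2))"
          by (simp add: std_normal_density_def exp_add[symmetric] power_mult_distrib field_simps)
        then show "ennreal (x * ?\<phi> x * ?\<phi> (x * u)) * indicator {0<..} x = ennreal (1 / (2 * pi) * (x * exp (- (x\<^sup>2 * (1 + u\<^sup>2)) / 2))) * indicator {0..} x"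
          by (cases "x = 0") (auto simp: indicator_def)
      qed
      also have "\<dots> = ennreal (0 - (- (1 / (2 * pi) * (exp (- (0\<^sup>2 * (1 + u\<^sup>2)) / 2) / (1 + u\<^sup>2)))))"
      proof (rule nn_integral_FTC_atLeast)
        fix x :: real
        show "((\<lambda>x. - (1 / (2 * pi) * (exp (- (x\<^sup>2 * (1 + u\<^sup>2)) / 2) / (1 + u\<^sup>2)))) has_real_derivative 1 / (2 * pi) * (x * exp (- (x\<^sup>2 * (1 + u\<^sup>2)) / 2))) (at x)"
        proof -
          have "((\<lambda>x. - (1 / (2 * pi) * (exp (- (x\<^sup>2 * P) / 2) / P))) has_real_derivative 1 / (2 * pi) * (x * exp (- (x\<^sup>2 * P) / 2))) (at x)"
            if "P > 0" for P :: real
            using that by (auto intro!: derivative_eq_intros)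
          from this[OF p] show ?thesis .
        qed
      next
        have "LIM x at_top. - (x\<^sup>2 * (1 + u\<^sup>2)) / 2 :> at_bot"
          using p by real_asymp
        then have "((\<lambda>x. exp (- (x\<^sup>2 * (1 + u\<^sup>2)) / 2)) \<longlongrightarrow> 0) at_top"
          by (rule filterlim_compose[OF exp_at_bot])
        then have "((\<lambda>x. - (1 / (2 * pi) * (exp (- (x\<^sup>2 * (1 + u\<^sup>2)) / 2) / (1 + u\<^sup>2)))) \<longlongrightarrow> - (1 / (2 * pi) * (0 / (1 + u\<^sup>2)))) at_top"
          using p by (intro tendsto_intros) auto
        then show "((\<lambda>x. - (1 / (2 * pi) * (exp (- (x\<^sup>2 * (1 + u\<^sup>2)) / 2) / (1 + u\<^sup>2)))) \<longlongrightarrow> 0) at_top" by simp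
      qed auto
      finally show "(\<integral>\<^sup>+x. ennreal (x * ?\<phi> x * ?\<phi> (x * u)) * indicator {0<..} x * indicator {c<..} u \<partial>lborel)
        = ennreal (1 / (2 * pi) * inverse (1 + u\<^sup>2)) * indicator {c..} u"
        using u by (auto simp: indicator_def inverse_eq_divide)
    qed
  qed
  also have "\<dots> = ennreal (1 / (2 * pi) * (pi / 2) - 1 / (2 * pi) * arctan c)"
  proof (rule nn_integral_FTC_atLeast)
    show "((\<lambda>u. 1 / (2 * pi) * arctan u) has_real_derivative 1 / (2 * pi) * inverse (1 + x\<^sup>2)) (at x)" for x
      by (intro DERIV_cmult DERIV_arctan)
    show "((\<lambda>u. 1 / (2 * pi) * arctan u) \<longlongrightarrow> 1 / (2 * pi) * (pi / 2)) at_top"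
      by (intro tendsto_intros tendsto_arctan_at_top)
    show "0 \<le> 1 / (2 * pi) * inverse (1 + x\<^sup>2)" for x :: real by (simp add: add_nonneg_nonneg)
  qed measurable
  also have "1 / (2 * pi) * (pi / 2) - 1 / (2 * pi) * arctan c = (pi / 2 - arctan c) / (2 * pi)"
    by (simp add: field_simps)
  finally show ?thesis .
qed

context prob_space
begin

lemma std_normal_of_char:
  assumes [measurable]: "X \<in> borel_measurable M"
    and ch: "\<And>s. (CLINT \<omega>|M. iexp (s * X \<omega>)) = of_real (exp (- (s\<^sup>2) / 2))"
  shows "distr M borel X = std_normal_distribution"
proof (rule Levy_uniqueness)
  show "char (distr M borel X) = char std_normal_distribution"
  proof
    fix s show "char (distr M borel X) s = char std_normal_distribution s"
      unfolding char_std_normal_distribution ch[symmetric] char_def by (subst integral_distr) auto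
  qed
qed (auto intro: real_dist_normal_dist)

lemma std_normal_pair_sector:
  assumes X [measurable]: "X \<in> borel_measurable M" and Z [measurable]: "Z \<in> borel_measurable M"
    and ch: "\<And>s t. (CLINT \<omega>|M. iexp (s * X \<omega> + t * Z \<omega>)) = of_real (exp (- (s\<^sup>2 + t\<^sup>2) / 2))"
  shows "prob {\<omega>\<in>space M. X \<omega> > 0 \<and> Z \<omega> < - c * X \<omega>} = (pi / 2 - arctan c) / (2 * pi)"
proof -
  have chX: "(CLINT \<omega>|M. iexp (s * X \<omega>)) = of_real (exp (- (s\<^sup>2) / 2))" for s using ch[of s 0] by simp
  have chZ: "(CLINT \<omega>|M. iexp (s * Z \<omega>)) = of_real (exp (- (s\<^sup>2) / 2))" for s using ch[of 0 s] by simp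
  have "distr M (borel \<Otimes>\<^sub>M borel) (\<lambda>\<omega>. (X \<omega>, Z \<omega>)) = distr M borel X \<Otimes>\<^sub>M distr M borel Z"
  proof (rule char_factor_imp_product[OF X Z])
    fix s t
    have "exp (- (s\<^sup>2 + t\<^sup>2) / 2) = exp (- (s\<^sup>2) / 2) * exp (- (t\<^sup>2) / 2 :: real)"
      by (simp add: exp_add[symmetric] field_simps)
    then show "(CLINT \<omega>|M. iexp (s * X \<omega> + t * Z \<omega>)) = (CLINT \<omega>|M. iexp (s * X \<omega>)) * (CLINT \<omega>|M. iexp (t * Z \<omega>))"
      unfolding ch chX chZ by (metis of_real_mult)
  qed
  also have "\<dots> = std_normal_distribution \<Otimes>\<^sub>M std_normal_distribution"
    using std_normal_of_char[OF X chX] std_normal_of_char[OF Z chZ] by simp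
  finally have d: "distr M (borel \<Otimes>\<^sub>M borel) (\<lambda>\<omega>. (X \<omega>, Z \<omega>)) = std_normal_distribution \<Otimes>\<^sub>M std_normal_distribution" .
  have "{p \<in> space (borel \<Otimes>\<^sub>M borel). fst p > 0 \<and> snd p < - c * fst p} \<in> sets (borel \<Otimes>\<^sub>M borel :: (real \<times> real) measure)"
    by measurable
  then have S: "{p. fst p > 0 \<and> snd p < - c * fst p} \<in> sets (borel \<Otimes>\<^sub>M borel :: (real \<times> real) measure)"
    by (simp add: space_pair_measure)
  have "emeasure M {\<omega>\<in>space M. X \<omega> > 0 \<and> Z \<omega> < - c * X \<omega>} 
     = emeasure (distr M (borel \<Otimes>\<^sub>M borel) (\<lambda>\<omega>. (X \<omega>, Z \<omega>))) {p. fst p > 0 \<and> snd p < - c * fst p}"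
    using S by (subst emeasure_distr) (auto intro!: arg_cong[of _ _ "emeasure M"])
  also have "\<dots> = ennreal ((pi / 2 - arctan c) / (2 * pi))" unfolding d by (rule std_normal_sector)
  finally show ?thesis using arctan_ubound[of c] by (simp add: measure_def)
qed

text \<open>After normalising the variances, the second variable is \<open>r X' + q Z\<close> with \<open>q = sqrt (1 - r\<^sup>2)\<close> and \<open>Z\<close> a
standard normal variable independent of \<open>X'\<close>. Opposite signs then mean that \<open>(X', Z)\<close> falls into one of
two opposite sectors. In the case \<open>r = 1\<close> the normalised variables coincide almost surely.\<close>

lemma gaussian_sign_change:
  assumes X [measurable]: "X \<in> borel_measurable M" and Y [measurable]: "Y \<in> borel_measurable M"
    and ch: "\<And>s t. (CLINT \<omega>|M. iexp (s * X \<omega> + t * Y \<omega>)) = of_real (exp (- (s\<^sup>2 * A + 2 * s * t * R + t\<^sup>2 * B) / 2))"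
    and AB: "A > 0" "B > 0" and r: "r = R / (sqrt A * sqrt B)" "-1 < r" "r \<le> 1"
  shows "prob {\<omega>\<in>space M. X \<omega> * Y \<omega> < 0} = arccos r / pi"
proof -
  have sA: "sqrt A > 0" "sqrt B > 0" using AB by auto
  have sq: "(sqrt A)\<^sup>2 = A" "(sqrt B)\<^sup>2 = B" using AB by auto
  have R: "R = r * sqrt A * sqrt B" using r(1) sA by simp
  show ?thesis
  proof (cases "r = 1")
    case True
    define D where "D = (\<lambda>\<omega>. X \<omega> / sqrt A - Y \<omega> / sqrt B)"
    have D [measurable]: "D \<in> borel_measurable M" unfolding D_def by measurable
    have "distr M borel D = return borel 0"
    proof (rule Levy_uniqueness)
      show "real_distribution (distr M borel D)" by simp
      show "real_distribution (return borel (0::real))"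
        by (auto intro!: prob_space_return simp: real_distribution_def real_distribution_axioms_def)
      show "char (distr M borel D) = char (return borel 0)"
      proof
        fix s
        have "char (distr M borel D) s = (CLINT \<omega>|M. iexp (s * D \<omega>))"
          unfolding char_def by (subst integral_distr) auto
        also have "\<dots> = (CLINT \<omega>|M. iexp ((s / sqrt A) * X \<omega> + (- s / sqrt B) * Y \<omega>))"
          by (simp add: D_def algebra_simps)
        also have "\<dots> = of_real (exp (- ((s / sqrt A)\<^sup>2 * A + 2 * (s / sqrt A) * (- s / sqrt B) * R + (- s / sqrt B)\<^sup>2 * B) / 2))"
          by (rule ch)
        also have "(s / sqrt A)\<^sup>2 * A + 2 * (s / sqrt A) * (- s / sqrt B) * R + (- s / sqrt B)\<^sup>2 * B = 0"
          using sA AB unfolding R True by (simp add: power_divide power2_eq_square)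
        also have "of_real (exp (- 0 / 2)) = char (return borel 0) s"
          unfolding char_def by (subst integral_return) auto
        finally show "char (distr M borel D) s = char (return borel 0) s" .
      qed
    qed
    then have "AE x in distr M borel D. x = 0" by (simp only:) (subst AE_return, auto)
    then have "AE \<omega> in M. D \<omega> = 0" by (subst (asm) AE_distr_iff) auto
    then have "AE \<omega> in M. \<not> (X \<omega> * Y \<omega> < 0)"
    proof eventually_elim
      case (elim \<omega>)
      then have "X \<omega> = sqrt A * (Y \<omega> / sqrt B)" using sA by (simp add: D_def field_simps)
      then have "X \<omega> * Y \<omega> = (sqrt A / sqrt B) * (Y \<omega>)\<^sup>2" by (simp add: power2_eq_square)
      moreover have "(sqrt A / sqrt B) * (Y \<omega>)\<^sup>2 \<ge> 0" using sA by (intro mult_nonneg_nonneg) auto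
      ultimately show ?case by simp
    qed
    then have "prob {\<omega>\<in>space M. X \<omega> * Y \<omega> < 0} = 0"
      by (subst prob_eq_0) auto
    then show ?thesis using True by simp
  next
    case False
    define q where "q = sqrt (1 - r\<^sup>2)"
    have "r\<^sup>2 < 1" using r False by (metis abs_square_less_1 abs_less_iff less_eq_real_def minus_less_iff)
    then have q: "q > 0" "q\<^sup>2 = 1 - r\<^sup>2" by (auto simp: q_def)
    define X' where "X' = (\<lambda>\<omega>. X \<omega> / sqrt A)"
    \<comment> \<open>the part of the second variable that is uncorrelated with the first, normalised\<close>
    define Z where "Z = (\<lambda>\<omega>. (Y \<omega> / sqrt B - r * X' \<omega>) / q)"
    have mX: "X' \<in> borel_measurable M" unfolding X'_def by measurable
    have mZ: "Z \<in> borel_measurable M" unfolding Z_def X'_def by measurable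
    have chXZ: "(CLINT \<omega>|M. iexp (s * X' \<omega> + t * Z \<omega>)) = of_real (exp (- (s\<^sup>2 + t\<^sup>2) / 2))" for s t
    proof -
      have "(CLINT \<omega>|M. iexp (s * X' \<omega> + t * Z \<omega>)) = (CLINT \<omega>|M. iexp (((s - t * r / q) / sqrt A) * X \<omega> + (t / q / sqrt B) * Y \<omega>))"
      proof -
        have "s * X' \<omega> + t * Z \<omega> = ((s - t * r / q) / sqrt A) * X \<omega> + (t / q / sqrt B) * Y \<omega>" for \<omega>
          by (simp add: X'_def Z_def diff_divide_distrib algebra_simps)
        then show ?thesis by simp
      qed
      also have "\<dots> = of_real (exp (- (((s - t * r / q) / sqrt A)\<^sup>2 * A + 2 * ((s - t * r / q) / sqrt A) * (t / q / sqrt B) * R + (t / q / sqrt B)\<^sup>2 * B) / 2))"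
        by (rule ch)
      also have "((s - t * r / q) / sqrt A)\<^sup>2 * A + 2 * ((s - t * r / q) / sqrt A) * (t / q / sqrt B) * R + (t / q / sqrt B)\<^sup>2 * B
         = (s - t * r / q)\<^sup>2 + 2 * (s - t * r / q) * (t / q) * r + (t / q)\<^sup>2"
      proof -
        have "(x / a)\<^sup>2 * a\<^sup>2 + 2 * (x / a) * (y / b) * (r * a * b) + (y / b)\<^sup>2 * b\<^sup>2 = x\<^sup>2 + 2 * x * y * r + y\<^sup>2"
          if "a > 0" "b > 0" for x y a b :: real
          using that by (simp add: power_divide)
        from this[OF sA, of "s - t * r / q" "t / q"] show ?thesis unfolding R sq .
      qed
      also have "\<dots> = s\<^sup>2 + (t / q)\<^sup>2 * (1 - r\<^sup>2)"
        by (simp add: power2_eq_square algebra_simps diff_divide_distrib)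
      also have "\<dots> = s\<^sup>2 + t\<^sup>2" unfolding q(2)[symmetric] using q(1) by (simp add: power_divide)
      finally show ?thesis .
    qed
    have p1: "prob {\<omega>\<in>space M. X' \<omega> > 0 \<and> Z \<omega> < - (r / q) * X' \<omega>} = (pi / 2 - arctan (r / q)) / (2 * pi)"
      by (rule std_normal_pair_sector[OF mX mZ chXZ])
    have p2: "prob {\<omega>\<in>space M. - X' \<omega> > 0 \<and> - Z \<omega> < - (r / q) * (- X' \<omega>)} = (pi / 2 - arctan (r / q)) / (2 * pi)"
    proof (rule std_normal_pair_sector)
      show "(\<lambda>\<omega>. - X' \<omega>) \<in> borel_measurable M" "(\<lambda>\<omega>. - Z \<omega>) \<in> borel_measurable M" using mX mZ by auto
      show "(CLINT \<omega>|M. iexp (s * - X' \<omega> + t * - Z \<omega>)) = of_real (exp (- (s\<^sup>2 + t\<^sup>2) / 2))" for s t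
        using chXZ[of "-s" "-t"] by simp
    qed
    have YZ: "Y \<omega> = sqrt B * (r * X' \<omega> + q * Z \<omega>)" and XX: "X \<omega> = sqrt A * X' \<omega>" for \<omega>
      using sA q by (simp_all add: Z_def X'_def field_simps)
    have iff: "X \<omega> * Y \<omega> < 0 \<longleftrightarrow> (X' \<omega> > 0 \<and> Z \<omega> < - (r / q) * X' \<omega>) \<or> (- X' \<omega> > 0 \<and> - Z \<omega> < - (r / q) * (- X' \<omega>))" for \<omega>
    proof -
      have "X \<omega> * Y \<omega> = (sqrt A * sqrt B) * (X' \<omega> * (r * X' \<omega> + q * Z \<omega>))" unfolding YZ XX by simp
      then have "X \<omega> * Y \<omega> < 0 \<longleftrightarrow> X' \<omega> * (r * X' \<omega> + q * Z \<omega>) < 0"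
        using sA by (simp add: mult_less_0_iff zero_less_mult_iff)
      also have "\<dots> \<longleftrightarrow> (X' \<omega> > 0 \<and> q * Z \<omega> < - (r * X' \<omega>)) \<or> (X' \<omega> < 0 \<and> q * Z \<omega> > - (r * X' \<omega>))"
        by (auto simp: mult_less_0_iff)
      also have "q * Z \<omega> < - (r * X' \<omega>) \<longleftrightarrow> Z \<omega> < - (r / q) * X' \<omega>" using q by (simp add: field_simps)
      also have "q * Z \<omega> > - (r * X' \<omega>) \<longleftrightarrow> - Z \<omega> < - (r / q) * (- X' \<omega>)" using q by (simp add: field_simps, auto)
      finally show ?thesis by simp
    qed
    have "prob {\<omega>\<in>space M. X \<omega> * Y \<omega> < 0} = prob ({\<omega>\<in>space M. X' \<omega> > 0 \<and> Z \<omega> < - (r / q) * X' \<omega>} \<union> {\<omega>\<in>space M. - X' \<omega> > 0 \<and> - Z \<omega> < - (r / q) * (- X' \<omega>)})"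
      unfolding iff by (rule arg_cong[of _ _ prob]) auto
    also have "\<dots> = prob {\<omega>\<in>space M. X' \<omega> > 0 \<and> Z \<omega> < - (r / q) * X' \<omega>} + prob {\<omega>\<in>space M. - X' \<omega> > 0 \<and> - Z \<omega> < - (r / q) * (- X' \<omega>)}"
      using mX mZ by (intro finite_measure_Union) auto
    also have "\<dots> = (pi / 2 - arctan (r / q)) / pi" unfolding p1 p2 by (simp add: field_simps)
    also have "arctan (r / q) = arcsin r"
      unfolding q_def using r(2,3) False by (intro arcsin_arctan[symmetric]) auto
    also have "pi / 2 - arcsin r = arccos r" using r by (simp add: arccos_arcsin_eq)
    finally show ?thesis .
  qed
qed

lemma gaussian_small_ball:
  assumes X [measurable]: "X \<in> borel_measurable M"
    and ch: "\<And>s. (CLINT \<omega>|M. iexp (s * X \<omega>)) = of_real (exp (- (s\<^sup>2 * A) / 2))"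
    and A: "A > 0" and e: "e \<ge> 0"
  shows "prob {\<omega>\<in>space M. \<bar>X \<omega>\<bar> \<le> e} \<le> 2 * e / sqrt A"
proof -
  define X' where "X' = (\<lambda>\<omega>. X \<omega> / sqrt A)"
  have sA: "sqrt A > 0" using A by simp
  have m [measurable]: "X' \<in> borel_measurable M" unfolding X'_def by measurable
  have "(CLINT \<omega>|M. iexp (s * X' \<omega>)) = of_real (exp (- (s\<^sup>2) / 2))" for s
    using ch[of "s / sqrt A"] A by (simp add: X'_def power_divide)
  then have d: "distr M borel X' = std_normal_distribution" by (rule std_normal_of_char[OF m])
  let ?e = "e / sqrt A"
  have e0: "?e \<ge> 0" using e sA by simp
  have "emeasure M {\<omega>\<in>space M. \<bar>X \<omega>\<bar> \<le> e} = emeasure (distr M borel X') {-?e..?e}"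
    using sA by (subst emeasure_distr) (auto intro!: arg_cong[of _ _ "emeasure M"] simp: X'_def field_simps abs_le_iff)
  also have "\<dots> = (\<integral>\<^sup>+x. ennreal (std_normal_density x) * indicator {-?e..?e} x \<partial>lborel)"
    unfolding d by (subst emeasure_density) auto
  also have "\<dots> \<le> (\<integral>\<^sup>+x. indicator {-?e..?e} x \<partial>lborel)"
  proof (intro nn_integral_mono)
    fix x
    have "std_normal_density x \<le> 1 * 1"
      unfolding std_normal_density_def
    proof (intro mult_mono)
      have "1 \<le> sqrt (2 * pi)" using pi_gt3 by simp
      then show "1 / sqrt (2 * pi) \<le> 1" by simp
    qed auto
    then show "ennreal (std_normal_density x) * indicator {-?e..?e} x \<le> indicator {-?e..?e} x"
      by (auto simp: indicator_def ennreal_le_1)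
  qed
  also have "\<dots> = ennreal (2 * e / sqrt A)" using e0 by simp
  finally show ?thesis using e sA by (simp add: emeasure_eq_measure)
qed

end

section \<open>The curve of a phase function and its Schwarzian\<close>

locale phase_curve =
  fixes \<phi> :: "real \<Rightarrow> real"
  assumes deriv_iter: "((deriv ^^ n) \<phi> has_real_derivative (deriv ^^ Suc n) \<phi> x) (at x)"
    and deriv_pos: "deriv \<phi> x > 0"
begin

definition "d1 = deriv \<phi>"
definition "d2 = deriv d1"
definition "d3 = deriv d2"
definition "d4 = deriv d3"

lemma phase_deriv: "(\<phi> has_real_derivative d1 x) (at x)"
  using deriv_iter[of 0 x] by (simp add: d1_def)

lemma d_derivs: "(d1 has_real_derivative d2 x) (at x)" "(d2 has_real_derivative d3 x) (at x)" "(d3 has_real_derivative d4 x) (at x)"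
  using deriv_iter[of 1 x] deriv_iter[of 2 x] deriv_iter[of 3 x] 
  by (simp_all add: numeral_eq_Suc d1_def d2_def d3_def d4_def)

lemma d4_isCont: "isCont d4 x"
  using DERIV_isCont[OF deriv_iter[of 4 x]] by (simp add: numeral_eq_Suc d1_def d2_def d3_def d4_def)

lemma d_1_pos: "d1 x > 0" using deriv_pos by (simp add: d1_def)
lemma d_1_nz: "d1 x \<noteq> 0" using d_1_pos[of x] by simp

text \<open>The logarithmic derivative of the amplitude \<open>1 / sqrt \<phi>'\<close> and its first two derivatives, in the form
produced by the quotient rule.\<close>

definition "logd x = - (1/2) * (d2 x / d1 x)"
definition "logd1 x = - (1/2) * ((d3 x * d1 x - d2 x * d2 x) / (d1 x * d1 x))"
definition "logd2 x = - (1/2) * (((d4 x * d1 x + d2 x * d3 x - (d3 x * d2 x + d3 x * d2 x)) * (d1 x * d1 x)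
   - (d3 x * d1 x - d2 x * d2 x) * (d2 x * d1 x + d2 x * d1 x)) / ((d1 x * d1 x) * (d1 x * d1 x)))"

lemma logd_deriv: "(logd has_real_derivative logd1 x) (at x)"
  unfolding logd_def[abs_def] logd1_def
  by (intro DERIV_cmult DERIV_divide d_derivs d_1_nz)

lemma logd1_deriv: "(logd1 has_real_derivative logd2 x) (at x)"
  unfolding logd1_def[abs_def] logd2_def using d_1_nz
  by (intro DERIV_cmult DERIV_divide DERIV_diff DERIV_mult d_derivs) auto

text \<open>Half the Schwarzian derivative of \<open>tan \<phi>\<close>, which appears below as the common potential of \<open>u\<close> and \<open>w\<close>.\<close>

definition "Q x = (d1 x)\<^sup>2 - logd1 x - (logd x)\<^sup>2"
definition "Q1 x = 2 * d1 x * d2 x - logd2 x - 2 * logd x * logd1 x"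

lemma Q_deriv: "(Q has_real_derivative Q1 x) (at x)"
  unfolding Q_def[abs_def] Q1_def
  by (auto intro!: derivative_eq_intros d_derivs logd_deriv logd1_deriv)

definition "amp x = 1 / sqrt (d1 x)"

lemma amp_pos: "amp x > 0" using d_1_pos by (simp add: amp_def)
lemma amp_sq: "d1 x * (amp x)\<^sup>2 = 1" using d_1_pos[of x] by (simp add: amp_def power_divide)

lemma amp_deriv: "(amp has_real_derivative logd x * amp x) (at x)"
proof -
  define s where "s = sqrt (d1 x)"
  have s: "s > 0" "d1 x = s * s" using d_1_pos[of x] by (auto simp: s_def)
  have "((\<lambda>x. inverse (sqrt (d1 x))) has_real_derivative - (inverse s * (inverse s / 2 * d2 x) * inverse s)) (at x)"
    unfolding s_def using d_1_pos[of x] by (auto intro!: derivative_eq_intros d_derivs simp: divide_simps)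
  also have "- (inverse s * (inverse s / 2 * d2 x) * inverse s) = logd x * amp x"
    unfolding logd_def amp_def s(2) using s(1) by (simp add: field_simps)
  finally show ?thesis by (simp add: amp_def[abs_def] inverse_eq_divide)
qed

definition "u x = amp x * cos (\<phi> x)"
definition "w x = amp x * sin (\<phi> x)"
definition "u1 x = logd x * u x - d1 x * w x"
definition "w1 x = logd x * w x + d1 x * u x"

lemma u_deriv: "(u has_real_derivative u1 x) (at x)"
  unfolding u_def[abs_def] u1_def w_def
  by (auto intro!: derivative_eq_intros amp_deriv phase_deriv simp: algebra_simps)

lemma w_deriv: "(w has_real_derivative w1 x) (at x)"
  unfolding w_def[abs_def] w1_def u_def
  by (auto intro!: derivative_eq_intros amp_deriv phase_deriv simp: algebra_simps)

lemma d2_logd: "d2 x = - 2 * logd x * d1 x" using d_1_nz[of x] by (simp add: logd_def)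

lemma u1_deriv: "(u1 has_real_derivative - Q x * u x) (at x)"
proof -
  have "(u1 has_real_derivative logd1 x * u x + logd x * u1 x - (d2 x * w x + d1 x * w1 x)) (at x)"
    unfolding u1_def[abs_def] 
    by (auto intro!: derivative_eq_intros logd_deriv d_derivs u_deriv[unfolded u1_def] w_deriv simp: u1_def algebra_simps)
  also have "logd1 x * u x + logd x * u1 x - (d2 x * w x + d1 x * w1 x) = - Q x * u x"
    unfolding d2_logd by (simp add: u1_def w1_def Q_def power2_eq_square algebra_simps)
  finally show ?thesis .
qed

lemma w1_deriv: "(w1 has_real_derivative - Q x * w x) (at x)"
proof -
  have "(w1 has_real_derivative logd1 x * w x + logd x * w1 x + (d2 x * u x + d1 x * u1 x)) (at x)"
    unfolding w1_def[abs_def] 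
    by (auto intro!: derivative_eq_intros logd_deriv d_derivs w_deriv[unfolded w1_def] u_deriv simp: w1_def algebra_simps)
  also have "logd1 x * w x + logd x * w1 x + (d2 x * u x + d1 x * u1 x) = - Q x * w x"
    unfolding d2_logd by (simp add: u1_def w1_def Q_def power2_eq_square algebra_simps)
  finally show ?thesis .
qed

lemma wronskian: "w1 x * u x - u1 x * w x = 1"
proof -
  have "w1 x * u x - u1 x * w x = d1 x * ((u x)\<^sup>2 + (w x)\<^sup>2)"
    by (simp add: u1_def w1_def power2_eq_square algebra_simps)
  also have "(u x)\<^sup>2 + (w x)\<^sup>2 = (amp x)\<^sup>2"
    unfolding u_def w_def power_mult_distrib distrib_left[symmetric] by simp
  finally show ?thesis by (simp add: amp_sq)
qed

definition "W x y = w x * u y - u x * w y"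
definition "T x y = - (Q1 x * W x y + Q x * (w1 x * u y - u1 x * w y))"

lemma W_eq: "W x y = amp x * amp y * sin (\<phi> x - \<phi> y)"
  by (simp add: W_def u_def w_def sin_diff algebra_simps)

text \<open>As a function of \<open>x\<close>, \<open>W x y\<close> solves \<open>f'' = - Q f\<close> with \<open>f y = 0\<close> and \<open>f' y = 1\<close>. So the terms
of order 0 and 2 vanish, and \<open>T\<close> is the third derivative.\<close>

lemma W_taylor:
  assumes "x \<noteq> y"
  shows "\<exists>t. min x y \<le> t \<and> t \<le> max x y \<and> W x y = (x - y) + T t y / 6 * (x - y)^3"
proof -
  \<comment> \<open>the derivatives of \<open>W x y\<close> in \<open>x\<close>, with the differential equation used from order 2 on\<close>
  define D where "D n = (if n = 0 then (\<lambda>x. W x y) else if n = 1 then (\<lambda>x. w1 x * u y - u1 x * w y) 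
     else if n = 2 then (\<lambda>x. - Q x * W x y) else (\<lambda>x. T x y))" for n :: nat
  have "\<exists>t. (if x < y then x < t \<and> t < y else y < t \<and> t < x) \<and>
      W x y = (\<Sum>m<3. (D m y / fact m) * (x - y)^m) + (D 3 t / fact 3) * (x - y)^3"
  proof (rule Taylor[where a = "min x y" and b = "max x y" and f = "\<lambda>x. W x y"])
    show "\<forall>m t. m < 3 \<and> min x y \<le> t \<and> t \<le> max x y \<longrightarrow> (D m has_real_derivative D (Suc m) t) (at t)"
    proof (intro allI impI)
      fix m :: nat and t assume "m < 3 \<and> min x y \<le> t \<and> t \<le> max x y"
      then consider "m = 0" | "m = 1" | "m = 2" by linarith
      then show "(D m has_real_derivative D (Suc m) t) (at t)"
      proof cases
        case 1
        then show ?thesis by (auto simp: D_def W_def intro!: derivative_eq_intros u_deriv w_deriv)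
      next
        case 2
        then show ?thesis by (auto simp: D_def W_def algebra_simps intro!: derivative_eq_intros u1_deriv w1_deriv)
      next
        case 3
        then show ?thesis by (auto simp: D_def W_def T_def algebra_simps intro!: derivative_eq_intros u_deriv w_deriv Q_deriv)
      qed
    qed
  qed (use assms in \<open>auto simp: D_def\<close>)
  then obtain t where t: "if x < y then x < t \<and> t < y else y < t \<and> t < x"
    "W x y = (\<Sum>m<3. (D m y / fact m) * (x - y)^m) + (D 3 t / fact 3) * (x - y)^3" by blast
  have "(\<Sum>m<3. (D m y / fact m) * (x - y)^m) = x - y"
    using wronskian[of y] by (simp add: D_def W_def numeral_3_eq_3)
  then show ?thesis using t assms
    by (intro exI[of _ t]) (auto simp: D_def fact_numeral split: if_splits)
qed

lemma T_diag: "T x x = - Q x"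
  using wronskian[of x] by (simp add: T_def W_def)

lemma T_continuous: "isCont (\<lambda>p. T (fst p) (snd p)) (x0, y0)"
proof -
  have f: "isCont (\<lambda>p. f (fst p)) (x0, y0)" and sn: "isCont (\<lambda>p. f (snd p)) (x0, y0)" if "\<And>z. isCont f z" for f :: "real \<Rightarrow> real"
    by (rule isCont_o2[OF isCont_fst[OF continuous_ident] that], rule isCont_o2[OF isCont_snd[OF continuous_ident] that])
  have dc: "isCont d1 z" "isCont d2 z" "isCont d3 z" for z
    using d_derivs[of z] by (auto intro: DERIV_isCont)
  have "isCont logd2 z" for z
    unfolding logd2_def[abs_def] using d_1_nz
    by (intro continuous_intros dc d4_isCont) auto
  then have "isCont Q1 z" for z
    unfolding Q1_def[abs_def]
    by (intro continuous_intros dc DERIV_isCont[OF logd_deriv] DERIV_isCont[OF logd1_deriv]) auto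
  note q1 = f[OF this]
  note fs = f[OF DERIV_isCont] sn[OF DERIV_isCont]
  show ?thesis unfolding T_def W_def
    by (intro continuous_intros q1 fs[OF Q_deriv] fs[OF u_deriv] fs[OF w_deriv] fs[OF u1_deriv] fs[OF w1_deriv])
qed

text \<open>The partitions in the counting argument use intervals near \<open>x\<close> rather than intervals starting at \<open>x\<close>;
so the limits are taken with both endpoints free.\<close>

definition off_diagonal :: "real \<Rightarrow> (real \<times> real) filter" where
  "off_diagonal x = at (x, x) within {p. fst p \<noteq> snd p}"

lemma one_minus_correlation_limit:
  "((\<lambda>p. (1 - W (fst p) (snd p) / (fst p - snd p)) / (fst p - snd p)\<^sup>2) \<longlongrightarrow> Q x / 6) (off_diagonal x)"
  unfolding off_diagonal_def
proof (rule tendstoI)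
  fix e :: real assume "e > 0"
  then obtain \<delta> where \<delta>: "\<delta> > 0" "\<And>p. dist p (x, x) < \<delta> \<Longrightarrow> dist (T (fst p) (snd p)) (T x x) < e"
    using T_continuous[of x x] unfolding continuous_at_eps_delta by auto
  show "\<forall>\<^sub>F p in at (x, x) within {p. fst p \<noteq> snd p}. dist ((1 - W (fst p) (snd p) / (fst p - snd p)) / (fst p - snd p)\<^sup>2) (Q x / 6) < e"
    unfolding eventually_at
  proof (intro exI[of _ "\<delta> / 2"] conjI ballI impI)
    fix p :: "real \<times> real" assume p: "p \<in> {p. fst p \<noteq> snd p}" "p \<noteq> (x, x) \<and> dist p (x, x) < \<delta> / 2"
    obtain a b where ab: "p = (a, b)" by (cases p)
    have ne: "a \<noteq> b" using p ab by simp
    have d: "dist a x < \<delta> / 2" "dist b x < \<delta> / 2" 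
      using p dist_fst_le[of p "(x,x)"] dist_snd_le[of p "(x,x)"] ab by auto
    obtain t where t: "min a b \<le> t" "t \<le> max a b" "W a b = (a - b) + T t b / 6 * (a - b)^3"
      using W_taylor[OF ne] by blast
    have "dist t x < \<delta> / 2" using t(1,2) d by (auto simp: dist_real_def min_def max_def abs_if split: if_splits)
    moreover have "dist (t, b) (x, x) \<le> dist t x + dist b x"
      by (simp add: dist_Pair_Pair sqrt_sum_squares_le_sum)
    ultimately have "dist (t, b) (x, x) < \<delta>" using d by simp
    from \<delta>(2)[OF this] have "\<bar>T t b + Q x\<bar> < e" by (simp add: T_diag dist_real_def)
    moreover have "(1 - W a b / (a - b)) / (a - b)\<^sup>2 = - T t b / 6"
    proof -
      have "W a b / (a - b) = 1 + T t b / 6 * (a - b)\<^sup>2" unfolding t(3) using ne by (simp add: field_simps power2_eq_square power3_eq_cube)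
      then show ?thesis using ne by simp
    qed
    ultimately show "dist ((1 - W (fst p) (snd p) / (fst p - snd p)) / (fst p - snd p)\<^sup>2) (Q x / 6) < e"
    proof -
      have eq: "dist (- T t b / 6) (Q x / 6) = \<bar>T t b + Q x\<bar> / 6" by (simp add: dist_real_def abs_if field_simps)
      have "dist (- T t b / 6) (Q x / 6) < e"
        unfolding eq using \<open>\<bar>T t b + Q x\<bar> < e\<close> by simp
      then show ?thesis using \<open>(1 - W a b / (a - b)) / (a - b)\<^sup>2 = - T t b / 6\<close> by (simp add: ab)
    qed
  qed (use \<delta> in simp)
qed

lemma arccos_eq_arcsin_half:
  assumes "-1 \<le> r" "r \<le> 1"
  shows "arccos r = 2 * arcsin (sqrt ((1 - r) / 2))"
proof -
  let ?t = "arccos r"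
  have b: "0 \<le> ?t" "?t \<le> pi" using assms by (auto intro: arccos_lbound arccos_ubound)
  have "r = 1 - 2 * (sin (?t / 2))\<^sup>2" using cos_double_sin[of "?t / 2"] assms by simp
  then have "(1 - r) / 2 = (sin (?t / 2))\<^sup>2" by simp
  moreover have "sin (?t / 2) \<ge> 0" using b by (intro sin_ge_zero) auto
  ultimately have "sqrt ((1 - r) / 2) = sin (?t / 2)" by simp
  then show ?thesis using b by (simp add: arcsin_sin)
qed

text \<open>By the half-angle formula \<open>arccos r = 2 arcsin (sqrt ((1 - r) / 2))\<close>, and \<open>arcsin t\<close> behaves like \<open>t\<close>
near 0. The correlation may be 1 off the diagonal, which happens for one-dimensional spaces.\<close>

lemma arccos_correlation_limit:
  assumes le: "\<And>x y. x \<noteq> y \<Longrightarrow> W x y / (x - y) \<le> 1"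
  shows "((\<lambda>p. arccos (W (fst p) (snd p) / (fst p - snd p)) / \<bar>fst p - snd p\<bar>) \<longlongrightarrow> sqrt (Q x / 3)) (off_diagonal x)"
    and "\<forall>\<^sub>F p in off_diagonal x. W (fst p) (snd p) / (fst p - snd p) > -1"
proof -
  let ?h = "\<lambda>p. fst p - snd p :: real" and ?r = "\<lambda>p. W (fst p) (snd p) / (fst p - snd p)"
  define g where "g = (\<lambda>p. (1 - ?r p) / (?h p)\<^sup>2)"
  have g: "(g \<longlongrightarrow> Q x / 6) (off_diagonal x)" unfolding g_def by (rule one_minus_correlation_limit)
  have ne: "\<forall>\<^sub>F p in off_diagonal x. fst p \<noteq> snd p"
    unfolding off_diagonal_def by (auto simp: eventually_at_filter)
  have h: "(?h \<longlongrightarrow> 0) (off_diagonal x)"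
  proof -
    have "((\<lambda>p. fst p - snd p :: real) \<longlongrightarrow> fst (x, x) - snd (x, x)) (off_diagonal x)"
      unfolding off_diagonal_def by (intro tendsto_intros tendsto_ident_at)
    then show ?thesis by simp
  qed
  have "((\<lambda>p. g p * (?h p)\<^sup>2) \<longlongrightarrow> Q x / 6 * 0\<^sup>2) (off_diagonal x)" by (intro tendsto_intros g h)
  moreover have gh: "\<forall>\<^sub>F p in off_diagonal x. g p * (?h p)\<^sup>2 = 1 - ?r p"
    using ne by eventually_elim (simp add: g_def)
  ultimately have r0: "((\<lambda>p. 1 - ?r p) \<longlongrightarrow> 0) (off_diagonal x)"
    by (simp add: Lim_transform_eventually)
  then have "\<forall>\<^sub>F p in off_diagonal x. 1 - ?r p < 2" by (rule order_tendstoD) simp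
  then show gt: "\<forall>\<^sub>F p in off_diagonal x. ?r p > -1" by eventually_elim linarith
  \<comment> \<open>completing \<open>arcsin t / t\<close> at 0 covers correlations equal to 1\<close>
  define A where "A t = (if t = 0 then 1 else arcsin t / t)" for t :: real
  have "(arcsin has_real_derivative 1) (at 0)"
    using DERIV_arcsin[of 0] by simp
  then have "((\<lambda>t. arcsin t / t) \<longlongrightarrow> 1) (at 0)" by (simp add: has_field_derivative_iff)
  then have "isCont A 0" unfolding A_def isCont_def
    by (auto simp: eventually_at_filter elim!: Lim_transform_eventually)
  have "((\<lambda>p. sqrt ((1 - ?r p) / 2)) \<longlongrightarrow> sqrt (0 / 2)) (off_diagonal x)" by (intro tendsto_intros r0) auto
  then have "((\<lambda>p. sqrt ((1 - ?r p) / 2)) \<longlongrightarrow> 0) (off_diagonal x)" by simp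
  from isCont_tendsto_compose[OF \<open>isCont A 0\<close> this]
  have "((\<lambda>p. A (sqrt ((1 - ?r p) / 2))) \<longlongrightarrow> 1) (off_diagonal x)" by (simp add: A_def)
  then have lim: "((\<lambda>p. 2 * (A (sqrt ((1 - ?r p) / 2)) * sqrt (g p / 2))) \<longlongrightarrow> 2 * (1 * sqrt (Q x / 6 / 2))) (off_diagonal x)"
    by (intro tendsto_intros g) auto
  have val: "2 * (1 * sqrt (Q x / 6 / 2)) = sqrt (Q x / 3)"
  proof -
    have "Q x / 3 = 2\<^sup>2 * (Q x / 6 / 2)" by simp
    then have "sqrt (Q x / 3) = sqrt (2\<^sup>2) * sqrt (Q x / 6 / 2)" by (metis real_sqrt_mult)
    then show ?thesis by simp
  qed
  have ev: "\<forall>\<^sub>F p in off_diagonal x. 2 * (A (sqrt ((1 - ?r p) / 2)) * sqrt (g p / 2)) = arccos (?r p) / \<bar>?h p\<bar>"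
    using ne gt gh
  proof eventually_elim
    case (elim p)
    let ?t = "sqrt ((1 - ?r p) / 2)"
    have "g p * (?h p)\<^sup>2 = 1 - ?r p" by (rule elim)
    then have "?t = sqrt (g p / 2 * (?h p)\<^sup>2)" by simp
    also have "\<dots> = sqrt (g p / 2) * \<bar>?h p\<bar>" by (simp only: real_sqrt_mult real_sqrt_abs)
    finally have t: "?t = sqrt (g p / 2) * \<bar>?h p\<bar>" .
    have "arccos (?r p) = 2 * arcsin ?t"
      using elim le[of "fst p" "snd p"] by (intro arccos_eq_arcsin_half) auto
    also have "arcsin ?t = A ?t * ?t" by (simp add: A_def)
    also have "2 * (A ?t * ?t) = 2 * (A ?t * sqrt (g p / 2)) * \<bar>?h p\<bar>" by (subst (2) t) simp
    finally show ?case using elim by simp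
  qed
  from Lim_transform_eventually[OF lim ev] show "((\<lambda>p. arccos (?r p) / \<bar>?h p\<bar>) \<longlongrightarrow> sqrt (Q x / 3)) (off_diagonal x)"
    unfolding val .
qed

end

text \<open>The coefficients are the Wronskians of \<open>f\<close> with \<open>w\<close> and \<open>u\<close>; they are constant because all three
functions solve the same equation.\<close>

lemma (in phase_curve) ode_solution:
  assumes f: "\<And>x. (f has_real_derivative f1 x) (at x)" "\<And>x. (f1 has_real_derivative - Q x * f x) (at x)"
  obtains a b where "\<And>x. f x = a * u x + b * w x" "\<And>x. f1 x = a * u1 x + b * w1 x"
proof -
  have "((\<lambda>x. f x * w1 x - f1 x * w x) has_real_derivative 0) (at x)" for x
    by (auto intro!: derivative_eq_intros f w_deriv w1_deriv simp: algebra_simps)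
  then have p: "f x * w1 x - f1 x * w x = f 0 * w1 0 - f1 0 * w 0" for x
    by (intro DERIV_isconst_all) auto
  have "((\<lambda>x. f1 x * u x - f x * u1 x) has_real_derivative 0) (at x)" for x
    by (auto intro!: derivative_eq_intros f u_deriv u1_deriv simp: algebra_simps)
  then have q: "f1 x * u x - f x * u1 x = f1 0 * u 0 - f 0 * u1 0" for x
    by (intro DERIV_isconst_all) auto
  show ?thesis
  proof (rule that[of "f 0 * w1 0 - f1 0 * w 0" "f1 0 * u 0 - f 0 * u1 0"])
    fix x
    have "f x = f x * (w1 x * u x - u1 x * w x)" by (simp add: wronskian)
    also have "\<dots> = (f x * w1 x - f1 x * w x) * u x + (f1 x * u x - f x * u1 x) * w x" by (simp add: algebra_simps)
    finally show "f x = (f 0 * w1 0 - f1 0 * w 0) * u x + (f1 0 * u 0 - f 0 * u1 0) * w x" unfolding p[of x] q[of x] .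
    have "f1 x = f1 x * (w1 x * u x - u1 x * w x)" by (simp add: wronskian)
    also have "\<dots> = (f x * w1 x - f1 x * w x) * u1 x + (f1 x * u x - f x * u1 x) * w1 x" by (simp add: algebra_simps)
    finally show "f1 x = (f 0 * w1 0 - f1 0 * w 0) * u1 x + (f1 0 * u 0 - f 0 * u1 0) * w1 x" unfolding p[of x] q[of x] .
  qed
qed

text \<open>The determinant is the quotient of the two Wronskians, both equal to 1.\<close>

lemma phase_curves_related:
  assumes "phase_curve \<phi>" "phase_curve \<psi>" and Q: "\<And>x. phase_curve.Q \<phi> x = phase_curve.Q \<psi> x"
  obtains a b c d where "a * d - b * c = 1"
    "\<And>x. phase_curve.u \<psi> x = a * phase_curve.u \<phi> x + b * phase_curve.w \<phi> x"
    "\<And>x. phase_curve.w \<psi> x = c * phase_curve.u \<phi> x + d * phase_curve.w \<phi> x"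
proof -
  interpret p: phase_curve \<phi> by fact
  interpret q: phase_curve \<psi> by fact
  obtain a b where ab: "\<And>x. q.u x = a * p.u x + b * p.w x" "\<And>x. q.u1 x = a * p.u1 x + b * p.w1 x"
    using p.ode_solution[OF q.u_deriv q.u1_deriv[folded Q]] by blast
  obtain c d where cd: "\<And>x. q.w x = c * p.u x + d * p.w x" "\<And>x. q.w1 x = c * p.u1 x + d * p.w1 x"
    using p.ode_solution[OF q.w_deriv q.w1_deriv[folded Q]] by blast
  have "1 = q.w1 0 * q.u 0 - q.u1 0 * q.w 0" by (simp add: q.wronskian)
  also have "\<dots> = (a * d - b * c) * (p.w1 0 * p.u 0 - p.u1 0 * p.w 0)"
    unfolding ab cd by (simp add: algebra_simps)
  finally have "a * d - b * c = 1" by (simp add: p.wronskian)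
  then show ?thesis using that ab cd by blast
qed

section \<open>Counting zeros by sign changes\<close>

definition grid :: "real \<Rightarrow> real \<Rightarrow> nat \<Rightarrow> nat \<Rightarrow> real" where
  "grid a b N i = a + (b - a) * (real i / real N)"

lemma grid_mem: "a \<le> b \<Longrightarrow> i \<le> N \<Longrightarrow> N > 0 \<Longrightarrow> grid a b N i \<in> {a..b}"
  using mult_left_mono[of "real i / real N" 1 "b - a"] by (simp add: grid_def)

lemma grid_step: "N > 0 \<Longrightarrow> grid a b N (Suc i) - grid a b N i = (b - a) / real N"
  by (simp add: grid_def field_simps)

lemma grid_cell:
  assumes ab: "a < b" and y: "y \<in> {a..b}" and N: "N > 0"
  obtains i where "i < N" "grid a b N i \<le> y" "y \<le> grid a b N (Suc i)"
proof (cases "y = b")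
  case True
  then show ?thesis using that[of "N - 1"] N ab grid_mem[of a b "N - 1" N] by (auto simp: grid_def)
next
  case False
  define t where "t = (y - a) * real N / (b - a)"
  have t: "0 \<le> t" "t < real N" using y ab N False by (auto simp: t_def divide_simps)
  define i where "i = nat \<lfloor>t\<rfloor>"
  have i: "real i \<le> t" "t < real i + 1" using t by (auto simp: i_def)
  have yt: "y = a + (b - a) * (t / real N)" using ab N by (simp add: t_def)
  show ?thesis
  proof (rule that[of i])
    show "i < N" using i(1) t(2) by linarith
    show "grid a b N i \<le> y" unfolding grid_def yt using i(1) ab N
      by (intro add_left_mono mult_left_mono divide_right_mono) auto
    show "y \<le> grid a b N (Suc i)" unfolding grid_def yt using i(2) ab N
      by (intro add_left_mono mult_left_mono divide_right_mono) auto
  qed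
qed

lemma simple_zero_sign_change:
  fixes f :: "real \<Rightarrow> real"
  assumes "(f has_real_derivative l) (at z)" "l \<noteq> 0" "f z = 0"
  shows "\<exists>\<delta>>0. \<forall>h h'. 0 < h \<longrightarrow> h < \<delta> \<longrightarrow> 0 < h' \<longrightarrow> h' < \<delta> \<longrightarrow> f (z - h) * f (z + h') < 0"
proof (cases "l > 0")
  case True
  obtain d1 where d1: "d1 > 0" "\<And>h. 0 < h \<Longrightarrow> h < d1 \<Longrightarrow> f z < f (z + h)"
    using DERIV_pos_inc_right[OF assms(1) True] by blast
  obtain d2 where d2: "d2 > 0" "\<And>h. 0 < h \<Longrightarrow> h < d2 \<Longrightarrow> f (z - h) < f z"
    using DERIV_pos_inc_left[OF assms(1) True] by blast
  show ?thesis using d1 d2 assms(3) by (intro exI[of _ "min d1 d2"]) (auto intro: mult_neg_pos)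
next
  case False
  then have l: "l < 0" using assms(2) by simp
  obtain d1 where d1: "d1 > 0" "\<And>h. 0 < h \<Longrightarrow> h < d1 \<Longrightarrow> f z > f (z + h)"
    using DERIV_neg_dec_right[OF assms(1) l] by blast
  obtain d2 where d2: "d2 > 0" "\<And>h. 0 < h \<Longrightarrow> h < d2 \<Longrightarrow> f (z - h) > f z"
    using DERIV_neg_dec_left[OF assms(1) l] by blast
  show ?thesis using d1 d2 assms(3) by (intro exI[of _ "min d1 d2"]) (auto intro: mult_pos_neg)
qed

definition sign_changes :: "(real \<Rightarrow> real) \<Rightarrow> real \<Rightarrow> real \<Rightarrow> nat \<Rightarrow> nat set" where
  "sign_changes f a b N = {i. i < N \<and> f (grid a b N i) * f (grid a b N (Suc i)) < 0}"

lemma finite_zeros_le_sign_changes: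
  fixes f :: "real \<Rightarrow> real"
  assumes ab: "a < b" and A: "finite A" "A \<subseteq> {x\<in>{a..b}. f x = 0}"
    and simple: "\<And>z. z \<in> A \<Longrightarrow> \<exists>l. l \<noteq> 0 \<and> (f has_real_derivative l) (at z)"
    and grid: "\<And>N i. N > 0 \<Longrightarrow> i \<le> N \<Longrightarrow> f (grid a b N i) \<noteq> 0"
  shows "\<forall>\<^sub>F N in sequentially. card A \<le> card (sign_changes f a b (Suc N))"
proof -
  have "\<forall>z\<in>A. \<exists>\<delta>>0. \<forall>h h'. 0 < h \<longrightarrow> h < \<delta> \<longrightarrow> 0 < h' \<longrightarrow> h' < \<delta> \<longrightarrow> f (z - h) * f (z + h') < 0"
    using simple simple_zero_sign_change A(2) by blast
  then obtain D where D: "\<And>z. z \<in> A \<Longrightarrow> D z > 0"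
    "\<And>z h h'. z \<in> A \<Longrightarrow> 0 < h \<Longrightarrow> h < D z \<Longrightarrow> 0 < h' \<Longrightarrow> h' < D z \<Longrightarrow> f (z - h) * f (z + h') < 0"
    by (auto simp: bchoice_iff)
  define \<delta> where "\<delta> = Min (insert 1 (D ` A))"
  have \<delta>: "\<delta> > 0" "\<And>z. z \<in> A \<Longrightarrow> \<delta> \<le> D z" using A(1) D(1) by (auto simp: \<delta>_def)
  have "(\<lambda>N. (b - a) * (1 / real (Suc N))) \<longlonglongrightarrow> (b - a) * 0"
    using LIMSEQ_inverse_real_of_nat by (intro tendsto_intros) (simp add: inverse_eq_divide)
  then have "\<forall>\<^sub>F N in sequentially. (b - a) * (1 / real (Suc N)) < \<delta>"
    using \<delta>(1) by (intro order_tendstoD(2)) auto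
  then show ?thesis
  proof eventually_elim
    case (elim N)
    let ?N = "Suc N" and ?g = "grid a b (Suc N)"
    have step: "?g (Suc i) - ?g i < \<delta>" for i using elim by (simp add: grid_step)
    have "\<exists>i. i < ?N \<and> ?g i < z \<and> z < ?g (Suc i)" if z: "z \<in> A" for z
    proof -
      have "z \<in> {a..b}" "f z = 0" using z A(2) by auto
      moreover obtain i where "i < ?N" "?g i \<le> z" "z \<le> ?g (Suc i)" using grid_cell[OF ab \<open>z \<in> {a..b}\<close>, of ?N] by auto
      moreover have "f (?g i) \<noteq> 0" "f (?g (Suc i)) \<noteq> 0" using \<open>i < ?N\<close> grid[of ?N] by auto
      ultimately show ?thesis by (intro exI[of _ i]) (auto simp: order_le_less)
    qed
    then obtain I where I: "\<And>z. z \<in> A \<Longrightarrow> I z < ?N" "\<And>z. z \<in> A \<Longrightarrow> ?g (I z) < z" "\<And>z. z \<in> A \<Longrightarrow> z < ?g (Suc (I z))"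
      by metis
    have close: "z - ?g (I z) < D z" "?g (Suc (I z)) - z < D z" if "z \<in> A" for z
      using I(2,3)[OF that] step[of "I z"] \<delta>(2)[OF that] by linarith+
    have sc: "I z \<in> sign_changes f a b ?N" if z: "z \<in> A" for z
    proof -
      have "f (z - (z - ?g (I z))) * f (z + (?g (Suc (I z)) - z)) < 0"
        using I(2,3)[OF z] close[OF z] by (intro D(2)[OF z]) auto
      then show ?thesis using I(1)[OF z] by (simp add: sign_changes_def)
    qed
    \<comment> \<open>a second zero in the same cell would lie where the first one forces a nonzero value\<close>
    have no: "\<not> z < z'" if "z \<in> A" "z' \<in> A" "I z = I z'" for z z'
    proof
      assume "z < z'"
      have "z' - z < D z" using close(2)[OF that(1)] I(3)[OF that(2)] that(3) by simp
      then have "f (z - (z - ?g (I z))) * f (z + (z' - z)) < 0"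
        using I(2)[OF that(1)] close(1)[OF that(1)] \<open>z < z'\<close> by (intro D(2)[OF that(1)]) auto
      moreover have "f z' = 0" using that(2) A(2) by auto
      ultimately show False by simp
    qed
    have "inj_on I A"
    proof (rule inj_onI)
      fix z z' assume "z \<in> A" "z' \<in> A" "I z = I z'"
      then show "z = z'" using no[of z z'] no[of z' z] by (simp add: less_linear[of z z', THEN disjE] not_less_iff_gr_or_eq) 
    qed
    then have "card A = card (I ` A)" by (simp add: card_image)
    also have "\<dots> \<le> card (sign_changes f a b ?N)"
    proof (rule card_mono)
      show "finite (sign_changes f a b ?N)" by (simp add: sign_changes_def)
      show "I ` A \<subseteq> sign_changes f a b ?N" using sc by auto
    qed
    finally show ?case .
  qed
qed

text \<open>Every finite set of simple zeros is separated by a sufficiently fine partition, and then produces a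
sign change in as many distinct cells.\<close>

lemma zero_count_le_liminf:
  fixes f :: "real \<Rightarrow> real"
  assumes ab: "a < b"
    and simple: "\<And>z. z \<in> {a..b} \<Longrightarrow> f z = 0 \<Longrightarrow> \<exists>l. l \<noteq> 0 \<and> (f has_real_derivative l) (at z)"
    and grid: "\<And>N i. N > 0 \<Longrightarrow> i \<le> N \<Longrightarrow> f (grid a b N i) \<noteq> 0"
  shows "emeasure (count_space UNIV) {x\<in>{a..b}. f x = 0} \<le> liminf (\<lambda>N. of_nat (card (sign_changes f a b (Suc N))) :: ennreal)"
    (is "_ \<le> ?L")
proof -
  let ?Z = "{x\<in>{a..b}. f x = 0}"
  have le: "of_nat (card A) \<le> ?L" if "finite A" "A \<subseteq> ?Z" for A
  proof (rule Liminf_bounded)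
    show "\<forall>\<^sub>F N in sequentially. (of_nat (card A) :: ennreal) \<le> of_nat (card (sign_changes f a b (Suc N)))"
    proof -
      have "\<forall>\<^sub>F N in sequentially. card A \<le> card (sign_changes f a b (Suc N))"
      proof (rule finite_zeros_le_sign_changes[OF ab that])
        show "\<exists>l. l \<noteq> 0 \<and> (f has_real_derivative l) (at z)" if "z \<in> A" for z
          by (rule simple) (use that \<open>A \<subseteq> ?Z\<close> in auto)
      qed (rule grid)
      then show ?thesis by eventually_elim simp
    qed
  qed
  show ?thesis
  proof (cases "finite ?Z")
    case True
    then show ?thesis using le[of ?Z] by (simp add: emeasure_count_space_finite)
  next
    case False
    have nat_le: "of_nat n \<le> ?L" for n
      using infinite_arbitrarily_large[OF False, of n] le by auto
    have "?L = \<infinity>"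
    proof (rule ccontr)
      assume "?L \<noteq> \<infinity>"
      then obtain r where r: "r \<ge> 0" "?L = ennreal r" by (cases ?L) auto
      obtain n :: nat where "real n > r" using reals_Archimedean2 by blast
      moreover have "ennreal (real n) \<le> ennreal r" using nat_le[of n] r(2) by (simp add: ennreal_of_nat_eq_real_of_nat)
      ultimately show False using r(1) by simp
    qed
    then show ?thesis by simp
  qed
qed

text \<open>This is what the counting argument uses of an entire function that is real on the real line: it is differentiable,
and near a double zero it is quadratically small, uniformly on intervals.\<close>

definition tame :: "(real \<Rightarrow> real) \<Rightarrow> bool" where
  "tame f \<longleftrightarrow> (\<exists>f'. (\<forall>x. (f has_real_derivative f' x) (at x)) \<and>
     (\<forall>a b y. f y = 0 \<longrightarrow> f' y = 0 \<longrightarrow> (\<exists>B::nat. \<forall>x\<in>{a..b}. \<bar>f x\<bar> \<le> real B * (x - y)\<^sup>2)))"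

context prob_space
begin

abbreviation flips :: "(real \<Rightarrow> 'a \<Rightarrow> real) \<Rightarrow> real \<Rightarrow> real \<Rightarrow> 'a set" where
  "flips X x y \<equiv> {\<omega>\<in>space M. X x \<omega> * X y \<omega> < 0}"

text \<open>Bulinskaya's argument: a path with a double zero is of order \<open>1 / n\<^sup>2\<close> at one of \<open>n\<close> grid points. Each
of these events has a probability of that order, so the union has probability of order \<open>1 / n\<close>.
The bound \<open>B\<close> is frozen first; the exceptional set is then contained in a measurable null set,
whether or not it is itself measurable.\<close>

lemma no_double_zeros:
  fixes X :: "real \<Rightarrow> 'a \<Rightarrow> real"
  assumes [measurable]: "\<And>x. X x \<in> borel_measurable M" and ab: "a < b" and C: "C \<ge> 0"
    and small: "\<And>x e. x \<in> {a..b} \<Longrightarrow> e \<ge> 0 \<Longrightarrow> prob {\<omega>\<in>space M. \<bar>X x \<omega>\<bar> \<le> e} \<le> C * e"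
  shows "AE \<omega> in M. \<not> (\<exists>y\<in>{a..b}. \<exists>B::nat. \<forall>x\<in>{a..b}. \<bar>X x \<omega>\<bar> \<le> real B * (x - y)\<^sup>2)"
proof -
  have "AE \<omega> in M. \<not> (\<exists>y\<in>{a..b}. \<forall>x\<in>{a..b}. \<bar>X x \<omega>\<bar> \<le> real B * (x - y)\<^sup>2)" for B :: nat
  proof -
    define e where "e n = real B * ((b - a) / real (Suc n))\<^sup>2" for n
    have e0: "e n \<ge> 0" for n by (simp add: e_def)
    define U where "U n = (\<Union>i\<in>{..n}. {\<omega>\<in>space M. \<bar>X (grid a b (Suc n) i) \<omega>\<bar> \<le> e n})" for n
    have [measurable]: "U n \<in> sets M" for n unfolding U_def by measurable
    have le: "prob (U n) \<le> C * real B * (b - a)\<^sup>2 * (1 / real (Suc n))" for n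
    proof -
      have "prob (U n) \<le> (\<Sum>i\<in>{..n}. prob {\<omega>\<in>space M. \<bar>X (grid a b (Suc n) i) \<omega>\<bar> \<le> e n})"
        unfolding U_def by (intro finite_measure_subadditive_finite) auto
      also have "\<dots> \<le> (\<Sum>i\<in>{..n}. C * e n)"
        using ab by (intro sum_mono small grid_mem e0) auto
      also have "\<dots> = real (Suc n) * (C * e n)" by simp
      also have "\<dots> = C * real B * (b - a)\<^sup>2 * (1 / real (Suc n))"
      proof -
        have "m * (C * (real B * ((b - a) / m)\<^sup>2)) = C * real B * (b - a)\<^sup>2 * (1 / m)" if "m > 0" for m :: real
          using that by (simp add: power2_eq_square)
        from this[of "real (Suc n)"] show ?thesis by (simp add: e_def)
      qed
      finally show ?thesis .
    qed
    have "(\<lambda>n. C * real B * (b - a)\<^sup>2 * (1 / real (Suc n))) \<longlonglongrightarrow> C * real B * (b - a)\<^sup>2 * 0"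
      using LIMSEQ_inverse_real_of_nat by (intro tendsto_intros) (simp add: inverse_eq_divide)
    then have "prob (\<Inter>n. U n) \<le> C * real B * (b - a)\<^sup>2 * 0"
    proof (rule LIMSEQ_le_const)
      have "prob (\<Inter>n. U n) \<le> prob (U n)" for n by (intro finite_measure_mono) auto
      then show "\<exists>N. \<forall>n\<ge>N. prob (\<Inter>n. U n) \<le> C * real B * (b - a)\<^sup>2 * (1 / real (Suc n))"
        using le order_trans by blast
    qed
    then have "prob (\<Inter>n. U n) = 0" by (simp add: measure_le_0_iff)
    then have "(\<Inter>n. U n) \<in> null_sets M" by (intro null_setsI) (auto simp: emeasure_eq_measure)
    then have "AE \<omega> in M. \<omega> \<notin> (\<Inter>n. U n)" by (rule AE_not_in)
    then show ?thesis using AE_space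
    proof eventually_elim
      case (elim \<omega>)
      show ?case
      proof
        assume "\<exists>y\<in>{a..b}. \<forall>x\<in>{a..b}. \<bar>X x \<omega>\<bar> \<le> real B * (x - y)\<^sup>2"
        then obtain y where y: "y \<in> {a..b}" "\<And>x. x \<in> {a..b} \<Longrightarrow> \<bar>X x \<omega>\<bar> \<le> real B * (x - y)\<^sup>2" by blast
        have "\<omega> \<in> U n" for n
        proof -
          obtain i where i: "i < Suc n" "grid a b (Suc n) i \<le> y" "y \<le> grid a b (Suc n) (Suc i)"
            using grid_cell[OF ab y(1), of "Suc n"] by auto
          have g: "grid a b (Suc n) i \<in> {a..b}" using ab i by (intro grid_mem) auto
          have "\<bar>grid a b (Suc n) i - y\<bar> \<le> (b - a) / real (Suc n)"
            using i grid_step[of "Suc n" a b i] by linarith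
          then have "(grid a b (Suc n) i - y)\<^sup>2 \<le> ((b - a) / real (Suc n))\<^sup>2"
            by (metis abs_ge_zero power2_abs power_mono)
          then have "real B * (grid a b (Suc n) i - y)\<^sup>2 \<le> e n" unfolding e_def by (intro mult_left_mono) auto
          with y(2)[OF g] have "\<bar>X (grid a b (Suc n) i) \<omega>\<bar> \<le> e n" by linarith
          then show ?thesis using i(1) elim(2) by (auto simp: U_def)
        qed
        then show False using elim(1) by auto
      qed
    qed
  qed
  then have "AE \<omega> in M. \<forall>B::nat. \<not> (\<exists>y\<in>{a..b}. \<forall>x\<in>{a..b}. \<bar>X x \<omega>\<bar> \<le> real B * (x - y)\<^sup>2)"
    by (simp add: AE_all_countable)
  then show ?thesis by eventually_elim blast
qed

lemma expected_zeros_lower: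
  fixes X :: "real \<Rightarrow> 'a \<Rightarrow> real"
  assumes [measurable]: "\<And>x. X x \<in> borel_measurable M" and ab: "a < b"
    and tame: "AE \<omega> in M. tame (\<lambda>x. X x \<omega>)"
  shows "ennreal (prob (flips X a b)) \<le> (\<integral>\<^sup>+\<omega>. emeasure (count_space UNIV) {x\<in>{a..b}. X x \<omega> = 0} \<partial>M)"
proof -
  have "ennreal (prob (flips X a b)) = (\<integral>\<^sup>+\<omega>. indicator (flips X a b) \<omega> \<partial>M)"
    by (subst nn_integral_indicator) (auto simp: emeasure_eq_measure)
  also have "\<dots> \<le> (\<integral>\<^sup>+\<omega>. emeasure (count_space UNIV) {x\<in>{a..b}. X x \<omega> = 0} \<partial>M)"
  proof (rule nn_integral_mono_AE)
    show "AE \<omega> in M. indicator (flips X a b) \<omega> \<le> emeasure (count_space UNIV) {x\<in>{a..b}. X x \<omega> = 0}"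
      using tame
    proof eventually_elim
      case (elim \<omega>)
      show ?case
      proof (cases "X a \<omega> * X b \<omega> < 0")
        case True
        have c: "isCont (\<lambda>x. X x \<omega>) x" for x
          using elim unfolding tame_def by (meson DERIV_isCont)
        have "\<exists>x\<in>{a..b}. X x \<omega> = 0"
        proof (cases "X a \<omega> < 0")
          case True
          then show ?thesis using \<open>X a \<omega> * X b \<omega> < 0\<close> IVT[of "\<lambda>x. X x \<omega>" a 0 b] ab c by (auto simp: mult_less_0_iff)
        next
          case False
          then show ?thesis using \<open>X a \<omega> * X b \<omega> < 0\<close> IVT2[of "\<lambda>x. X x \<omega>" b 0 a] ab c by (auto simp: mult_less_0_iff)
        qed
        then obtain x where x: "x \<in> {a..b}" "X x \<omega> = 0" by blast
        have "1 = emeasure (count_space UNIV) {x}" by (subst emeasure_count_space_finite) auto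
        also have "\<dots> \<le> emeasure (count_space UNIV) {x\<in>{a..b}. X x \<omega> = 0}"
          using x by (intro emeasure_mono) auto
        finally show ?thesis using True by (auto simp: indicator_def)
      qed auto
    qed
  qed
  finally show ?thesis .
qed

lemma expected_zeros_upper:
  fixes X :: "real \<Rightarrow> 'a \<Rightarrow> real"
  assumes [measurable]: "\<And>x. X x \<in> borel_measurable M" and ab: "a < b" and C: "C \<ge> 0" and L: "L \<ge> 0"
    and tame: "AE \<omega> in M. tame (\<lambda>x. X x \<omega>)"
    and small: "\<And>x e. x \<in> {a..b} \<Longrightarrow> e \<ge> 0 \<Longrightarrow> prob {\<omega>\<in>space M. \<bar>X x \<omega>\<bar> \<le> e} \<le> C * e"
    and sc: "\<And>x y. x \<in> {a..b} \<Longrightarrow> y \<in> {a..b} \<Longrightarrow> x < y \<Longrightarrow> prob (flips X x y) \<le> L * (y - x)"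
  shows "(\<integral>\<^sup>+\<omega>. emeasure (count_space UNIV) {x\<in>{a..b}. X x \<omega> = 0} \<partial>M) \<le> ennreal (L * (b - a))"
proof -
  have nz: "AE \<omega> in M. X x \<omega> \<noteq> 0" if "x \<in> {a..b}" for x
  proof -
    have "prob {\<omega>\<in>space M. X x \<omega> = 0} \<le> 0" using small[OF that, of 0] by simp
    then have "prob {\<omega>\<in>space M. X x \<omega> = 0} = 0" by (simp add: measure_le_0_iff)
    then show ?thesis by (subst (asm) prob_eq_0) auto
  qed
  have "AE \<omega> in M. \<forall>N. \<forall>i. N > 0 \<longrightarrow> i \<le> N \<longrightarrow> X (grid a b N i) \<omega> \<noteq> 0"
    unfolding AE_all_countable using ab nz grid_mem[of a b] by auto
  moreover have "AE \<omega> in M. \<not> (\<exists>y\<in>{a..b}. \<exists>B::nat. \<forall>x\<in>{a..b}. \<bar>X x \<omega>\<bar> \<le> real B * (x - y)\<^sup>2)"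
    by (rule no_double_zeros[OF assms(1) ab C]) (rule small)
  ultimately have le: "AE \<omega> in M. emeasure (count_space UNIV) {x\<in>{a..b}. X x \<omega> = 0} \<le> liminf (\<lambda>N. of_nat (card (sign_changes (\<lambda>x. X x \<omega>) a b (Suc N))) :: ennreal)"
    using tame
  proof eventually_elim
    case (elim \<omega>)
    obtain f' where f': "\<And>x. ((\<lambda>x. X x \<omega>) has_real_derivative f' x) (at x)"
      "\<And>a b y. X y \<omega> = 0 \<Longrightarrow> f' y = 0 \<Longrightarrow> \<exists>B::nat. \<forall>x\<in>{a..b}. \<bar>X x \<omega>\<bar> \<le> real B * (x - y)\<^sup>2"
      using elim(3) unfolding tame_def by blast
    show ?case
    proof (rule zero_count_le_liminf[OF ab])
      fix z assume z: "z \<in> {a..b}" "X z \<omega> = 0"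
      have "f' z \<noteq> 0"
      proof
        assume "f' z = 0"
        from f'(2)[OF z(2) this, of a b] elim(2) z(1) show False by blast
      qed
      then show "\<exists>l. l \<noteq> 0 \<and> ((\<lambda>x. X x \<omega>) has_real_derivative l) (at z)" using f'(1) by blast
    qed (use elim(1) in auto)
  qed
  have ceq: "(of_nat (card (sign_changes (\<lambda>x. X x \<omega>) a b N)) :: ennreal) = (\<Sum>i<N. indicator (flips X (grid a b N i) (grid a b N (Suc i))) \<omega>)"
    if "\<omega> \<in> space M" for \<omega> N
  proof -
    have "(of_nat (card (sign_changes (\<lambda>x. X x \<omega>) a b N)) :: ennreal) = (\<Sum>i\<in>sign_changes (\<lambda>x. X x \<omega>) a b N. 1)" by simp
    also have "\<dots> = (\<Sum>i<N. indicator (flips X (grid a b N i) (grid a b N (Suc i))) \<omega>)"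
      using that by (intro sum.mono_neutral_cong_left) (auto simp: sign_changes_def indicator_def)
    finally show ?thesis .
  qed
  have "(\<integral>\<^sup>+\<omega>. emeasure (count_space UNIV) {x\<in>{a..b}. X x \<omega> = 0} \<partial>M) 
     \<le> (\<integral>\<^sup>+\<omega>. liminf (\<lambda>N. of_nat (card (sign_changes (\<lambda>x. X x \<omega>) a b (Suc N))) :: ennreal) \<partial>M)"
    by (rule nn_integral_mono_AE[OF le])
  also have "\<dots> = (\<integral>\<^sup>+\<omega>. liminf (\<lambda>N. (\<Sum>i<Suc N. indicator (flips X (grid a b (Suc N) i) (grid a b (Suc N) (Suc i))) \<omega>)) \<partial>M)"
    by (intro nn_integral_cong) (simp only: ceq)
  also have "\<dots> \<le> liminf (\<lambda>N. \<integral>\<^sup>+\<omega>. (\<Sum>i<Suc N. indicator (flips X (grid a b (Suc N) i) (grid a b (Suc N) (Suc i))) \<omega>) \<partial>M)"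
    by (rule nn_integral_liminf) measurable
  also have "\<dots> \<le> liminf (\<lambda>N::nat. ennreal (L * (b - a)))"
  proof (intro Liminf_mono always_eventually allI)
    fix N :: nat
    have "(\<integral>\<^sup>+\<omega>. (\<Sum>i<Suc N. indicator (flips X (grid a b (Suc N) i) (grid a b (Suc N) (Suc i))) \<omega>) \<partial>M)
      = (\<Sum>i<Suc N. emeasure M (flips X (grid a b (Suc N) i) (grid a b (Suc N) (Suc i))))"
      by (subst nn_integral_sum) auto
    also have "\<dots> \<le> (\<Sum>i<Suc N. ennreal (L * ((b - a) / real (Suc N))))"
    proof (intro sum_mono)
      fix i assume i: "i \<in> {..<Suc N}"
      have "prob (flips X (grid a b (Suc N) i) (grid a b (Suc N) (Suc i))) \<le> L * (grid a b (Suc N) (Suc i) - grid a b (Suc N) i)"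
      proof (rule sc)
        show "grid a b (Suc N) i < grid a b (Suc N) (Suc i)"
          using grid_step[of "Suc N" a b i] ab by (metis diff_gt_0_iff_gt divide_pos_pos of_nat_0_less_iff zero_less_Suc)
        show "grid a b (Suc N) i \<in> {a..b}" "grid a b (Suc N) (Suc i) \<in> {a..b}"
          by (rule grid_mem; use i ab in simp)+
      qed
      then show "emeasure M (flips X (grid a b (Suc N) i) (grid a b (Suc N) (Suc i))) \<le> ennreal (L * ((b - a) / real (Suc N)))"
        by (simp add: grid_step emeasure_eq_measure ennreal_leI del: of_nat_Suc)
    qed
    also have "\<dots> = ennreal (\<Sum>i<Suc N. L * ((b - a) / real (Suc N)))"
      using L ab by (intro sum_ennreal) auto
    also have "(\<Sum>i<Suc N. L * ((b - a) / real (Suc N))) = L * (b - a)" by (simp del: of_nat_Suc)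
    finally show "(\<integral>\<^sup>+\<omega>. (\<Sum>i<Suc N. indicator (flips X (grid a b (Suc N) i) (grid a b (Suc N) (Suc i))) \<omega>) \<partial>M) \<le> ennreal (L * (b - a))" .
  qed
  also have "\<dots> = ennreal (L * (b - a))" by (simp add: Liminf_const)
  finally show ?thesis .
qed

text \<open>An interval contains at least as many zeros as the indicator of a sign change between its endpoints, and on
average at most as many as the sign changes in fine partitions. If the rate of sign changes has a limit at
\<open>x0\<close>, uniformly over short intervals nearby, both bounds agree with that limit, and so does the
continuous intensity.\<close>

theorem intensity_eq_sign_change_rate:
  fixes X :: "real \<Rightarrow> 'a \<Rightarrow> real"
  assumes meas: "\<And>x. X x \<in> borel_measurable M"
    and tame: "AE \<omega> in M. tame (\<lambda>x. X x \<omega>)"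
    and small: "\<And>a b. a < b \<Longrightarrow> \<exists>C\<ge>0. \<forall>x\<in>{a..b}. \<forall>e\<ge>0. prob {\<omega>\<in>space M. \<bar>X x \<omega>\<bar> \<le> e} \<le> C * e"
    and rate: "((\<lambda>p. prob (flips X (fst p) (snd p)) / \<bar>fst p - snd p\<bar>) \<longlongrightarrow> v) (at (x0, x0) within {p. fst p \<noteq> snd p})"
    and v: "v \<ge> 0"
    and intensity: "first_intensity M F \<rho>"
    and zeros: "AE \<omega> in M. \<forall>x. F \<omega> (of_real x) = 0 \<longleftrightarrow> X x \<omega> = 0"
  shows "\<rho> x0 = v"
proof -
  have "\<bar>\<rho> x0 - v\<bar> \<le> 2 * e" if e: "e > 0" for e
  proof -
    obtain \<delta>1 where \<delta>1: "\<delta>1 > 0" "\<And>p. fst p \<noteq> snd p \<Longrightarrow> p \<noteq> (x0, x0) \<Longrightarrow> dist p (x0, x0) < \<delta>1 \<Longrightarrow> 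
        dist (prob (flips X (fst p) (snd p)) / \<bar>fst p - snd p\<bar>) v < e"
      using tendstoD[OF rate e] unfolding eventually_at by auto
    have "isCont \<rho> x0" using intensity by (auto simp: first_intensity_def continuous_on_eq_continuous_at)
    then obtain \<delta>2 where \<delta>2: "\<delta>2 > 0" "\<And>x. dist x x0 < \<delta>2 \<Longrightarrow> dist (\<rho> x) (\<rho> x0) < e"
      using e unfolding continuous_at_eps_delta by blast
    \<comment> \<open>the factor 4 keeps pairs of points of the interval within distance \<open>\<delta>1\<close> of \<open>(x0, x0)\<close>\<close>
    define \<delta> where "\<delta> = min \<delta>1 \<delta>2 / 4"
    have \<delta>: "\<delta> > 0" "2 * \<delta> < \<delta>1" "\<delta> < \<delta>2" using \<delta>1(1) \<delta>2(1) by (auto simp: \<delta>_def min_def)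
    define b where "b = x0 + \<delta>"
    have ab: "x0 < b" using \<delta> by (simp add: b_def)
    have P: "\<bar>prob (flips X x y) / (y - x) - v\<bar> < e" if "x \<in> {x0..b}" "y \<in> {x0..b}" "x < y" for x y
    proof -
      have "dist (x, y) (x0, x0) \<le> dist x x0 + dist y x0"
        by (simp add: dist_Pair_Pair sqrt_sum_squares_le_sum)
      also have "\<dots> < \<delta>1" using that \<delta> by (auto simp: b_def dist_real_def)
      finally have "dist (x, y) (x0, x0) < \<delta>1" .
      then show ?thesis using \<delta>1(2)[of "(x, y)"] that by (auto simp: dist_real_def)
    qed
    define EN where "EN = (\<integral>\<^sup>+\<omega>. emeasure (count_space UNIV) {x\<in>{x0..b}. X x \<omega> = 0} \<partial>M)"
    have "EN = (\<integral>\<^sup>+\<omega>. emeasure (count_space UNIV) (real_zeros (F \<omega>) \<inter> {x0..b}) \<partial>M)"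
      unfolding EN_def
    proof (rule nn_integral_cong_AE)
      show "AE \<omega> in M. emeasure (count_space UNIV) {x\<in>{x0..b}. X x \<omega> = 0} = emeasure (count_space UNIV) (real_zeros (F \<omega>) \<inter> {x0..b})"
        using zeros by eventually_elim (auto simp: real_zeros_def intro!: arg_cong[of _ _ "emeasure (count_space UNIV)"])
    qed
    also have "\<dots> = (\<integral>\<^sup>+x\<in>{x0..b}. ennreal (\<rho> x) \<partial>lborel)"
      using intensity unfolding first_intensity_def by auto
    finally have EN: "EN = (\<integral>\<^sup>+x\<in>{x0..b}. ennreal (\<rho> x) \<partial>lborel)" .
    have const: "(\<integral>\<^sup>+x\<in>{x0..b}. ennreal c \<partial>lborel) = ennreal (c * \<delta>)" if "c \<ge> 0" for c
      using \<delta>(1) that by (subst nn_integral_cmult_indicator) (auto simp: b_def ennreal_mult)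
    have near: "\<bar>\<rho> x - \<rho> x0\<bar> < e" if "x \<in> {x0..b}" for x
      using that \<delta> \<delta>2(2)[of x] by (auto simp: b_def dist_real_def)
    have \<rho>0: "\<rho> x0 \<ge> 0" using intensity by (auto simp: first_intensity_def)
    have up1: "EN \<le> ennreal ((\<rho> x0 + e) * \<delta>)"
    proof -
      have "EN \<le> (\<integral>\<^sup>+x\<in>{x0..b}. ennreal (\<rho> x0 + e) \<partial>lborel)" unfolding EN
      proof (intro nn_integral_mono)
        fix x show "ennreal (\<rho> x) * indicator {x0..b} x \<le> ennreal (\<rho> x0 + e) * indicator {x0..b} x"
          using near[of x] by (auto simp: indicator_def intro!: ennreal_leI)
      qed
      then show ?thesis using \<rho>0 e by (subst (asm) const) auto
    qed
    have lo1: "ennreal (max 0 (\<rho> x0 - e) * \<delta>) \<le> EN"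
    proof -
      have "(\<integral>\<^sup>+x\<in>{x0..b}. ennreal (max 0 (\<rho> x0 - e)) \<partial>lborel) \<le> EN" unfolding EN
      proof (intro nn_integral_mono)
        fix x 
        have "\<rho> x \<ge> 0" using intensity by (auto simp: first_intensity_def)
        then show "ennreal (max 0 (\<rho> x0 - e)) * indicator {x0..b} x \<le> ennreal (\<rho> x) * indicator {x0..b} x"
          using near[of x] by (auto simp: indicator_def intro!: ennreal_leI)
      qed
      then show ?thesis by (subst (asm) const) auto
    qed
    have lo2: "ennreal (max 0 (v - e) * \<delta>) \<le> EN"
    proof -
      have "prob (flips X x0 b) / \<delta> > v - e"
        using P[of x0 b] ab by (auto simp: b_def)
      then have "(v - e) * \<delta> \<le> prob (flips X x0 b)" using \<delta>(1) by (simp add: field_simps)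
      then have "max 0 (v - e) * \<delta> \<le> prob (flips X x0 b)" by (simp add: max_def)
      then have "ennreal (max 0 (v - e) * \<delta>) \<le> ennreal (prob (flips X x0 b))" by (rule ennreal_leI)
      also have "\<dots> \<le> EN" unfolding EN_def by (rule expected_zeros_lower[OF meas ab tame])
      finally show ?thesis .
    qed
    have up2: "EN \<le> ennreal ((v + e) * \<delta>)"
    proof -
      obtain C where C: "C \<ge> 0" "\<And>x e. x \<in> {x0..b} \<Longrightarrow> e \<ge> 0 \<Longrightarrow> prob {\<omega>\<in>space M. \<bar>X x \<omega>\<bar> \<le> e} \<le> C * e"
        using small[OF ab] by blast
      have "EN \<le> ennreal ((v + e) * (b - x0))" unfolding EN_def
      proof (rule expected_zeros_upper[OF meas ab C(1) _ tame])
        show "prob {\<omega>\<in>space M. \<bar>X x \<omega>\<bar> \<le> e} \<le> C * e" if "x \<in> {x0..b}" "e \<ge> 0" for x e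
          using C(2) that by blast
        show "v + e \<ge> 0" using v e by simp
        fix x y assume xy: "x \<in> {x0..b}" "y \<in> {x0..b}" "x < y"
        have "prob (flips X x y) / (y - x) < v + e" using P[OF xy] by linarith
        then show "prob (flips X x y) \<le> (v + e) * (y - x)" using xy(3) by (simp add: field_simps)
      qed
      then show ?thesis by (simp add: b_def)
    qed
    have "max 0 (\<rho> x0 - e) * \<delta> \<le> (v + e) * \<delta>"
      using order_trans[OF lo1 up2] v e \<delta>(1) by (subst (asm) ennreal_le_iff) auto
    moreover have "max 0 (v - e) * \<delta> \<le> (\<rho> x0 + e) * \<delta>"
      using order_trans[OF lo2 up1] \<rho>0 e \<delta>(1) by (subst (asm) ennreal_le_iff) auto
    ultimately show ?thesis using \<delta>(1) by (simp add: abs_le_iff)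
  qed
  then have "\<bar>\<rho> x0 - v\<bar> \<le> 0 + e" if "e > 0" for e using that by (metis add_0 field_sum_of_halves half_gt_zero mult_2)
  then have "\<bar>\<rho> x0 - v\<bar> \<le> 0" by (rule field_le_epsilon)
  then show ?thesis by simp
qed

end

section \<open>The intensity of the de Branges Gaussian function\<close>

lemma entire_double_zero_bound:
  assumes f: "entire f" and z: "f y = 0" "deriv f y = 0" and S: "compact S"
  obtains B :: nat where "\<And>z. z \<in> S \<Longrightarrow> cmod (f z) \<le> real B * (cmod (z - y))\<^sup>2"
proof -
  define g1 where "g1 = (\<lambda>z. if z = y then deriv f y else (f z - f y) / (z - y))"
  have g1: "g1 holomorphic_on UNIV"
    unfolding g1_def by (rule pole_lemma_open) (use f in \<open>auto simp: entire_def\<close>)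
  define g2 where "g2 = (\<lambda>z. if z = y then deriv g1 y else (g1 z - g1 y) / (z - y))"
  have g2: "g2 holomorphic_on UNIV"
    unfolding g2_def by (rule pole_lemma_open) (use g1 in auto)
  have eq: "f z = (z - y)\<^sup>2 * g2 z" for z
    using z by (auto simp: g1_def g2_def power2_eq_square)
  have "compact (g2 ` S)" by (intro compact_continuous_image S holomorphic_on_imp_continuous_on holomorphic_on_subset[OF g2]) auto
  then obtain C where C: "\<forall>z\<in>g2 ` S. cmod z \<le> C" by (metis compact_imp_bounded bounded_iff)
  obtain B :: nat where B: "C \<le> real B" using real_arch_simple by blast
  show ?thesis
  proof (rule that[of B])
    fix z assume "z \<in> S"
    then have "cmod (g2 z) \<le> real B" using C B by force
    then show "cmod (f z) \<le> real B * (cmod (z - y))\<^sup>2"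
      unfolding eq norm_mult norm_power mult.commute[of "(cmod (z - y))\<^sup>2"] by (rule mult_right_mono) simp
  qed
qed

text \<open>At a double zero the function factors as \<open>(z - y)\<^sup>2\<close> times an entire function.\<close>

lemma tame_real_entire:
  assumes f: "entire f" and real: "\<And>x::real. f (of_real x) = of_real (g x)"
  shows "tame g"
  unfolding tame_def
proof (intro exI[of _ "\<lambda>x. Re (deriv f (of_real x))"] conjI allI impI)
  have fd: "(f has_field_derivative deriv f z) (at z)" for z
    using f unfolding entire_def by (metis UNIV_I holomorphic_derivI open_UNIV)
  have vd: "((\<lambda>x. f (of_real x)) has_vector_derivative deriv f (of_real x)) (at x)" for x :: real
    using has_vector_derivative_real_field[OF fd[of "of_real x"]] by simp
  have g_eq: "g = (\<lambda>x. Re (f (of_real x)))" and im: "(\<lambda>x::real. Im (f (of_real x))) = (\<lambda>x. 0)" using real by auto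
  show D: "(g has_real_derivative Re (deriv f (of_real x))) (at x)" for x
    unfolding g_eq has_real_derivative_iff_has_vector_derivative
    by (rule bounded_linear.has_vector_derivative[OF bounded_linear_Re vd])
  have "((\<lambda>x. Im (f (of_real x))) has_real_derivative Im (deriv f (of_real x))) (at x)" for x
    unfolding has_real_derivative_iff_has_vector_derivative
    by (rule bounded_linear.has_vector_derivative[OF bounded_linear_Im vd])
  then have im0: "Im (deriv f (of_real x)) = 0" for x
    unfolding im using DERIV_unique DERIV_const by blast
  fix a b y assume y: "g y = 0" "Re (deriv f (of_real y)) = 0"
  have "compact (of_real ` {a..b} :: complex set)" by (intro compact_continuous_image continuous_intros) auto
  moreover have "f (of_real y) = 0" "deriv f (of_real y) = 0" using y real[of y] im0[of y] by (auto simp: complex_eq_iff)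
  ultimately obtain B :: nat where B: "\<And>z. z \<in> of_real ` {a..b} \<Longrightarrow> cmod (f z) \<le> real B * (cmod (z - of_real y))\<^sup>2"
    using entire_double_zero_bound[OF f] by metis
  have "\<bar>g x\<bar> \<le> real B * (x - y)\<^sup>2" if "x \<in> {a..b}" for x
  proof -
    have "cmod (f (of_real x)) = \<bar>g x\<bar>" unfolding real by simp
    moreover have "cmod (of_real x - of_real y) = \<bar>x - y\<bar>" by (simp flip: of_real_diff)
    ultimately show ?thesis using B[of "of_real x"] that by simp
  qed
  then show "\<exists>B::nat. \<forall>x\<in>{a..b}. \<bar>g x\<bar> \<le> real B * (x - y)\<^sup>2" by blast
qed

context prob_space
begin

lemma char_gaussian_sum:
  fixes a :: "'i \<Rightarrow> 'a \<Rightarrow> real" and b :: "'i \<Rightarrow> real"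
  assumes J: "finite J" and ind: "indep_vars (\<lambda>_. borel) a J"
    and std: "\<And>n. n \<in> J \<Longrightarrow> distributed M lborel (a n) std_normal_density"
  shows "(CLINT \<omega>|M. iexp (\<Sum>n\<in>J. b n * a n \<omega>)) = of_real (exp (- (\<Sum>n\<in>J. (b n)\<^sup>2) / 2))"
proof -
  have m [measurable]: "a n \<in> borel_measurable M" if "n \<in> J" for n
    using ind that by (auto simp: indep_vars_def)
  have ind2: "indep_vars (\<lambda>_. borel) (\<lambda>n \<omega>. b n * a n \<omega>) J"
    by (rule indep_vars_compose2[OF ind]) auto
  have "(CLINT \<omega>|M. iexp (\<Sum>n\<in>J. b n * a n \<omega>)) = char (distr M borel (\<lambda>\<omega>. \<Sum>n\<in>J. b n * a n \<omega>)) 1"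
    unfolding char_def using m by (subst integral_distr) auto
  also have "\<dots> = (\<Prod>n\<in>J. char (distr M borel (\<lambda>\<omega>. b n * a n \<omega>)) 1)" by (rule char_distr_sum[OF ind2])
  also have "\<dots> = (\<Prod>n\<in>J. of_real (exp (- ((b n)\<^sup>2) / 2)))"
  proof (rule prod.cong[OF refl])
    fix n assume n: "n \<in> J"
    note [measurable] = m[OF n]
    have "distr M borel (a n) = distr M lborel (a n)" by (rule distr_cong) auto
    also have "\<dots> = std_normal_distribution"
      using distributed_distr_eq_density[OF std[OF n]] by simp
    finally have d: "distr M borel (a n) = std_normal_distribution" .
    have "char (distr M borel (\<lambda>\<omega>. b n * a n \<omega>)) 1 = (CLINT \<omega>|M. iexp (b n * a n \<omega>))"
      unfolding char_def by (subst integral_distr) auto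
    also have "\<dots> = char (distr M borel (a n)) (b n)"
      unfolding char_def by (subst integral_distr) auto
    also have "\<dots> = of_real (exp (- ((b n)\<^sup>2) / 2))" unfolding d char_std_normal_distribution ..
    finally show "char (distr M borel (\<lambda>\<omega>. b n * a n \<omega>)) 1 = of_real (exp (- ((b n)\<^sup>2) / 2))" .
  qed
  also have "\<dots> = of_real (\<Prod>n\<in>J. exp (- ((b n)\<^sup>2) / 2))" by simp
  also have "(\<Prod>n\<in>J. exp (- ((b n)\<^sup>2) / 2)) = exp (\<Sum>n\<in>J. - ((b n)\<^sup>2) / 2)" by (rule exp_sum[symmetric, OF J])
  also have "(\<Sum>n\<in>J. - ((b n)\<^sup>2) / 2) = - (\<Sum>n\<in>J. (b n)\<^sup>2) / 2"
    by (simp add: sum_divide_distrib[symmetric] sum_negf)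
  finally show ?thesis .
qed

end

context phase_space
begin

sublocale curve: phase_curve \<phi>
  by unfold_locales (rule phase_deriv_iter, rule phase_deriv_pos)

definition covar :: "real \<Rightarrow> real \<Rightarrow> real" where "covar x y = Re (K (of_real x) (of_real y))"

lemma covar_pos: "covar x x > 0" unfolding covar_def by (rule K_diag_pos) simp

text \<open>The moduli of \<open>E\<close> cancel from the correlation, which therefore depends on the phase alone.\<close>

lemma covar_correlation:
  assumes "x \<noteq> y"
  shows "covar x y / (sqrt (covar x x) * sqrt (covar y y)) = curve.W x y / (x - y)"
proof -
  have sq: "sqrt (covar x x) = cmod (E (of_real x)) * sqrt (deriv \<phi> x) / sqrt pi" for x
  proof -
    have "covar x x = (cmod (E (of_real x)))\<^sup>2 * deriv \<phi> x / pi" using K_diag_phase[of x] by (simp add: covar_def field_simps)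
    then show ?thesis by (simp add: real_sqrt_mult real_sqrt_divide)
  qed
  have e: "cmod (E (of_real x)) > 0" for x using E_nonzero[of "of_real x"] by simp
  have dp: "sqrt (deriv \<phi> x) > 0" for x using phase_deriv_pos by simp
  have pp: "pi = sqrt pi * sqrt pi" by simp
  have "covar x y = cmod (E (of_real x)) * cmod (E (of_real y)) * sin (\<phi> x - \<phi> y) / (pi * (x - y))"
    using K_real_formula(1)[of x y] assms by (simp add: covar_def field_simps)
  also have "\<dots> / (sqrt (covar x x) * sqrt (covar y y)) = sin (\<phi> x - \<phi> y) / (sqrt (deriv \<phi> x) * sqrt (deriv \<phi> y)) / (x - y)"
    unfolding sq using e[of x] e[of y] dp[of x] dp[of y] assms by (simp add: field_simps)
  also have "\<dots> = curve.W x y / (x - y)"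
    unfolding curve.W_eq curve.amp_def curve.d1_def by simp
  finally show ?thesis .
qed

lemma covar_correlation_le: "\<bar>covar x y\<bar> \<le> sqrt (covar x x) * sqrt (covar y y)"
proof -
  have n: "dB_norm E (\<lambda>u. K u (of_real x)) = sqrt (covar x x)" for x
  proof -
    have "covar x x = (dB_norm E (\<lambda>u. K u (of_real x)))\<^sup>2" unfolding covar_def by (subst K_diag) simp
    then show ?thesis using norm_nonneg by simp
  qed
  have "\<bar>covar x y\<bar> \<le> cmod (K (of_real x) (of_real y))" unfolding covar_def by (rule abs_Re_le_cmod)
  also have "\<dots> = cmod (dB_inner E (\<lambda>u. K u (of_real y)) (\<lambda>u. K u (of_real x)))"
    using K_reproducing[OF K_in_space, of "of_real x" "of_real y"] by simp
  also have "\<dots> \<le> sqrt (covar y y) * sqrt (covar x x)"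
    using inner_Cauchy_Schwarz[OF K_in_space K_in_space, of "of_real y" "of_real x"] unfolding n .
  finally show ?thesis by (simp add: mult.commute)
qed

lemma W_correlation_le: "x \<noteq> y \<Longrightarrow> curve.W x y / (x - y) \<le> 1"
  unfolding covar_correlation[symmetric] using covar_correlation_le[of x y] covar_pos[of x] covar_pos[of y]
  by (simp add: divide_le_eq abs_le_iff)

lemma covar_lower_bound:
  assumes "a < b"
  obtains m where "m > 0" "\<And>x. x \<in> {a..b} \<Longrightarrow> m \<le> covar x x"
proof -
  have eq: "covar x x = (cmod (E (of_real x)))\<^sup>2 * deriv \<phi> x / pi" for x using K_diag_phase[of x] by (simp add: covar_def field_simps)
  have cE: "continuous_on {a..b} (\<lambda>x. E (of_real x))"
    by (rule continuous_on_compose2[of UNIV E]) (use E_entire in \<open>auto simp: entire_def intro!: holomorphic_on_imp_continuous_on continuous_intros\<close>)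
  have cd: "continuous_on {a..b} (deriv \<phi>)"
    using phase_deriv_iter[of 1] by (intro continuous_at_imp_continuous_on ballI) (auto intro: DERIV_isCont)
  have "continuous_on {a..b} (\<lambda>x. covar x x)"
    unfolding eq by (intro continuous_intros cE cd) auto
  then obtain x where "x \<in> {a..b}" "\<And>y. y \<in> {a..b} \<Longrightarrow> covar x x \<le> covar y y"
    using continuous_attains_inf[of "{a..b}" "\<lambda>x. covar x x"] assms by auto
  then show ?thesis using that[of "covar x x"] covar_pos by blast
qed

end

locale gaussian_space = phase_space + 
  fixes M :: "'a measure" and F :: "'a \<Rightarrow> complex \<Rightarrow> complex"
  assumes gaf: "deBranges_GAF M E K \<phi> F"
begin

lemma prob_space_M: "prob_space M" using gaf by (simp add: deBranges_GAF_def)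

sublocale P: prob_space M by (rule prob_space_M)

text \<open>On the complement of a null set the partial sums converge; \<open>X\<close> is the limit there and 0 on the null
set, which makes it measurable. The partial sums are Gaussian with covariance the partial
sums of the kernel expansion.\<close>

theorem real_gaussian_process:
  obtains X :: "real \<Rightarrow> 'a \<Rightarrow> real" where
    "\<And>x. X x \<in> borel_measurable M"
    "AE \<omega> in M. tame (\<lambda>x. X x \<omega>)"
    "AE \<omega> in M. \<forall>x. F \<omega> (of_real x) = 0 \<longleftrightarrow> X x \<omega> = 0"
    "\<And>x y s t. (CLINT \<omega>|M. iexp (s * X x \<omega> + t * X y \<omega>)) = of_real (exp (- (s\<^sup>2 * covar x x + 2 * s * t * covar x y + t\<^sup>2 * covar y y) / 2))"
proof -
  obtain \<alpha> a where 
    onb: "dB_orthonormal_basis E (phase_index \<phi> \<alpha>) (\<lambda>n. normalized_kernel K (phase_point \<phi> \<alpha> n))" and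
    ind: "P.indep_vars (\<lambda>_. borel) a (phase_index \<phi> \<alpha>)" and
    std: "\<And>n. n \<in> phase_index \<phi> \<alpha> \<Longrightarrow> distributed M lborel (a n) std_normal_density" and
    lim: "AE \<omega> in M. \<forall>C. compact C \<longrightarrow>
           uniform_limit C
             (\<lambda>N z. \<Sum>n\<in>{n \<in> phase_index \<phi> \<alpha>. \<bar>n\<bar> \<le> int N}.
                of_real (a n \<omega>) * normalized_kernel K (phase_point \<phi> \<alpha> n) z)
             (F \<omega>) sequentially"
    using gaf unfolding deBranges_GAF_def by auto
  define I where "I = phase_index \<phi> \<alpha>"
  define k where "k = (\<lambda>n. normalized_kernel K (phase_point \<phi> \<alpha> n))"
  define J where "J N = {n \<in> I. \<bar>n\<bar> \<le> int N}" for N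
  define S where "S = (\<lambda>\<omega> N z. \<Sum>n\<in>J N. of_real (a n \<omega>) * k n z)"
  define c where "c n x = Re (k n (of_real x))" for n and x :: real
  have finJ: "finite (J N)" for N
    by (rule finite_subset[of _ "{- int N..int N}"]) (auto simp: J_def)
  have JI: "J N \<subseteq> I" for N by (auto simp: J_def)
  have Jev: "\<forall>\<^sub>F N in sequentially. A \<subseteq> J N" if A: "finite A" "A \<subseteq> I" for A
  proof -
    define m where "m = Max (insert 0 ((\<lambda>n. nat \<bar>n\<bar>) ` A))"
    have "A \<subseteq> J N" if "N \<ge> m" for N
    proof
      fix n assume n: "n \<in> A"
      then have "nat \<bar>n\<bar> \<le> m" unfolding m_def using A(1) by (intro Max_ge) auto
      then show "n \<in> J N" using that n A(2) by (auto simp: J_def)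
    qed
    then show ?thesis unfolding eventually_sequentially by blast
  qed
  have kreal: "k n (of_real x) = of_real (c n x)" for n x
  proof -
    have "k n (of_real x) = of_real (Re (K (of_real x) (of_real (phase_point \<phi> \<alpha> n))) / sqrt (Re (K (of_real (phase_point \<phi> \<alpha> n)) (of_real (phase_point \<phi> \<alpha> n)))))"
      unfolding k_def normalized_kernel_def by (subst (1) K_real) simp
    then show ?thesis unfolding c_def by (metis Re_complex_of_real)
  qed
  have kent: "entire (k n)" if "n \<in> I" for n
    using onb that deBranges_space_entire[of "k n" E] by (auto simp: dB_orthonormal_basis_def I_def k_def)
  have am [measurable]: "a n \<in> borel_measurable M" if "n \<in> I" for n
    using ind that by (auto simp: P.indep_vars_def I_def)
  obtain N0 where N0: "N0 \<in> null_sets M" and good: "\<And>\<omega> C. \<omega> \<in> space M - N0 \<Longrightarrow> compact C \<Longrightarrow> uniform_limit C (S \<omega>) (F \<omega>) sequentially"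
  proof -
    from lim obtain N0 where "N0 \<in> null_sets M" "{\<omega>\<in>space M. \<not> (\<forall>C. compact C \<longrightarrow> uniform_limit C (S \<omega>) (F \<omega>) sequentially)} \<subseteq> N0"
      unfolding S_def J_def I_def k_def by (auto simp: eventually_ae_filter)
    then show ?thesis by (intro that[of N0]) auto
  qed
  have N0m [measurable]: "N0 \<in> sets M" using N0 by auto
  define X where "X x \<omega> = (if \<omega> \<in> N0 then 0 else Re (F \<omega> (of_real x)))" for x :: real and \<omega>
  define Y where "Y N x \<omega> = (if \<omega> \<in> N0 then 0 else (\<Sum>n\<in>J N. c n x * a n \<omega>))" for N x \<omega>
  have Ym [measurable]: "Y N x \<in> borel_measurable M" for N x
  proof -
    have [measurable]: "(\<lambda>\<omega>. \<Sum>n\<in>J N. c n x * a n \<omega>) \<in> borel_measurable M"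
      using JI[of N] am by (intro borel_measurable_sum borel_measurable_times) auto
    show ?thesis unfolding Y_def by measurable
  qed
  have Slim: "(\<lambda>N. S \<omega> N z) \<longlonglongrightarrow> F \<omega> z" if "\<omega> \<in> space M - N0" for \<omega> z
    using tendsto_uniform_limitI[OF good[OF that, of "{z}"]] by auto
  have Sreal: "S \<omega> N (of_real x) = of_real (\<Sum>n\<in>J N. c n x * a n \<omega>)" for \<omega> N x
    unfolding S_def kreal by (simp add: mult.commute)
  have Freal: "F \<omega> (of_real x) = of_real (Re (F \<omega> (of_real x)))" if "\<omega> \<in> space M - N0" for \<omega> x
  proof -
    have "(\<lambda>N. Im (S \<omega> N (of_real x))) \<longlonglongrightarrow> Im (F \<omega> (of_real x))" by (intro tendsto_intros Slim that)
    then have "Im (F \<omega> (of_real x)) = 0" unfolding Sreal by (simp add: LIMSEQ_const_iff)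
    then show ?thesis by (simp add: complex_eq_iff)
  qed
  have Ylim: "(\<lambda>N. Y N x \<omega>) \<longlonglongrightarrow> X x \<omega>" if "\<omega> \<in> space M" for x \<omega>
  proof (cases "\<omega> \<in> N0")
    case False
    have "(\<lambda>N. Re (S \<omega> N (of_real x))) \<longlonglongrightarrow> Re (F \<omega> (of_real x))" using that False by (intro tendsto_intros Slim) auto
    then show ?thesis using False unfolding Sreal by (simp add: X_def Y_def)
  qed (simp add: X_def Y_def)
  have Xm: "X x \<in> borel_measurable M" for x
    by (rule borel_measurable_LIMSEQ_real[OF Ylim Ym])
  have notN0: "AE \<omega> in M. \<omega> \<in> space M - N0" using AE_not_in[OF N0] AE_space by eventually_elim auto
  have tame: "AE \<omega> in M. tame (\<lambda>x. X x \<omega>)" using notN0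
  proof eventually_elim
    case (elim \<omega>)
    have "F \<omega> holomorphic_on UNIV"
    proof (rule holomorphic_uniform_sequence[OF open_UNIV])
      show "S \<omega> N holomorphic_on UNIV" for N
        unfolding S_def using kent JI[of N] by (intro holomorphic_intros) (auto simp: entire_def)
      show "\<exists>d>0. cball x d \<subseteq> UNIV \<and> uniform_limit (cball x d) (S \<omega>) (F \<omega>) sequentially" for x
        using good[OF elim compact_cball] by (intro exI[of _ 1]) auto
    qed
    then have "entire (F \<omega>)" by (simp add: entire_def)
    moreover have "F \<omega> (of_real x) = of_real (X x \<omega>)" for x using Freal[OF elim, of x] elim by (simp add: X_def)
    ultimately show ?case by (rule tame_real_entire)
  qed
  have zeros: "AE \<omega> in M. \<forall>x. F \<omega> (of_real x) = 0 \<longleftrightarrow> X x \<omega> = 0" using notN0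
  proof eventually_elim
    case (elim \<omega>)
    then show ?case using Freal[OF elim] by (auto simp: X_def complex_eq_iff)
  qed
  have cov: "(\<lambda>N. \<Sum>n\<in>J N. c n x * c n y) \<longlonglongrightarrow> covar x y" for x y
  proof -
    have "(\<lambda>N. \<Sum>n\<in>J N. k n (of_real x) * cnj (k n (of_real y))) \<longlonglongrightarrow> K (of_real x) (of_real y)"
      by (rule kernel_expansion[OF onb[folded I_def k_def] finJ JI Jev])
    then have "(\<lambda>N. Re (\<Sum>n\<in>J N. k n (of_real x) * cnj (k n (of_real y)))) \<longlonglongrightarrow> Re (K (of_real x) (of_real y))"
      by (rule tendsto_Re)
    then show ?thesis unfolding kreal by (simp add: covar_def)
  qed
  have ch: "(CLINT \<omega>|M. iexp (s * X x \<omega> + t * X y \<omega>)) = of_real (exp (- (s\<^sup>2 * covar x x + 2 * s * t * covar x y + t\<^sup>2 * covar y y) / 2))" for x y s t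
  proof (rule LIMSEQ_unique)
    show "(\<lambda>N. CLINT \<omega>|M. iexp (s * Y N x \<omega> + t * Y N y \<omega>)) \<longlonglongrightarrow> (CLINT \<omega>|M. iexp (s * X x \<omega> + t * X y \<omega>))"
    proof (rule integral_dominated_convergence[where w = "\<lambda>_. 1"])
      show "(\<lambda>\<omega>. iexp (s * X x \<omega> + t * X y \<omega>)) \<in> borel_measurable M" using Xm[of x] Xm[of y] by measurable
      show "AE \<omega> in M. (\<lambda>N. iexp (s * Y N x \<omega> + t * Y N y \<omega>)) \<longlonglongrightarrow> iexp (s * X x \<omega> + t * X y \<omega>)"
        by (intro AE_I2 tendsto_intros Ylim) auto
    qed auto
    have "(CLINT \<omega>|M. iexp (s * Y N x \<omega> + t * Y N y \<omega>)) = of_real (exp (- (s\<^sup>2 * (\<Sum>n\<in>J N. c n x * c n x) + 2 * s * t * (\<Sum>n\<in>J N. c n x * c n y) + t\<^sup>2 * (\<Sum>n\<in>J N. c n y * c n y)) / 2))" for N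
    proof -
      have [measurable]: "(\<lambda>\<omega>. \<Sum>n\<in>J N. (s * c n x + t * c n y) * a n \<omega>) \<in> borel_measurable M"
        using JI[of N] am by (intro borel_measurable_sum borel_measurable_times) auto
      have "(CLINT \<omega>|M. iexp (s * Y N x \<omega> + t * Y N y \<omega>)) = (CLINT \<omega>|M. iexp (\<Sum>n\<in>J N. (s * c n x + t * c n y) * a n \<omega>))"
      proof (rule integral_cong_AE)
        show "AE \<omega> in M. iexp (s * Y N x \<omega> + t * Y N y \<omega>) = iexp (\<Sum>n\<in>J N. (s * c n x + t * c n y) * a n \<omega>)"
          using notN0 
        proof eventually_elim
          case (elim \<omega>)
          have "s * Y N x \<omega> + t * Y N y \<omega> = (\<Sum>n\<in>J N. (s * c n x + t * c n y) * a n \<omega>)"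
            using elim by (simp add: Y_def sum_distrib_left sum.distrib[symmetric] algebra_simps)
          then show ?case by simp
        qed
      qed measurable
      also have "\<dots> = of_real (exp (- (\<Sum>n\<in>J N. (s * c n x + t * c n y)\<^sup>2) / 2))"
      proof (rule P.char_gaussian_sum[OF finJ])
        show "P.indep_vars (\<lambda>_. borel) a (J N)" by (rule P.indep_vars_subset[OF ind[folded I_def] JI])
        show "distributed M lborel (a n) std_normal_density" if "n \<in> J N" for n
          using std JI[of N] that by (auto simp: I_def)
      qed
      also have "(\<Sum>n\<in>J N. (s * c n x + t * c n y)\<^sup>2) = s\<^sup>2 * (\<Sum>n\<in>J N. c n x * c n x) + 2 * s * t * (\<Sum>n\<in>J N. c n x * c n y) + t\<^sup>2 * (\<Sum>n\<in>J N. c n y * c n y)"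
        by (simp add: sum_distrib_left sum.distrib[symmetric] power2_eq_square algebra_simps)
      finally show ?thesis .
    qed
    moreover have "(\<lambda>N. complex_of_real (exp (- (s\<^sup>2 * (\<Sum>n\<in>J N. c n x * c n x) + 2 * s * t * (\<Sum>n\<in>J N. c n x * c n y) + t\<^sup>2 * (\<Sum>n\<in>J N. c n y * c n y)) / 2)))
       \<longlonglongrightarrow> of_real (exp (- (s\<^sup>2 * covar x x + 2 * s * t * covar x y + t\<^sup>2 * covar y y) / 2))"
      by (intro tendsto_intros cov) auto
    ultimately show "(\<lambda>N. CLINT \<omega>|M. iexp (s * Y N x \<omega> + t * Y N y \<omega>)) \<longlonglongrightarrow> of_real (exp (- (s\<^sup>2 * covar x x + 2 * s * t * covar x y + t\<^sup>2 * covar y y) / 2))"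
      by simp
  qed
  show ?thesis by (rule that[OF Xm tame zeros ch])
qed

text \<open>The probability of a sign change is the angle between two normalised kernels divided by \<open>\<pi>\<close>, and
\<open>sqrt (Q / 3)\<close> is the speed of the curve of normalised kernels.\<close>

theorem intensity_formula:
  assumes "first_intensity M F \<rho>"
  shows "\<rho> x0 = sqrt (curve.Q x0 / 3) / pi"
proof -
  obtain X :: "real \<Rightarrow> 'a \<Rightarrow> real" where X: 
    "\<And>x. X x \<in> borel_measurable M"
    "AE \<omega> in M. tame (\<lambda>x. X x \<omega>)"
    "AE \<omega> in M. \<forall>x. F \<omega> (of_real x) = 0 \<longleftrightarrow> X x \<omega> = 0"
    and ch: "\<And>x y s t. (CLINT \<omega>|M. iexp (s * X x \<omega> + t * X y \<omega>)) = of_real (exp (- (s\<^sup>2 * covar x x + 2 * s * t * covar x y + t\<^sup>2 * covar y y) / 2))"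
    using real_gaussian_process by blast
  let ?F = "at (x0, x0) within {p::real \<times> real. fst p \<noteq> snd p}"
  have ne: "\<forall>\<^sub>F p in ?F. fst p \<noteq> snd p" by (auto simp: eventually_at_filter)
  have le: "curve.W x y / (x - y) \<le> 1" if "x \<noteq> y" for x y using that by (rule W_correlation_le)
  have lims: "((\<lambda>p. arccos (curve.W (fst p) (snd p) / (fst p - snd p)) / \<bar>fst p - snd p\<bar>) \<longlongrightarrow> sqrt (curve.Q x0 / 3)) ?F"
    "\<forall>\<^sub>F p in ?F. curve.W (fst p) (snd p) / (fst p - snd p) > -1"
    unfolding curve.off_diagonal_def[symmetric] by (rule curve.arccos_correlation_limit, erule le)+
  have prob_eq: "\<forall>\<^sub>F p in ?F. arccos (curve.W (fst p) (snd p) / (fst p - snd p)) / \<bar>fst p - snd p\<bar> / pi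
     = P.prob {\<omega>\<in>space M. X (fst p) \<omega> * X (snd p) \<omega> < 0} / \<bar>fst p - snd p\<bar>"
    using ne lims(2)
  proof eventually_elim
    case (elim p)
    have "P.prob {\<omega>\<in>space M. X (fst p) \<omega> * X (snd p) \<omega> < 0} = arccos (curve.W (fst p) (snd p) / (fst p - snd p)) / pi"
    proof (rule P.gaussian_sign_change[OF X(1) X(1) ch])
      show "curve.W (fst p) (snd p) / (fst p - snd p) = covar (fst p) (snd p) / (sqrt (covar (fst p) (fst p)) * sqrt (covar (snd p) (snd p)))"
        using covar_correlation[OF elim(1)] by simp
    qed (use elim covar_pos W_correlation_le in auto)
    then show ?case by simp
  qed
  have rate: "((\<lambda>p. P.prob {\<omega>\<in>space M. X (fst p) \<omega> * X (snd p) \<omega> < 0} / \<bar>fst p - snd p\<bar>) \<longlongrightarrow> sqrt (curve.Q x0 / 3) / pi) ?F"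
    by (rule Lim_transform_eventually[OF tendsto_divide[OF lims(1) tendsto_const] prob_eq]) simp
  have ntriv: "?F \<noteq> bot"
  proof -
    have "(x0, x0) islimpt {p::real \<times> real. fst p \<noteq> snd p}"
      unfolding islimpt_approachable
    proof (intro allI impI)
      fix e :: real assume "e > 0"
      then show "\<exists>x'\<in>{p::real \<times> real. fst p \<noteq> snd p}. x' \<noteq> (x0, x0) \<and> dist x' (x0, x0) < e"
        by (intro bexI[of _ "(x0 + e / 2, x0)"]) (auto simp: dist_Pair_Pair dist_real_def)
    qed
    then show ?thesis using trivial_limit_within[of "(x0, x0)"] by blast
  qed
  show ?thesis
  proof (rule P.intensity_eq_sign_change_rate[OF X(1,2) _ rate _ assms X(3)])
    show "0 \<le> sqrt (curve.Q x0 / 3) / pi"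
      by (rule tendsto_lowerbound[OF rate _ ntriv]) (auto intro!: always_eventually)
    fix a b :: real assume ab: "a < b"
    obtain m where m: "m > 0" "\<And>x. x \<in> {a..b} \<Longrightarrow> m \<le> covar x x" using covar_lower_bound[OF ab] by blast
    have "P.prob {\<omega>\<in>space M. \<bar>X x \<omega>\<bar> \<le> e} \<le> 2 / sqrt m * e" if "x \<in> {a..b}" "e \<ge> 0" for x e
    proof -
      have "P.prob {\<omega>\<in>space M. \<bar>X x \<omega>\<bar> \<le> e} \<le> 2 * e / sqrt (covar x x)"
        by (rule P.gaussian_small_ball[OF X(1) _ covar_pos that(2)]) (use ch[of _ x 0 x] in simp)
      also have "\<dots> \<le> 2 * e / sqrt m" using m that covar_pos[of x] by (intro divide_left_mono) auto
      finally show ?thesis by simp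
    qed
    then show "\<exists>C\<ge>0. \<forall>x\<in>{a..b}. \<forall>e\<ge>0. P.prob {\<omega>\<in>space M. \<bar>X x \<omega>\<bar> \<le> e} \<le> C * e"
      using m by (intro exI[of _ "2 / sqrt m"]) auto
  qed
qed

end

section \<open>Hermite-Biehler functions related by a Moebius transformation\<close>

text \<open>The basis that defines the Gaussian function consists of multiples of kernels.\<close>

lemma (in gaussian_space) kernels_dense:
  assumes "f \<in> H" "e > 0"
  obtains A :: "int set" and c y where "finite A" "dB_norm E (\<lambda>z. f z - (\<Sum>n\<in>A. c n * K z (y n))) < e"
proof -
  obtain \<alpha> where onb: "dB_orthonormal_basis E (phase_index \<phi> \<alpha>) (\<lambda>n. normalized_kernel K (phase_point \<phi> \<alpha> n))"
    using gaf unfolding deBranges_GAF_def by auto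
  then obtain A c where A: "finite A" "dB_norm E (\<lambda>z. f z - (\<Sum>n\<in>A. c n * normalized_kernel K (phase_point \<phi> \<alpha> n) z)) < e"
    using assms unfolding dB_orthonormal_basis_def by blast
  show ?thesis
    by (rule that[OF A(1), of "\<lambda>n. c n / of_real (sqrt (Re (K (of_real (phase_point \<phi> \<alpha> n)) (of_real (phase_point \<phi> \<alpha> n)))))" "\<lambda>n. of_real (phase_point \<phi> \<alpha> n)"])
      (use A(2) in \<open>simp add: normalized_kernel_def\<close>)
qed

text \<open>The quotient \<open>E\<^sub>1\<^sup>* / E\<^sub>1\<close> of the first function is related on the real line to that of the second by a
Moebius transformation of the unit disc, given by \<open>\<alpha>\<close> and \<open>\<beta>\<close>.\<close>

locale hermite_biehler_moebius = 
  H1: hermite_biehler_function E1 + H2: hermite_biehler_function E2 for E1 E2 +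
  fixes \<alpha> \<beta> :: complex and s :: "real \<Rightarrow> real"
  assumes det: "(cmod \<alpha>)\<^sup>2 - (cmod \<beta>)\<^sup>2 = 1"
    and E2_real: "E2 (of_real x) = of_real (s x) * (\<alpha> * E1 (of_real x) + \<beta> * cnj (E1 (of_real x)))"
begin

definition G :: "complex \<Rightarrow> complex" where "G z = \<alpha> * E1 z + \<beta> * sharp E1 z"
text \<open>Each of the two quotients is used on a half-plane on which its denominator has no zeros.\<close>

definition S :: "complex \<Rightarrow> complex" where "S z = (if Im z \<ge> 0 then E2 z / G z else sharp E2 z / sharp G z)"
definition gap :: real where "gap = cmod \<alpha> - cmod \<beta>"

lemma gap_pos: "gap > 0"
proof -
  have "(cmod \<beta>)\<^sup>2 < (cmod \<alpha>)\<^sup>2" using det by simp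
  then have "cmod \<beta> < cmod \<alpha>" by (rule power_less_imp_less_base) simp
  then show ?thesis by (simp add: gap_def)
qed

lemma G_entire: "entire G"
  unfolding G_def[abs_def] entire_def using H1.E_entire entire_sharp[OF H1.E_entire]
  by (intro holomorphic_intros) (auto simp: entire_def)

lemma sharp_G: "sharp G z = cnj \<alpha> * sharp E1 z + cnj \<beta> * E1 z"
  by (simp add: G_def sharp_def)

lemma G_lower: "Im z \<ge> 0 \<Longrightarrow> gap * cmod (E1 z) \<le> cmod (G z)"
proof -
  assume z: "Im z \<ge> 0"
  have "gap * cmod (E1 z) = cmod (\<alpha> * E1 z) - cmod \<beta> * cmod (E1 z)" by (simp add: gap_def norm_mult algebra_simps)
  also have "\<dots> \<le> cmod (\<alpha> * E1 z) - cmod (\<beta> * sharp E1 z)"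
    using mult_left_mono[OF H1.norm_sharp_le[OF z] norm_ge_zero[of \<beta>]] by (simp add: norm_mult)
  also have "\<dots> \<le> cmod (G z)" unfolding G_def by (rule norm_diff_ineq)
  finally show ?thesis .
qed

lemma G_nonzero: "Im z \<ge> 0 \<Longrightarrow> G z \<noteq> 0"
  using G_lower[of z] H1.E_nonzero[of z] gap_pos by (auto simp: mult_le_0_iff)

lemma sharp_G_nonzero: "Im z \<le> 0 \<Longrightarrow> sharp G z \<noteq> 0"
  using G_nonzero[of "cnj z"] by (simp add: sharp_def)

text \<open>Both sides are entire and agree on the real line, where \<open>E\<^sub>2 / G\<close> is real.\<close>

lemma E2_cross: "E2 z * sharp G z = sharp E2 z * G z"
proof (rule entire_eq_on_reals[where f = "\<lambda>z. E2 z * sharp G z" and g = "\<lambda>z. sharp E2 z * G z"])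
  show "entire (\<lambda>z. E2 z * sharp G z)" "entire (\<lambda>z. sharp E2 z * G z)"
    using H2.E_entire entire_sharp[OF H2.E_entire] G_entire entire_sharp[OF G_entire]
    by (auto simp: entire_def intro!: holomorphic_intros)
  fix x :: real
  have "E2 (of_real x) = of_real (s x) * G (of_real x)" unfolding E2_real G_def sharp_of_real ..
  then show "E2 (of_real x) * sharp G (of_real x) = sharp E2 (of_real x) * G (of_real x)"
    by (simp add: sharp_of_real)
qed

lemma S_eq: "G z \<noteq> 0 \<Longrightarrow> S z = E2 z / G z"
  using E2_cross[of z] sharp_G_nonzero[of z] by (cases "Im z \<ge> 0") (simp_all add: S_def frac_eq_eq)

lemma S_eq_sharp: "sharp G z \<noteq> 0 \<Longrightarrow> S z = sharp E2 z / sharp G z"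
  using E2_cross[of z] G_nonzero[of z] by (cases "Im z \<ge> 0") (simp_all add: S_def frac_eq_eq)

lemma S_entire: "entire S"
proof -
  have h: "E2 holomorphic_on A" "sharp E2 holomorphic_on A" "G holomorphic_on A" "sharp G holomorphic_on A" for A
    using H2.E_entire entire_sharp[OF H2.E_entire] G_entire entire_sharp[OF G_entire]
    by (auto simp: entire_def intro: holomorphic_on_subset)
  have o: "open {z. f z \<noteq> 0}" if "f holomorphic_on UNIV" for f :: "complex \<Rightarrow> complex"
    using open_Collect_neq[OF holomorphic_on_imp_continuous_on[OF that] continuous_on_const] by simp
  have "S holomorphic_on {z. G z \<noteq> 0} \<union> {z. sharp G z \<noteq> 0}"
  proof (rule holomorphic_on_Un)
    have "(\<lambda>z. E2 z / G z) holomorphic_on {z. G z \<noteq> 0}" by (intro holomorphic_intros h) auto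
    then show "S holomorphic_on {z. G z \<noteq> 0}" by (rule holomorphic_transform) (auto simp: S_eq)
    have "(\<lambda>z. sharp E2 z / sharp G z) holomorphic_on {z. sharp G z \<noteq> 0}" by (intro holomorphic_intros h) auto
    then show "S holomorphic_on {z. sharp G z \<noteq> 0}" by (rule holomorphic_transform) (auto simp: S_eq_sharp)
  qed (rule o[OF h(3)], rule o[OF h(4)])
  also have "{z. G z \<noteq> 0} \<union> {z. sharp G z \<noteq> 0} = UNIV"
  proof -
    have "G z \<noteq> 0 \<or> sharp G z \<noteq> 0" for z using G_nonzero[of z] sharp_G_nonzero[of z] by linarith
    then show ?thesis by auto
  qed
  finally show ?thesis by (simp add: entire_def)
qed

lemma S_nonzero: "S z \<noteq> 0"
proof (cases "Im z \<ge> 0")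
  case True
  then show ?thesis using H2.E_nonzero[of z] G_nonzero[of z] by (simp add: S_def)
next
  case False
  then show ?thesis using H2.E_nonzero[of "cnj z"] sharp_G_nonzero[of z] by (simp add: S_def) (simp add: sharp_def)
qed

lemma S_G: "S z * G z = E2 z"
proof (cases "G z = 0")
  case True
  then have "sharp G z \<noteq> 0" using G_nonzero[of z] sharp_G_nonzero[of z] by (cases "Im z \<ge> 0") auto
  then show ?thesis using E2_cross[of z] True by simp
qed (simp add: S_eq)

lemma S_sharp_G: "S z * sharp G z = sharp E2 z"
proof (cases "sharp G z = 0")
  case True
  then have "G z \<noteq> 0" using G_nonzero[of z] sharp_G_nonzero[of z] by (cases "Im z \<ge> 0") auto
  then show ?thesis using E2_cross[of z] True by simp
qed (simp add: S_eq_sharp)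

lemma S_symmetric: "cnj (S (cnj z)) = S z"
proof (cases "Im z \<ge> 0")
  case True
  then have "S (cnj z) = sharp E2 (cnj z) / sharp G (cnj z)" by (intro S_eq_sharp sharp_G_nonzero) simp
  then show ?thesis using True G_nonzero[of z] by (simp add: S_eq sharp_def)
next
  case False
  then have "S (cnj z) = E2 (cnj z) / G (cnj z)" by (intro S_eq G_nonzero) simp
  then show ?thesis using False sharp_G_nonzero[of z] by (simp add: S_eq_sharp sharp_def)
qed

text \<open>The transformation from \<open>E\<^sub>1\<close> to \<open>G\<close> preserves the indefinite form in the numerator because \<open>(\<alpha>, \<beta>)\<close> has
norm 1 with respect to it.\<close>

lemma kernel_numerator_transform:
  "H2.kernel_numerator z w = S z * H1.kernel_numerator z w * cnj (S w)"
proof -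
  have d: "\<alpha> * cnj \<alpha> - \<beta> * cnj \<beta> = 1"
    using det by (simp add: complex_norm_square[symmetric] flip: of_real_diff of_real_power)
  have "G z * cnj (G w) - sharp G z * cnj (sharp G w)
     = (\<alpha> * cnj \<alpha> - \<beta> * cnj \<beta>) * (E1 z * cnj (E1 w) - sharp E1 z * cnj (sharp E1 w))"
    unfolding sharp_G G_def by (simp add: algebra_simps)
  then have g: "G z * cnj (G w) - sharp G z * cnj (sharp G w) = E1 z * cnj (E1 w) - sharp E1 z * cnj (sharp E1 w)"
    by (simp add: d)
  have "H2.kernel_numerator z w = \<i> / (2 * pi) * ((S z * G z) * cnj (S w * G w) - (S z * sharp G z) * cnj (S w * sharp G w))"
    unfolding H2.kernel_numerator_def S_G S_sharp_G ..
  also have "\<dots> = S z * (\<i> / (2 * pi) * (G z * cnj (G w) - sharp G z * cnj (sharp G w))) * cnj (S w)"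
    by (simp add: algebra_simps diff_divide_distrib)
  finally show ?thesis unfolding g H1.kernel_numerator_def .
qed

lemma S_ratio: "Im z \<ge> 0 \<Longrightarrow> S z * f z / E2 z = f z / G z"
  using G_nonzero[of z] H2.E_nonzero[of z] by (simp add: S_eq)

text \<open>In the closed upper half-plane \<open>\<bar>E\<^sub>1\<^sup>*\<bar> \<le> \<bar>E\<^sub>1\<bar>\<close>, so \<open>G\<close> is comparable to \<open>E\<^sub>1\<close>. This gives boundedness of the
multiplication by \<open>S\<close>, with a constant that is larger than 1 in general.\<close>

lemma ratio_bound: "Im z \<ge> 0 \<Longrightarrow> cmod (S z * f z / E2 z) \<le> (1 / gap) * cmod (f z / E1 z)"
proof -
  assume z: "Im z \<ge> 0"
  have e: "cmod (E1 z) > 0" using H1.E_nonzero[OF z] by simp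
  have "cmod (f z) / cmod (G z) \<le> cmod (f z) / (gap * cmod (E1 z))"
    using G_lower[OF z] e gap_pos by (intro divide_left_mono) (auto intro!: mult_pos_pos elim: less_le_trans simp: G_nonzero[OF z])
  then show ?thesis unfolding S_ratio[OF z] by (simp add: norm_divide)
qed

lemma ratio_hardy2:
  assumes f: "entire f" "(\<lambda>z. f z / E1 z) \<in> hardy2"
  shows "(\<lambda>z. S z * f z / E2 z) \<in> hardy2"
proof (rule hardy2_dominated[OF f(2), where C = "1 / gap"])
  show "(\<lambda>z. S z * f z / E2 z) holomorphic_on {z. Im z > 0}"
    using S_entire f(1) H2.E_entire H2.E_nonzero by (intro holomorphic_intros) (auto simp: entire_def intro: holomorphic_on_subset)
qed (use gap_pos ratio_bound in auto)

lemma mult_S_in_space: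
  assumes f: "f \<in> H1.H"
  shows "(\<lambda>z. S z * f z) \<in> H2.H"
proof -
  have fe: "entire f" by (rule deBranges_space_entire[OF f])
  have "entire (\<lambda>z. S z * f z)" using fe S_entire by (auto simp: entire_def intro!: holomorphic_intros)
  moreover have "(\<lambda>z. S z * f z / E2 z) \<in> hardy2" using f by (intro ratio_hardy2 fe) (auto simp: deBranges_space_def)
  moreover have "sharp (\<lambda>z. S z * f z) = (\<lambda>z. S z * sharp f z)"
    by (auto simp: sharp_def S_symmetric)
  moreover have "(\<lambda>z. S z * sharp f z / E2 z) \<in> hardy2" using f by (intro ratio_hardy2 entire_sharp fe) (auto simp: deBranges_space_def)
  ultimately show ?thesis by (simp add: deBranges_space_def)
qed

lemma norm_mult_S_le:
  assumes f: "f \<in> H1.H"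
  shows "dB_norm E2 (\<lambda>z. S z * f z) \<le> (1 / gap) * dB_norm E1 f"
proof -
  have "(LINT x|lborel. (cmod (S (of_real x) * f (of_real x) / E2 (of_real x)))\<^sup>2)
     \<le> (LINT x|lborel. (1 / gap)\<^sup>2 * (cmod (f (of_real x) / E1 (of_real x)))\<^sup>2)"
  proof (rule integral_mono)
    fix x :: real
    have "(cmod (S (of_real x) * f (of_real x) / E2 (of_real x)))\<^sup>2 \<le> ((1 / gap) * cmod (f (of_real x) / E1 (of_real x)))\<^sup>2"
      by (intro power_mono ratio_bound) auto
    then show "(cmod (S (of_real x) * f (of_real x) / E2 (of_real x)))\<^sup>2 \<le> (1 / gap)\<^sup>2 * (cmod (f (of_real x) / E1 (of_real x)))\<^sup>2"
      by (simp only: power_mult_distrib)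
  qed (use H2.L2_boundary[OF mult_S_in_space[OF f]] H1.L2_boundary[OF f] in auto)
  also have "\<dots> = (1 / gap)\<^sup>2 * (LINT x|lborel. (cmod (f (of_real x) / E1 (of_real x)))\<^sup>2)"
    by (rule integral_mult_right_zero)
  finally have "dB_norm E2 (\<lambda>z. S z * f z) \<le> sqrt ((1 / gap)\<^sup>2 * (LINT x|lborel. (cmod (f (of_real x) / E1 (of_real x)))\<^sup>2))"
    unfolding dB_norm_def by (rule real_sqrt_le_mono)
  also have "\<dots> = (1 / gap) * dB_norm E1 f" using gap_pos by (simp add: real_sqrt_mult dB_norm_def real_sqrt_divide)
  finally show ?thesis .
qed

end

locale moebius_kernel_spaces = hermite_biehler_moebius + 
  K1: kernel_space E1 K1 + K2: kernel_space E2 K2 for K1 K2 +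
  assumes dense: "\<And>f e. f \<in> H1.H \<Longrightarrow> e > 0 \<Longrightarrow> \<exists>A :: int set. \<exists>c y. finite A \<and> dB_norm E1 (\<lambda>z. f z - (\<Sum>n\<in>A. c n * K1 z (y n))) < e"
begin

lemma kernel_transform: "K2 z w = S z * K1 z w * cnj (S w)"
proof (rule entire_eq_punctured[where f = "\<lambda>z. K2 z w" and g = "\<lambda>z. S z * K1 z w * cnj (S w)" and a = "cnj w"])
  show "entire (\<lambda>z. K2 z w)" by (rule K2.K_entire)
  show "entire (\<lambda>z. S z * K1 z w * cnj (S w))" using S_entire K1.K_entire[of w] by (auto simp: entire_def intro!: holomorphic_intros)
  fix z assume "z \<noteq> cnj w"
  moreover have "(z - cnj w) * K2 z w = (z - cnj w) * (S z * K1 z w * cnj (S w))"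
    unfolding K2.K_formula kernel_numerator_transform K1.K_formula[symmetric] by (simp add: mult_ac)
  ultimately show "K2 z w = S z * K1 z w * cnj (S w)" by simp
qed

lemma inner_mult_S_kernel:
  assumes f: "f \<in> H1.H"
  shows "dB_inner E2 (\<lambda>z. S z * f z) (\<lambda>z. S z * K1 z w) = dB_inner E1 f (\<lambda>z. K1 z w)"
proof -
  have "(\<lambda>z. S z * K1 z w) = (\<lambda>z. (1 / cnj (S w)) * K2 z w)"
    using S_nonzero[of w] by (auto simp: kernel_transform)
  then have "dB_inner E2 (\<lambda>z. S z * f z) (\<lambda>z. S z * K1 z w) = cnj (1 / cnj (S w)) * dB_inner E2 (\<lambda>z. S z * f z) (\<lambda>z. K2 z w)"
    by (simp only: H2.inner_scale_right)
  also have "dB_inner E2 (\<lambda>z. S z * f z) (\<lambda>z. K2 z w) = S w * f w"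
    by (rule K2.K_reproducing[OF mult_S_in_space[OF f], symmetric])
  also have "cnj (1 / cnj (S w)) * (S w * f w) = f w" using S_nonzero[of w] by simp
  also have "f w = dB_inner E1 f (\<lambda>z. K1 z w)" by (rule K1.K_reproducing[OF f])
  finally show ?thesis .
qed

text \<open>Inner products with kernels are preserved since both sides evaluate \<open>f\<close>. For a combination \<open>q\<close> of
kernels close to \<open>f\<close>, the defect of \<open>\<parallel>f\<parallel>\<^sup>2\<close> is thus controlled by \<open>f - q\<close>, where boundedness suffices.\<close>

lemma norm_mult_S:
  assumes f: "f \<in> H1.H"
  shows "dB_norm E2 (\<lambda>z. S z * f z) = dB_norm E1 f"
proof -
  let ?Sf = "\<lambda>z. S z * f z"
  define I where "I = dB_inner E2 ?Sf ?Sf - dB_inner E1 f f"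
  have SfH: "?Sf \<in> H2.H" by (rule mult_S_in_space[OF f])
  \<comment> \<open>the constant by which the defect is bounded in terms of the distance from \<open>f\<close> to \<open>q\<close>\<close>
  define C where "C = dB_norm E2 ?Sf * (1 / gap) + dB_norm E1 f"
  have C: "C \<ge> 0" using H1.norm_nonneg H2.norm_nonneg gap_pos by (simp add: C_def)
  have le: "cmod I \<le> C * e" if e: "e > 0" for e
  proof -
    obtain A :: "int set" and c y where A: "finite A" "dB_norm E1 (\<lambda>z. f z - (\<Sum>n\<in>A. c n * K1 z (y n))) < e"
      using dense[OF f e] by blast
    define q where "q = (\<lambda>z. \<Sum>n\<in>A. c n * K1 z (y n))"
    define p where "p = (\<lambda>z. f z - q z)"
    have qH: "q \<in> H1.H" unfolding q_def by (intro deBranges_space_sum K1.K_in_space)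
    have pH: "p \<in> H1.H" unfolding p_def by (intro deBranges_space_diff f qH)
    have np: "dB_norm E1 p \<le> e" using A(2) by (simp add: p_def q_def)
    have "(\<lambda>z. S z * q z) = (\<lambda>z. \<Sum>n\<in>A. c n * (S z * K1 z (y n)))"
      by (auto simp: q_def sum_distrib_left mult_ac intro!: sum.cong)
    then have "dB_inner E2 ?Sf (\<lambda>z. S z * q z) = (\<Sum>n\<in>A. cnj (c n) * dB_inner E2 ?Sf (\<lambda>z. S z * K1 z (y n)))"
      using H2.inner_sum_right[of A "\<lambda>n z. S z * K1 z (y n)" ?Sf c] SfH mult_S_in_space[OF K1.K_in_space] by simp
    also have "\<dots> = (\<Sum>n\<in>A. cnj (c n) * dB_inner E1 f (\<lambda>z. K1 z (y n)))" by (simp add: inner_mult_S_kernel[OF f])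
    also have "\<dots> = dB_inner E1 f q"
      unfolding q_def by (rule H1.inner_sum_right[symmetric]) (use K1.K_in_space f in auto)
    finally have q: "dB_inner E2 ?Sf (\<lambda>z. S z * q z) = dB_inner E1 f q" .
    have "?Sf = (\<lambda>z. S z * p z + S z * q z)" "f = (\<lambda>z. p z + q z)" by (auto simp: p_def algebra_simps)
    then have "dB_inner E2 ?Sf ?Sf = dB_inner E2 ?Sf (\<lambda>z. S z * p z) + dB_inner E2 ?Sf (\<lambda>z. S z * q z)"
      "dB_inner E1 f f = dB_inner E1 f p + dB_inner E1 f q"
      using H2.inner_add_right[OF mult_S_in_space[OF pH] mult_S_in_space[OF qH] SfH] H1.inner_add_right[OF pH qH f] by auto
    then have "I = dB_inner E2 ?Sf (\<lambda>z. S z * p z) - dB_inner E1 f p" unfolding I_def q by simp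
    then have "cmod I \<le> cmod (dB_inner E2 ?Sf (\<lambda>z. S z * p z)) + cmod (dB_inner E1 f p)" by (simp add: norm_triangle_ineq4)
    also have "\<dots> \<le> dB_norm E2 ?Sf * dB_norm E2 (\<lambda>z. S z * p z) + dB_norm E1 f * dB_norm E1 p"
      by (intro add_mono H2.inner_Cauchy_Schwarz H1.inner_Cauchy_Schwarz SfH f pH mult_S_in_space)
    also have "\<dots> \<le> dB_norm E2 ?Sf * ((1 / gap) * e) + dB_norm E1 f * e"
    proof (intro add_mono mult_left_mono H1.norm_nonneg H2.norm_nonneg np)
      have "dB_norm E2 (\<lambda>z. S z * p z) \<le> (1 / gap) * dB_norm E1 p" by (rule norm_mult_S_le[OF pH])
      also have "\<dots> \<le> (1 / gap) * e" using gap_pos np by (intro mult_left_mono) auto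
      finally show "dB_norm E2 (\<lambda>z. S z * p z) \<le> (1 / gap) * e" .
    qed
    also have "\<dots> = C * e" by (simp add: C_def algebra_simps)
    finally show ?thesis .
  qed
  have "cmod I \<le> 0 + e" if "e > 0" for e
  proof -
    have "cmod I \<le> C * (e / (C + 1))" by (rule le) (use that C in auto)
    also have "\<dots> \<le> (C + 1) * (e / (C + 1))" using that C by (intro mult_right_mono) auto
    also have "\<dots> = e" using C by simp
    finally show ?thesis by simp
  qed
  then have "cmod I \<le> 0" by (rule field_le_epsilon)
  then have "dB_inner E2 ?Sf ?Sf = dB_inner E1 f f" by (simp add: I_def)
  then have "(dB_norm E2 ?Sf)\<^sup>2 = (dB_norm E1 f)\<^sup>2" unfolding H1.inner_self H2.inner_self by (simp only: of_real_eq_iff)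
  then show ?thesis using H1.norm_nonneg H2.norm_nonneg by (simp add: power2_eq_iff_nonneg)
qed

lemma isometry: "dB_isometry E1 E2 (\<lambda>f z. S z * f z)"
  unfolding dB_isometry_def
proof (intro conjI ballI)
  show "(\<lambda>f z. S z * f z) ` H1.H \<subseteq> H2.H" using mult_S_in_space by auto
  fix f g assume fg: "f \<in> H1.H" "g \<in> H1.H"
  have "dB_norm E2 (\<lambda>z. S z * (f z - g z)) = dB_norm E1 (\<lambda>z. f z - g z)"
    by (rule norm_mult_S[OF deBranges_space_diff[OF fg]])
  then show "dB_norm E2 (\<lambda>z. S z * f z - S z * g z) = dB_norm E1 (\<lambda>z. f z - g z)"
    by (simp add: right_diff_distrib)
qed

end

section \<open>Equal intensities\<close>

lemma (in phase_space) E_real_phase_curve: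
  "E (of_real x) = of_real (cmod (E (of_real x)) / curve.amp x) * (of_real (curve.u x) - \<i> * of_real (curve.w x))"
proof -
  have "of_real (curve.u x) - \<i> * of_real (curve.w x) = of_real (curve.amp x) * cis (- \<phi> x)"
    by (simp add: curve.u_def curve.w_def complex_eq_iff)
  then show ?thesis using curve.amp_pos[of x] by (subst (1) E_polar) simp
qed

theorem theorem1p9:
  fixes E1 E2 :: "complex \<Rightarrow> complex"
    and \<phi>1 \<phi>2 :: "real \<Rightarrow> real"
    and K1 K2 :: "complex \<Rightarrow> complex \<Rightarrow> complex"
    and M1 :: "'a measure" and M2 :: "'b measure"
    and F1 :: "'a \<Rightarrow> complex \<Rightarrow> complex" and F2 :: "'b \<Rightarrow> complex \<Rightarrow> complex"
    and \<rho>1 \<rho>2 :: "real \<Rightarrow> real"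
  assumes "hermite_biehler E1" and "no_real_zeros E1"
    and "hermite_biehler E2" and "no_real_zeros E2"
    and "phase_function E1 \<phi>1" and "phase_function E2 \<phi>2"
    and "reproducing_kernel E1 K1" and "reproducing_kernel E2 K2"
    and "deBranges_GAF M1 E1 K1 \<phi>1 F1" and "deBranges_GAF M2 E2 K2 \<phi>2 F2"
    and "first_intensity M1 F1 \<rho>1" and "first_intensity M2 F2 \<rho>2"
    and "\<forall>x. \<rho>1 x = \<rho>2 x"
  shows "\<exists>S. entire S \<and> (\<forall>z. S z \<noteq> 0) \<and>
           (\<forall>z w. K2 z w = S z * K1 z w * cnj (S w)) \<and>
           dB_isometry E1 E2 (\<lambda>f z. S z * f z)"
proof -
  interpret G1: gaussian_space E1 K1 \<phi>1 M1 F1 by unfold_locales fact+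
  interpret G2: gaussian_space E2 K2 \<phi>2 M2 F2 by unfold_locales fact+
  have Q: "G1.curve.Q x = G2.curve.Q x" for x
  proof -
    have "sqrt (G1.curve.Q x / 3) / pi = sqrt (G2.curve.Q x / 3) / pi"
      using G1.intensity_formula[OF assms(11)] G2.intensity_formula[OF assms(12)] assms(13) by metis
    then show ?thesis by simp
  qed
  obtain a b c d where det: "a * d - b * c = 1"
    and u2: "\<And>x. G2.curve.u x = a * G1.curve.u x + b * G1.curve.w x"
    and w2: "\<And>x. G2.curve.w x = c * G1.curve.u x + d * G1.curve.w x"
    using phase_curves_related[OF G1.curve.phase_curve_axioms G2.curve.phase_curve_axioms Q] by metis
  \<comment> \<open>real and imaginary parts come from writing \<open>u\<^sub>2 - i w\<^sub>2\<close> in terms of \<open>u\<^sub>1 - i w\<^sub>1\<close> and its conjugate\<close>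
  define \<alpha> where "\<alpha> = Complex ((a + d) / 2) ((b - c) / 2)"
  define \<beta> where "\<beta> = Complex ((a - d) / 2) (- (b + c) / 2)"
  define s where "s x = (cmod (E2 (of_real x)) / G2.curve.amp x) * (G1.curve.amp x / cmod (E1 (of_real x)))" for x :: real
  interpret T: moebius_kernel_spaces E1 E2 \<alpha> \<beta> s K1 K2
  proof unfold_locales
    show "(cmod \<alpha>)\<^sup>2 - (cmod \<beta>)\<^sup>2 = 1"
      using det unfolding cmod_power2 \<alpha>_def \<beta>_def by (simp add: power2_eq_square field_simps)
    show "E2 (of_real x) = of_real (s x) * (\<alpha> * E1 (of_real x) + \<beta> * cnj (E1 (of_real x)))" for x
    proof -
      define r1 where "r1 = cmod (E1 (of_real x)) / G1.curve.amp x"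
      define r2 where "r2 = cmod (E2 (of_real x)) / G2.curve.amp x"
      have "E1 (of_real x) \<noteq> 0" using G1.E_nonzero by simp
      then have r1: "r1 \<noteq> 0" using G1.curve.amp_pos[of x] by (simp add: r1_def)
      have s: "s x = r2 / r1" by (simp add: s_def r1_def r2_def)
      have e: "of_real (G2.curve.u x) - \<i> * of_real (G2.curve.w x) = 
         \<alpha> * (of_real (G1.curve.u x) - \<i> * of_real (G1.curve.w x)) + \<beta> * cnj (of_real (G1.curve.u x) - \<i> * of_real (G1.curve.w x))"
        unfolding u2 w2 by (simp add: complex_eq_iff \<alpha>_def \<beta>_def field_simps)
      have "E2 (of_real x) = of_real r2 * (of_real (G2.curve.u x) - \<i> * of_real (G2.curve.w x))"
        unfolding r2_def by (rule G2.E_real_phase_curve)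
      also have "\<dots> = of_real (s x) * (\<alpha> * (of_real r1 * (of_real (G1.curve.u x) - \<i> * of_real (G1.curve.w x))) + \<beta> * cnj (of_real r1 * (of_real (G1.curve.u x) - \<i> * of_real (G1.curve.w x))))"
        unfolding e s using r1 by (simp add: field_simps)
      also have "of_real r1 * (of_real (G1.curve.u x) - \<i> * of_real (G1.curve.w x)) = E1 (of_real x)"
        unfolding r1_def by (rule G1.E_real_phase_curve[symmetric])
      finally show ?thesis .
    qed
    show "\<exists>A :: int set. \<exists>c y. finite A \<and> dB_norm E1 (\<lambda>z. f z - (\<Sum>n\<in>A. c n * K1 z (y n))) < e"
      if "f \<in> deBranges_space E1" "e > 0" for f e
      using G1.kernels_dense[OF that] by metis
  qed
  show ?thesis
    using T.S_entire T.S_nonzero T.kernel_transform T.isometry by blast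
qed

end
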